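(* Let $C\in\mathbb{R}^{d\times d}$ satisfy Condition A, and let $L$ be the Fokker–Planck operator $Lf=-\mathrm{div}_x(C_S\nabla_xf+Cxf)$ on $\mathcal H$. Then the (finite) hypocoercivity index of $C$ is $m_{HC}\in\mathbb N_0$ if and only if $$\big\|e^{-Lt}\big\|_{\mathcal B(V_0^\perp)}=1-ct^{\alpha}+\mathcal O(t^{\alpha+1})\qquad\text{as } t\to0^+,$$ for some $c>0$, where $\alpha=2m_{HC}+1$.
   Context: $C_S=\frac12(C+C^T)$, $C_{AS}=\frac12(C-C^T)$. Condition A: (1) $C_S$ positive semi-definite; (2) no non-trivial $C^T$-invariant subspace of $\ker C_S$. The hypocoercivity index $m_{HC}$ is the minimal $m\in\mathbb N_0$ such that $\sum_{j=0}^m C_{AS}^jC_S(C_{AS}^T)^j$ is positive definite (finite under Condition A). $f_\infty(x)=(2\pi)^{-d/2}e^{-|x|^2/2}$, $\mathcal H=L^2(\mathbb R^d,f_\infty^{-1})$ with inner product $\int fgf_\infty^{-1}dx$, $e^{-Lt}$ the solution operator of $\partial_tf=-Lf$, $V_0=\mathrm{span}\{f_\infty\}$, $\Pi_0f=\langle f,f_\infty\rangle_{\mathcal H}f_\infty$, and $\|e^{-Lt}\|_{\mathcal B(V_0^\perp)}=\sup_{0\ne f_0\in\mathcal H}\|e^{-Lt}f_0-\Pi_0f_0\|_{\mathcal H}/\|f_0\|_{\mathcal H}$. *)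

theory Defs
  imports "HOL-Analysis.Analysis" "HOL-Library.Landau_Symbols"
begin

fun mat_pow :: "real^'n^'n \<Rightarrow> nat \<Rightarrow> real^'n^'n" where
  "mat_pow A 0 = mat 1"
| "mat_pow A (Suc k) = A ** mat_pow A k"

definition sym_part :: "real^'n^'n \<Rightarrow> real^'n^'n" where
  "sym_part C = (1/2) *\<^sub>R (C + transpose C)"

definition asym_part :: "real^'n^'n \<Rightarrow> real^'n^'n" where
  "asym_part C = (1/2) *\<^sub>R (C - transpose C)"

definition pos_semidef :: "real^'n^'n \<Rightarrow> bool" where
  "pos_semidef M \<longleftrightarrow> (\<forall>x. 0 \<le> x \<bullet> (M *v x))"

definition pos_def :: "real^'n^'n \<Rightarrow> bool" where
  "pos_def M \<longleftrightarrow> (\<forall>x. x \<noteq> 0 \<longrightarrow> 0 < x \<bullet> (M *v x))"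

definition condition_A :: "real^'n^'n \<Rightarrow> bool" where
  "condition_A C \<longleftrightarrow> pos_semidef (sym_part C) \<and>
     (\<forall>V. subspace V \<and> V \<subseteq> {x. sym_part C *v x = 0} \<and> (\<forall>v\<in>V. transpose C *v v \<in> V)
          \<longrightarrow> V = {0})"

definition hc_index :: "real^'n^'n \<Rightarrow> nat" where
  "hc_index C = (LEAST m. pos_def (\<Sum>j\<le>m. mat_pow (asym_part C) j ** sym_part C
                                          ** mat_pow (transpose (asym_part C)) j))"

definition f_inf :: "real^'n \<Rightarrow> real" where
  "f_inf x = (2*pi) powr (- real CARD('n) / 2) * exp (- (norm x)\<^sup>2 / 2)"

definition in_H :: "(real^'n \<Rightarrow> real) \<Rightarrow> bool" where
  "in_H f \<longleftrightarrow> f \<in> borel_measurable lborel \<and> integrable lborel (\<lambda>x. (f x)\<^sup>2 / f_inf x)"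

definition H_norm :: "(real^'n \<Rightarrow> real) \<Rightarrow> real" where
  "H_norm f = sqrt (\<integral>x. (f x)\<^sup>2 / f_inf x \<partial>lborel)"

text \<open>Pi_0 f = <f, f_inf>_H f_inf = (\<integral> f) f_inf.\<close>
definition Pi0 :: "(real^'n \<Rightarrow> real) \<Rightarrow> (real^'n \<Rightarrow> real)" where
  "Pi0 f = (\<lambda>x. (\<integral>y. f y * f_inf y / f_inf y \<partial>lborel) * f_inf x)"

definition test_fun :: "(real^'n \<Rightarrow> real) \<Rightarrow> (real^'n \<Rightarrow> real^'n) \<Rightarrow> (real^'n \<Rightarrow> real^'n^'n) \<Rightarrow> bool" where
  "test_fun \<phi> g Hs \<longleftrightarrow>
     (\<forall>x. (\<phi> has_derivative (\<lambda>h. g x \<bullet> h)) (at x)) \<and>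
     (\<forall>x. (g has_derivative (\<lambda>h. Hs x *v h)) (at x)) \<and>
     continuous_on UNIV Hs \<and> bounded {x. \<phi> x \<noteq> 0}"

text \<open>Formal adjoint of -L applied to a test function:
  -L^* \<phi> = div(C_S \<nabla>\<phi>) - Cx\<cdot>\<nabla>\<phi>, where L f = - div(C_S \<nabla> f + C x f).\<close>
definition FP_adj :: "real^'n^'n \<Rightarrow> (real^'n \<Rightarrow> real^'n) \<Rightarrow> (real^'n \<Rightarrow> real^'n^'n) \<Rightarrow> real^'n \<Rightarrow> real" where
  "FP_adj C g Hs x = (\<Sum>i\<in>UNIV. \<Sum>j\<in>UNIV. sym_part C $ i $ j * Hs x $ i $ j) - (C *v x) \<bullet> g x"

definition FP_solution :: "real^'n^'n \<Rightarrow> (real^'n \<Rightarrow> real) \<Rightarrow> (real \<Rightarrow> real^'n \<Rightarrow> real) \<Rightarrow> bool" where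
  "FP_solution C f0 u \<longleftrightarrow>
     (\<forall>t\<ge>0. in_H (u t)) \<and>
     H_norm (\<lambda>x. u 0 x - f0 x) = 0 \<and>
     (\<forall>t\<ge>0. ((\<lambda>s. H_norm (\<lambda>x. u s x - u t x)) \<longlongrightarrow> 0) (at t within {0..})) \<and>
     (\<forall>\<phi> g Hs. test_fun \<phi> g Hs \<longrightarrow> (\<forall>t\<ge>0.
        ((\<lambda>s. \<integral>x. u s x * \<phi> x \<partial>lborel) has_real_derivative
           (\<integral>x. u t x * FP_adj C g Hs x \<partial>lborel)) (at t within {0..})))"

text \<open>(e^{-Lt} f0)(x), with an (essentially unique) solution chosen.\<close>
definition FP_evol :: "real^'n^'n \<Rightarrow> real \<Rightarrow> (real^'n \<Rightarrow> real) \<Rightarrow> real^'n \<Rightarrow> real" where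
  "FP_evol C t f0 = (SOME u. FP_solution C f0 u) t"

definition FP_norm_V0perp :: "real^'n^'n \<Rightarrow> real \<Rightarrow> real" where
  "FP_norm_V0perp C t = (SUP f0 \<in> {f. in_H f \<and> H_norm f \<noteq> 0}.
      H_norm (\<lambda>x. FP_evol C t f0 x - Pi0 f0 x) / H_norm f0)"

end

(*
  Dividing by the equilibrium turns the weighted space into L^2 of the Gaussian measure, where the
  vectors coh xi = exp(xi . x - |xi|^2/2) are total and have the inner products exp(xi . eta).
  Testing the equation with coh xi gives a transport equation in xi whose characteristics are
  xi' = C^T xi, so the semigroup is the second quantization of exp(-C t): it sends coh eta to
  coh(exp(-C t) eta).  Schur's product theorem, applied to the Gram matrices of the coherent
  vectors, shows that its norm on the complement of the equilibrium is the matrix norm of exp(-C t);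
  the vectors coh(s x) - coh 0 with s tending to 0 show that this bound is attained.

  For the matrix norm, |exp(-C t) x|^2 loses 2 times the integral of x(s) . C_S x(s) over [0, t].  Decompose x
  along the decreasing spaces of vectors v with C_S C_AS^i v = 0 for all i < j and rescale the j-th component by
  t^(m - j): the dissipated energy becomes t^(2m+1) times a positive definite quadratic form, up to a
  relative error O(t).  Its infimum under a normalized last component is the constant c.
*)
theory Submission
  imports Defs "HOL-Probability.Probability"
begin

subsection \<open>The Gaussian measure\<close>

text \<open>\<open>FP_evol\<close> is merely some weak solution, tested against compactly supported
  C^2 functions, so its norm cannot be computed before existence and uniqueness are both settled.
  Coherent vectors settle existence because, multiplied by the equilibrium, they are its translates:
  these solve the equation exactly while their centres move by exp(-C t), and density carries this
  over to all data. The norm bound rests on a kernel inequality from which the degree-0 term of exp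
  is subtracted: that term is the equilibrium, and in each remaining degree n the natural factor
  |exp(-C t)|^(2n) is at most |exp(-C t)|^2. Only the forward implication needs analysis: an
  expansion whose error is of strictly higher order determines its leading exponent, so the index
  can be read back from it.\<close>

lemma f_inf_pos: "f_inf x > 0"
  by (simp add: f_inf_def)

lemma f_inf_continuous: "continuous_on A f_inf"
  unfolding f_inf_def by (intro continuous_intros) auto

lemma f_inf_measurable [measurable]: "f_inf \<in> borel_measurable borel"
  by (intro borel_measurable_continuous_onI f_inf_continuous)

text \<open>Used for two variances: sigma = 1 identifies \<open>f_inf\<close> as a product of
  probability densities, and sigma = 2 gives the integrable majorant exp(-|x|^2/8).\<close>

lemma prod_normal_density:
  fixes x :: "real^'n"
  assumes "\<sigma> > 0"
  shows "(\<Prod>b\<in>Basis. normal_density 0 \<sigma> (x \<bullet> b))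
    = (1 / sqrt (2 * pi * \<sigma>\<^sup>2)) ^ CARD('n) * exp (- (norm x)\<^sup>2 / (2 * \<sigma>\<^sup>2))"
proof -
  have "(\<Prod>b\<in>Basis. normal_density 0 \<sigma> (x \<bullet> b))
      = (\<Prod>b\<in>(Basis::(real^'n) set). 1 / sqrt (2 * pi * \<sigma>\<^sup>2))
        * (\<Prod>b\<in>Basis. exp (-((x \<bullet> b)\<^sup>2) / (2 * \<sigma>\<^sup>2)))"
    by (simp only: normal_density_def prod.distrib diff_zero)
  also have "(\<Prod>b\<in>Basis. exp (-((x \<bullet> b)\<^sup>2) / (2 * \<sigma>\<^sup>2))) = exp (\<Sum>b\<in>Basis. -((x \<bullet> b)\<^sup>2) / (2 * \<sigma>\<^sup>2))"
    by (simp add: exp_sum)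
  also have "(\<Sum>b\<in>Basis. -((x \<bullet> b)\<^sup>2) / (2 * \<sigma>\<^sup>2)) = - (norm x)\<^sup>2 / (2 * \<sigma>\<^sup>2)"
    unfolding power2_norm_eq_inner by (subst euclidean_inner)
      (simp add: sum_negf sum_divide_distrib power2_eq_square)
  finally show ?thesis by simp
qed

lemma nn_integral_normal_density:
  assumes "\<sigma> > 0" shows "(\<integral>\<^sup>+x. ennreal (normal_density 0 \<sigma> x) \<partial>lborel) = 1"
proof -
  interpret prob_space "density lborel (normal_density 0 \<sigma>)"
    by (rule prob_space_normal_density[OF assms])
  show ?thesis using emeasure_space_1 by (simp add: emeasure_density)
qed

lemma nn_integral_prod_normal_density:
  assumes "\<sigma> > 0"
  shows "(\<integral>\<^sup>+x. ennreal (\<Prod>b\<in>Basis. normal_density 0 \<sigma> ((x::real^'n) \<bullet> b)) \<partial>lborel) = 1"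
proof -
  have "(\<integral>\<^sup>+x. ennreal (\<Prod>b\<in>Basis. normal_density 0 \<sigma> ((x::real^'n) \<bullet> b)) \<partial>lborel)
     = (\<integral>\<^sup>+x. (\<Prod>b\<in>Basis. ennreal (normal_density 0 \<sigma> ((x::real^'n) \<bullet> b))) \<partial>lborel)"
    by (simp add: prod_ennreal)
  also have "\<dots> = 1"
    by (subst nn_integral_lborel_prod) (use nn_integral_normal_density[OF assms] in simp_all)
  finally show ?thesis .
qed

lemma f_inf_eq_prod: "f_inf (x::real^'n) = (\<Prod>b\<in>Basis. normal_density 0 1 (x \<bullet> b))"
proof -
  have "1 / sqrt (2 * pi) = (2 * pi) powr (- 1 / 2)"
    using powr_minus_divide[of "2 * pi" "1 / 2"] powr_half_sqrt[of "2 * pi"] by simp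
  then have "(1 / sqrt (2 * pi)) ^ CARD('n) = ((2 * pi) powr (- 1 / 2)) powr CARD('n)"
    by (subst powr_realpow) auto
  then have "(2 * pi) powr (- real CARD('n) / 2) = (1 / sqrt (2 * pi)) ^ CARD('n)"
    by (simp only: powr_powr) simp
  then show ?thesis
    by (subst prod_normal_density) (simp_all add: f_inf_def)
qed

lemma nn_integral_f_inf: "(\<integral>\<^sup>+x. ennreal (f_inf x) \<partial>lborel) = 1"
  unfolding f_inf_eq_prod by (rule nn_integral_prod_normal_density) simp

lemma integrable_gaussian_exp: "integrable lborel (\<lambda>x::real^'n. exp (- (norm x)\<^sup>2 / 8))"
proof -
  have "integrable lborel (\<lambda>x::real^'n. \<Prod>b\<in>Basis. normal_density 0 2 (x \<bullet> b))"
    by (rule integrableI_nonneg)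
       (use nn_integral_prod_normal_density[of 2, where 'n = 'n] in \<open>auto intro!: prod_nonneg simp: less_top[symmetric]\<close>)
  then have "integrable lborel (\<lambda>x::real^'n. sqrt (8 * pi) ^ CARD('n) * (\<Prod>b\<in>Basis. normal_density 0 2 (x \<bullet> b)))"
    by simp
  then show ?thesis
    by (subst (asm) prod_normal_density) (simp_all add: power_divide)
qed

definition gauss :: "(real^'n) measure" where
  "gauss = density lborel (\<lambda>x. ennreal (f_inf x))"

lemma sets_gauss [simp, measurable_cong]: "sets gauss = sets borel"
  by (simp add: gauss_def)

lemma space_gauss [simp]: "space gauss = UNIV"
  by (simp add: gauss_def)

interpretation gauss: prob_space gauss
  by standard (simp add: gauss_def emeasure_density nn_integral_f_inf)

lemma integrable_gauss_iff:
  assumes "g \<in> borel_measurable borel"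
  shows "integrable gauss g \<longleftrightarrow> integrable lborel (\<lambda>x. g x * f_inf x)"
  unfolding gauss_def using assms
  by (subst integrable_density) (auto simp: f_inf_pos less_imp_le mult.commute)

lemma integral_gauss:
  assumes "g \<in> borel_measurable borel"
  shows "(\<integral>x. g x \<partial>gauss) = (\<integral>x. g x * f_inf x \<partial>lborel)"
  unfolding gauss_def using assms
  by (subst integral_density) (auto simp: f_inf_pos less_imp_le mult.commute)

text \<open>The weight exp(|x|^2/4) uses up only half of the decay exp(-|x|^2/2), so any linear
  exponent can still be absorbed. The resulting square integrable functions exp(a |x| + |x|^2/8) are
  the majorants of the later limit arguments.\<close>

lemma integrable_gauss_exp_norm:
  fixes a :: real
  shows "integrable gauss (\<lambda>x::real^'n. exp (a * norm x + (norm x)\<^sup>2 / 4))"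
proof (subst integrable_gauss_iff)
  show "integrable lborel (\<lambda>x::real^'n. exp (a * norm x + (norm x)\<^sup>2 / 4) * f_inf x)"
  proof (rule Bochner_Integration.integrable_bound)
    let ?K = "(2*pi) powr (- real CARD('n) / 2) * exp (2 * a\<^sup>2)"
    show "integrable lborel (\<lambda>x::real^'n. ?K * exp (- (norm x)\<^sup>2 / 8))"
      using integrable_gaussian_exp by simp
    have "exp (a * norm x + (norm x)\<^sup>2 / 4) * exp (- (norm x)\<^sup>2 / 2) \<le> exp (2 * a\<^sup>2) * exp (- (norm x)\<^sup>2 / 8)"
      for x :: "real^'n"
    proof -
      have "0 \<le> (norm x / 2 - 2 * a)\<^sup>2 / 2" by simp
      then have "a * norm x + (norm x)\<^sup>2 / 4 - (norm x)\<^sup>2 / 2 \<le> 2 * a\<^sup>2 - (norm x)\<^sup>2 / 8"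
        by (simp add: power2_eq_square algebra_simps)
      then show ?thesis by (simp flip: exp_add)
    qed
    from mult_left_mono[OF this, of "(2*pi) powr (- real CARD('n) / 2)"]
    show "AE x::real^'n in lborel. norm (exp (a * norm x + (norm x)\<^sup>2 / 4) * f_inf x) \<le> norm (?K * exp (- (norm x)\<^sup>2 / 8))"
      by (auto simp: f_inf_def abs_mult mult_ac)
  qed measurable
qed measurable

section \<open>Translations and exponential moments of the Gaussian measure\<close>

lemma integrable_lborel_shift:
  fixes f :: "real^'n \<Rightarrow> real"
  assumes "f \<in> borel_measurable borel"
  shows "integrable lborel (\<lambda>x. f (c + x)) \<longleftrightarrow> integrable lborel f"
  using integrable_distr_eq[of "(+) c" "lborel" borel f] assms
  by (simp add: lborel_distr_plus)

lemma integral_lborel_shift: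
  fixes f :: "real^'n \<Rightarrow> real"
  assumes "f \<in> borel_measurable borel"
  shows "(\<integral>x. f (c + x) \<partial>lborel) = (\<integral>x. f x \<partial>lborel)"
  using integral_distr[of "(+) c" "lborel" borel f] assms
  by (simp add: lborel_distr_plus)

text \<open>Completing the square: an exponential tilt of the Gaussian is a translate of it.
  Exponential moments, and later the pairings with coherent vectors, thereby reduce to translation
  invariance of Lebesgue measure.\<close>

lemma exp_times_f_inf: "exp (\<xi> \<bullet> x) * f_inf x = exp ((norm \<xi>)\<^sup>2 / 2) * f_inf (x - \<xi>)"
  unfolding f_inf_def
  by (simp add: power2_norm_eq_inner inner_diff_left inner_diff_right inner_commute
     diff_divide_distrib add_divide_distrib flip: exp_add)

lemma integrable_f_inf: "integrable lborel f_inf"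
  by (rule integrableI_nonneg) (auto simp: nn_integral_f_inf f_inf_pos less_imp_le)

lemma integral_f_inf: "(\<integral>x. f_inf x \<partial>lborel) = 1"
  by (subst integral_eq_nn_integral) (auto simp: nn_integral_f_inf f_inf_pos less_imp_le)

lemma integrable_gauss_exp: "integrable gauss (\<lambda>x. exp (\<xi> \<bullet> x))"
  using integrable_f_inf integrable_lborel_shift[of f_inf "-\<xi>"]
  by (subst integrable_gauss_iff) (auto simp: exp_times_f_inf)

lemma integral_gauss_exp: "(\<integral>x. exp (\<xi> \<bullet> x) \<partial>gauss) = exp ((norm \<xi>)\<^sup>2 / 2)"
  using integral_f_inf integral_lborel_shift[of f_inf "-\<xi>"]
  by (subst integral_gauss) (auto simp: exp_times_f_inf)

subsection \<open>The Hilbert space of square integrable functions\<close>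

definition sq_int :: "(real^'n \<Rightarrow> real) \<Rightarrow> bool" where
  "sq_int f \<longleftrightarrow> f \<in> borel_measurable borel \<and> integrable gauss (\<lambda>x. (f x)\<^sup>2)"

lemma sq_int_measurable [measurable_dest]: "sq_int f \<Longrightarrow> f \<in> borel_measurable borel"
  by (simp add: sq_int_def)

lemma sq_int_mult:
  assumes "sq_int f" "sq_int g"
  shows "integrable gauss (\<lambda>x. f x * g x)"
proof (rule Bochner_Integration.integrable_bound)
  show "integrable gauss (\<lambda>x. (f x)\<^sup>2 + (g x)\<^sup>2)"
    using assms by (auto simp: sq_int_def)
  show "(\<lambda>x. f x * g x) \<in> borel_measurable gauss"
    using assms by (auto simp: sq_int_def)
  show "AE x in gauss. norm (f x * g x) \<le> norm ((f x)\<^sup>2 + (g x)\<^sup>2)"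
  proof (rule AE_I2)
    fix x
    have "\<bar>f x * g x\<bar> \<le> (f x)\<^sup>2 + (g x)\<^sup>2"
      using sum_squares_bound[of "\<bar>f x\<bar>" "\<bar>g x\<bar>"] mult_nonneg_nonneg[OF abs_ge_zero abs_ge_zero, of "f x" "g x"]
      unfolding abs_mult power2_abs mult.assoc by linarith
    then show "norm (f x * g x) \<le> norm ((f x)\<^sup>2 + (g x)\<^sup>2)" by simp
  qed
qed

lemma sq_int_bound:
  assumes "sq_int g" "f \<in> borel_measurable borel" "\<And>x. \<bar>f x\<bar> \<le> \<bar>g x\<bar>"
  shows "sq_int f"
  unfolding sq_int_def
proof
  show "integrable gauss (\<lambda>x. (f x)\<^sup>2)"
  proof (rule Bochner_Integration.integrable_bound)
    show "integrable gauss (\<lambda>x. (g x)\<^sup>2)" using assms by (simp add: sq_int_def)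
    show "AE x in gauss. norm ((f x)\<^sup>2) \<le> norm ((g x)\<^sup>2)"
      using assms(3) by (auto simp: abs_le_square_iff)
  qed (use assms in auto)
qed (use assms in auto)

lemma sq_int_0: "sq_int (\<lambda>x. 0)"
  by (simp add: sq_int_def)

lemma sq_int_scale: "sq_int f \<Longrightarrow> sq_int (\<lambda>x. a * f x)"
  by (auto simp: sq_int_def power_mult_distrib)

lemma sq_int_add:
  assumes "sq_int f" "sq_int g" shows "sq_int (\<lambda>x. f x + g x)"
  using assms sq_int_mult[OF assms]
  by (auto simp: sq_int_def power2_sum mult.assoc)

lemma sq_int_uminus: "sq_int f \<Longrightarrow> sq_int (\<lambda>x. - f x)"
  using sq_int_scale[of f "-1"] by simp

lemma sq_int_diff:
  assumes "sq_int f" "sq_int g" shows "sq_int (\<lambda>x. f x - g x)"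
  using sq_int_add[OF assms(1) sq_int_uminus[OF assms(2)]] by simp

lemma sq_int_const: "sq_int (\<lambda>x. c)"
  by (auto simp: sq_int_def)

lemma sq_int_bounded:
  assumes "f \<in> borel_measurable borel" "\<And>x. \<bar>f x\<bar> \<le> B"
  shows "sq_int f"
  by (rule sq_int_bound[OF sq_int_const[of B] assms(1)]) (use assms(2) abs_ge_self order_trans in blast)

lemma sq_int_exp: "sq_int (\<lambda>x. exp (\<xi> \<bullet> x))"
  unfolding sq_int_def using integrable_gauss_exp[of "2 *\<^sub>R \<xi>"]
  by (auto simp: power2_eq_square mult_exp_exp)

definition gl2_rel :: "(real^'n \<Rightarrow> real) \<Rightarrow> (real^'n \<Rightarrow> real) \<Rightarrow> bool" where
  "gl2_rel f g \<longleftrightarrow> sq_int f \<and> sq_int g \<and> (AE x in gauss. f x = g x)"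

quotient_type 'n gl2 = "real^'n \<Rightarrow> real" / partial: gl2_rel
proof (rule part_equivpI)
  show "\<exists>f. gl2_rel f f" by (rule exI[of _ "\<lambda>x. 0"]) (simp add: gl2_rel_def sq_int_0)
  show "symp gl2_rel" by (intro sympI) (simp add: gl2_rel_def eq_commute)
  show "transp gl2_rel"
    unfolding gl2_rel_def by (intro transpI) (auto elim: AE_mp)
qed

instantiation gl2 :: (finite) real_inner
begin

lift_definition zero_gl2 :: "'a gl2" is "\<lambda>x. 0"
  by (simp add: gl2_rel_def sq_int_0)

lift_definition plus_gl2 :: "'a gl2 \<Rightarrow> 'a gl2 \<Rightarrow> 'a gl2" is "\<lambda>f g x. f x + g x"
  by (auto simp: gl2_rel_def sq_int_add)

lift_definition minus_gl2 :: "'a gl2 \<Rightarrow> 'a gl2 \<Rightarrow> 'a gl2" is "\<lambda>f g x. f x - g x"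
  by (auto simp: gl2_rel_def sq_int_diff)

lift_definition uminus_gl2 :: "'a gl2 \<Rightarrow> 'a gl2" is "\<lambda>f x. - f x"
  by (auto simp: gl2_rel_def sq_int_uminus)

lift_definition scaleR_gl2 :: "real \<Rightarrow> 'a gl2 \<Rightarrow> 'a gl2" is "\<lambda>a f x. a * f x"
  by (auto simp: gl2_rel_def sq_int_scale)

lift_definition inner_gl2 :: "'a gl2 \<Rightarrow> 'a gl2 \<Rightarrow> real" is "\<lambda>f g. \<integral>x. f x * g x \<partial>gauss"
  by (intro integral_cong_AE) (auto simp: gl2_rel_def sq_int_def)

definition "norm_gl2 (x :: 'a gl2) = sqrt (inner x x)"
definition "dist_gl2 (x :: 'a gl2) y = norm (x - y)"
definition "sgn_gl2 (x :: 'a gl2) = scaleR (inverse (norm x)) x"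
definition [code del]: "(uniformity :: ('a gl2 \<times> 'a gl2) filter) = (INF e\<in>{0 <..}. principal {(x, y). dist x y < e})"
definition [code del]: "open (U :: 'a gl2 set) \<longleftrightarrow> (\<forall>x\<in>U. eventually (\<lambda>(x', y). x' = x \<longrightarrow> y \<in> U) uniformity)"

instance
proof
  fix x y z :: "'a gl2" and a b :: real
  show "x + y + z = x + (y + z)" by transfer (simp add: gl2_rel_def sq_int_add add_ac)
  show "x + y = y + x" by transfer (simp add: gl2_rel_def sq_int_add add_ac)
  show "0 + x = x" by transfer (simp add: gl2_rel_def)
  show "- x + x = 0" by transfer (simp add: gl2_rel_def sq_int_0)
  show "x - y = x + - y" by transfer (simp add: gl2_rel_def sq_int_add sq_int_diff sq_int_uminus)
  show "a *\<^sub>R (x + y) = a *\<^sub>R x + a *\<^sub>R y"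
    by transfer (simp add: gl2_rel_def distrib_left sq_int_add sq_int_scale)
  show "(a + b) *\<^sub>R x = a *\<^sub>R x + b *\<^sub>R x"
    by transfer (simp add: gl2_rel_def distrib_right sq_int_add sq_int_scale)
  show "a *\<^sub>R b *\<^sub>R x = (a * b) *\<^sub>R x"
    by transfer (simp add: gl2_rel_def mult.assoc sq_int_scale)
  show "1 *\<^sub>R x = x" by transfer (simp add: gl2_rel_def)
  show "dist x y = norm (x - y)" by (rule dist_gl2_def)
  show "sgn x = scaleR (inverse (norm x)) x" by (rule sgn_gl2_def)
  show "uniformity = (INF e\<in>{0 <..}. principal {(x, y :: 'a gl2). dist x y < e})"
    by (rule uniformity_gl2_def)
  show "open U \<longleftrightarrow> (\<forall>x\<in>U. \<forall>\<^sub>F (x', y) in uniformity. x' = x \<longrightarrow> y \<in> U)" for U :: "'a gl2 set"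
    by (rule open_gl2_def)
  show "norm x = sqrt (x \<bullet> x)" by (rule norm_gl2_def)
  show "x \<bullet> y = y \<bullet> x" by transfer (simp add: mult.commute)
  show "(x + y) \<bullet> z = x \<bullet> z + y \<bullet> z"
    by transfer (simp add: distrib_right gl2_rel_def sq_int_mult)
  show "(a *\<^sub>R x) \<bullet> y = a * (x \<bullet> y)" by transfer (simp add: mult.assoc)
  show "0 \<le> x \<bullet> x" by transfer simp
  show "(x \<bullet> x = 0) = (x = 0)"
  proof transfer
    fix f :: "real^'a \<Rightarrow> real" assume "gl2_rel f f"
    then have f: "sq_int f" by (simp add: gl2_rel_def)
    have i: "integrable gauss (\<lambda>x. f x * f x)" by (rule sq_int_mult[OF f f])
    have "(\<integral>x. f x * f x \<partial>gauss) = 0 \<longleftrightarrow> (AE x in gauss. f x * f x = 0)"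
      by (rule integral_nonneg_eq_0_iff_AE[OF i]) simp
    then show "((\<integral>x. f x * f x \<partial>gauss) = 0) = gl2_rel f (\<lambda>x. 0)"
      using f by (simp add: gl2_rel_def sq_int_0)
  qed
qed

end

lemma gl2_eq_iff:
  "sq_int f \<Longrightarrow> sq_int g \<Longrightarrow> abs_gl2 f = abs_gl2 g \<longleftrightarrow> (AE x in gauss. f x = g x)"
  using Quotient_rel[OF Quotient_gl2, of f g] by (auto simp: gl2_rel_def)

lemma gl2_cases: obtains f where "sq_int f" "h = abs_gl2 f"
proof -
  have "gl2_rel (rep_gl2 h) (rep_gl2 h)" "abs_gl2 (rep_gl2 h) = h"
    using Quotient_rep_reflp[OF Quotient_gl2] Quotient_abs_rep[OF Quotient_gl2] by auto
  then show ?thesis using that[of "rep_gl2 h"] by (simp add: gl2_rel_def)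
qed

lemma sq_int_rep: "sq_int (rep_gl2 h)"
  using Quotient_rep_reflp[OF Quotient_gl2, of h] by (simp add: gl2_rel_def)

lemma abs_rep_gl2 [simp]: "abs_gl2 (rep_gl2 h) = h"
  by (rule Quotient_abs_rep[OF Quotient_gl2])

lemma inner_abs_gl2: "sq_int f \<Longrightarrow> sq_int g \<Longrightarrow> abs_gl2 f \<bullet> abs_gl2 g = (\<integral>x. f x * g x \<partial>gauss)"
  by (rule inner_gl2.abs_eq) (auto simp: gl2_rel_def)

lemma norm_abs_gl2: "sq_int f \<Longrightarrow> norm (abs_gl2 f) = sqrt (\<integral>x. (f x)\<^sup>2 \<partial>gauss)"
  by (simp add: norm_eq_sqrt_inner inner_abs_gl2 power2_eq_square)

lemma diff_abs_gl2: "sq_int f \<Longrightarrow> sq_int g \<Longrightarrow> abs_gl2 f - abs_gl2 g = abs_gl2 (\<lambda>x. f x - g x)"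
  by (rule minus_gl2.abs_eq) (auto simp: gl2_rel_def)

lemma scaleR_abs_gl2: "sq_int f \<Longrightarrow> a *\<^sub>R abs_gl2 f = abs_gl2 (\<lambda>x. a * f x)"
  by (rule scaleR_gl2.abs_eq) (auto simp: gl2_rel_def)

lemma sq_int_integrable: "sq_int f \<Longrightarrow> integrable gauss f"
  using sq_int_mult[OF _ sq_int_const[of 1]] by simp

lemma sq_int_abs: "sq_int f \<Longrightarrow> sq_int (\<lambda>x. \<bar>f x\<bar>)"
  by (auto simp: sq_int_def)

lemma integral_abs_le_norm:
  assumes "sq_int f" shows "(\<integral>x. \<bar>f x\<bar> \<partial>gauss) \<le> norm (abs_gl2 f)"
  using norm_cauchy_schwarz[of "abs_gl2 (\<lambda>x. \<bar>f x\<bar>)" "abs_gl2 (\<lambda>x. 1)"] assms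
  by (simp add: inner_abs_gl2 norm_abs_gl2 sq_int_const sq_int_abs gauss.prob_space[unfolded space_gauss])

lemma nn_integral_power2_diff:
  assumes "sq_int f" "sq_int g"
  shows "(\<integral>\<^sup>+x. ennreal ((f x - g x)\<^sup>2) \<partial>gauss) = ennreal ((dist (abs_gl2 f) (abs_gl2 g))\<^sup>2)"
proof -
  have i: "integrable gauss (\<lambda>x. (f x - g x)\<^sup>2)"
    using sq_int_diff[OF assms] by (simp add: sq_int_def)
  show ?thesis
    by (subst nn_integral_eq_integral[OF i])
       (auto simp: dist_norm diff_abs_gl2 assms norm_abs_gl2 sq_int_diff)
qed

text \<open>Riesz-Fischer for a sequence with geometric rate: on a probability space the L^1 norms
  of the increments are at most their L^2 norms, hence summable, which gives convergence almost
  everywhere; Fatou's lemma then recovers the L^2 rate.\<close>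

lemma gl2_fast_Cauchy_limit:
  assumes f: "\<And>n. sq_int (f n)"
    and fast: "\<And>n k. n \<le> k \<Longrightarrow> dist (abs_gl2 (f k)) (abs_gl2 (f n)) \<le> (1/2) ^ n"
  obtains g where "sq_int g" "\<And>n. dist (abs_gl2 g) (abs_gl2 (f n)) \<le> (1/2) ^ n"
proof -
  have [measurable]: "f n \<in> borel_measurable borel" for n
    using f by (simp add: sq_int_def)
  define D where "D n x = f (Suc n) x - f n x" for n x
  have D: "sq_int (D n)" for n
    unfolding D_def by (intro sq_int_diff f)
  have [measurable]: "D n \<in> borel_measurable borel" for n
    using D by (simp add: sq_int_def)
  have "(\<integral>\<^sup>+x. ennreal \<bar>D n x\<bar> \<partial>gauss) \<le> ennreal ((1/2) ^ n)" for n
  proof -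
    have "(\<integral>x. \<bar>D n x\<bar> \<partial>gauss) \<le> norm (abs_gl2 (D n))"
      by (rule integral_abs_le_norm[OF D])
    also have "\<dots> = dist (abs_gl2 (f (Suc n))) (abs_gl2 (f n))"
      unfolding D_def by (simp add: dist_norm diff_abs_gl2 f)
    also have "\<dots> \<le> (1/2) ^ n" by (rule fast) simp
    finally show ?thesis
      by (subst nn_integral_eq_integral) (auto intro!: sq_int_integrable sq_int_abs D ennreal_leI)
  qed
  then have "(\<Sum>n. \<integral>\<^sup>+x. ennreal \<bar>D n x\<bar> \<partial>gauss) \<le> (\<Sum>n. ennreal ((1/2) ^ n))"
    by (intro suminf_le) auto
  also have "\<dots> = ennreal 2"
    by (rule suminf_ennreal_eq) (use geometric_sums[of "1/2::real"] in auto)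
  finally have "(\<integral>\<^sup>+x. (\<Sum>n. ennreal \<bar>D n x\<bar>) \<partial>gauss) \<noteq> \<infinity>"
    by (subst nn_integral_suminf) (auto simp: top_unique)
  then have "AE x in gauss. (\<Sum>n. ennreal \<bar>D n x\<bar>) \<noteq> \<infinity>"
    by (intro nn_integral_noteq_infinite) auto
  then have conv: "AE x in gauss. convergent (\<lambda>n. f n x)"
  proof eventually_elim
    fix x assume "(\<Sum>n. ennreal \<bar>D n x\<bar>) \<noteq> \<infinity>"
    then have "summable (\<lambda>n. \<bar>D n x\<bar>)" by (intro summable_suminf_not_top) auto
    then have "summable (\<lambda>n. D n x)" by (rule summable_rabs_cancel)
    then have "convergent (\<lambda>n. \<Sum>k<n. D k x)" by (simp add: summable_iff_convergent)
    moreover have "(\<Sum>k<n. D k x) = f n x - f 0 x" for n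
      unfolding D_def by (rule sum_lessThan_telescope)
    ultimately have "convergent (\<lambda>n. f n x - f 0 x)" by simp
    from convergent_add[OF this convergent_const[of "f 0 x"]] show "convergent (\<lambda>n. f n x)" by simp
  qed
  \<comment> \<open>On the null set of divergence the value of \<open>lim\<close> is irrelevant; the
    function is measurable all the same.\<close>
  define g where "g x = lim (\<lambda>n. f n x)" for x
  have [measurable]: "g \<in> borel_measurable borel"
    unfolding g_def by measurable
  have bound: "(\<integral>\<^sup>+x. ennreal ((g x - f n x)\<^sup>2) \<partial>gauss) \<le> ennreal (((1/2) ^ n)\<^sup>2)" for n
  proof -
    have "(\<integral>\<^sup>+x. ennreal ((g x - f n x)\<^sup>2) \<partial>gauss)
        = (\<integral>\<^sup>+x. liminf (\<lambda>k. ennreal ((f k x - f n x)\<^sup>2)) \<partial>gauss)"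
    proof (rule nn_integral_cong_AE)
      show "AE x in gauss. ennreal ((g x - f n x)\<^sup>2) = liminf (\<lambda>k. ennreal ((f k x - f n x)\<^sup>2))"
        using conv
      proof eventually_elim
        fix x assume "convergent (\<lambda>n. f n x)"
        then have "(\<lambda>k. f k x) \<longlonglongrightarrow> g x" by (simp add: g_def convergent_LIMSEQ_iff)
        then have "(\<lambda>k. ennreal ((f k x - f n x)\<^sup>2)) \<longlonglongrightarrow> ennreal ((g x - f n x)\<^sup>2)"
          by (intro tendsto_intros)
        then show "ennreal ((g x - f n x)\<^sup>2) = liminf (\<lambda>k. ennreal ((f k x - f n x)\<^sup>2))"
          by (rule lim_imp_Liminf[OF sequentially_bot, symmetric])
      qed
    qed
    also have "\<dots> \<le> liminf (\<lambda>k. \<integral>\<^sup>+x. ennreal ((f k x - f n x)\<^sup>2) \<partial>gauss)"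
      by (rule nn_integral_liminf) simp
    also have "\<dots> \<le> liminf (\<lambda>k. ennreal (((1/2) ^ n)\<^sup>2))"
      by (rule Liminf_mono, rule eventually_sequentiallyI[of n])
         (auto simp: nn_integral_power2_diff f intro!: ennreal_leI power_mono fast)
    finally show ?thesis by (simp add: Liminf_const)
  qed
  have gf: "sq_int (\<lambda>x. g x - f n x)" for n
    unfolding sq_int_def using bound[of n]
    by (auto intro!: integrableI_nonneg intro: le_less_trans)
  have g: "sq_int g" using sq_int_add[OF gf[of 0] f[of 0]] by simp
  have "dist (abs_gl2 g) (abs_gl2 (f n)) \<le> (1/2) ^ n" for n
  proof -
    have "ennreal ((dist (abs_gl2 g) (abs_gl2 (f n)))\<^sup>2) \<le> ennreal (((1/2) ^ n)\<^sup>2)"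
      using bound[of n] by (simp add: nn_integral_power2_diff f g)
    then have "(dist (abs_gl2 g) (abs_gl2 (f n)))\<^sup>2 \<le> ((1/2) ^ n)\<^sup>2"
      by (subst (asm) ennreal_le_iff) auto
    then show ?thesis by (rule power2_le_imp_le) simp
  qed
  with g that show ?thesis by blast
qed

instance gl2 :: (finite) complete_space
proof
  fix X :: "nat \<Rightarrow> 'a gl2" assume X: "Cauchy X"
  then have "\<forall>n. \<exists>N. \<forall>m\<ge>N. \<forall>k\<ge>N. dist (X m) (X k) < (1/2) ^ n"
    by (intro allI metric_CauchyD) auto
  then obtain N where N: "\<And>n m k. m \<ge> N n \<Longrightarrow> k \<ge> N n \<Longrightarrow> dist (X m) (X k) < (1/2) ^ n" by metis
  \<comment> \<open>The maximum makes \<open>r\<close> strictly increasing and at the same time puts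
    \<open>r n\<close> beyond the threshold \<open>N n\<close>.\<close>
  define r where "r = rec_nat (N 0) (\<lambda>n p. max (Suc p) (N (Suc n)))"
  have r: "r 0 = N 0" "r (Suc n) = max (Suc (r n)) (N (Suc n))" for n by (simp_all add: r_def)
  have sm: "strict_mono r" by (simp add: strict_mono_Suc_iff r less_max_iff_disj)
  have rN: "r n \<ge> N n" for n by (cases n) (simp_all add: r)
  define f where "f n = rep_gl2 (X (r n))" for n
  have f: "sq_int (f n)" "abs_gl2 (f n) = X (r n)" for n by (simp_all add: f_def sq_int_rep)
  have "dist (abs_gl2 (f k)) (abs_gl2 (f n)) \<le> (1/2) ^ n" if "n \<le> k" for n k
  proof -
    have "r k \<ge> N n" using rN[of n] strict_mono_less_eq[OF sm, of n k] that by linarith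
    then show ?thesis unfolding f(2) using N[of n "r k" "r n"] rN[of n] by simp
  qed
  from gl2_fast_Cauchy_limit[OF f(1) this]
  obtain g where g: "\<And>n. dist (abs_gl2 g) (X (r n)) \<le> (1/2) ^ n" unfolding f(2) by blast
  have "(\<lambda>n. dist ((X \<circ> r) n) (abs_gl2 g)) \<longlonglongrightarrow> 0"
  proof (rule real_tendsto_sandwich[of "\<lambda>_. 0" _ _ "\<lambda>n. (1/2) ^ n"])
    show "(\<lambda>n. (1/2::real) ^ n) \<longlonglongrightarrow> 0" by (rule LIMSEQ_power_zero) simp
    show "\<forall>\<^sub>F n in sequentially. dist ((X \<circ> r) n) (abs_gl2 g) \<le> (1/2) ^ n"
      unfolding comp_def dist_commute[of _ "abs_gl2 g"] using g by (intro always_eventually) blast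
  qed auto
  then have "(X \<circ> r) \<longlonglongrightarrow> abs_gl2 g" by (rule iffD2[OF tendsto_dist_iff])
  from Cauchy_converges_subseq[OF X sm this] show "convergent X" by (auto simp: convergent_def)
qed

subsection \<open>Closed subspaces with trivial orthogonal complement\<close>

text \<open>A minimising sequence is Cauchy by the parallelogram law because midpoints stay in
  \<open>S\<close>; completeness supplies the nearest point, and a one-dimensional variation shows
  that the residual is orthogonal.\<close>

lemma closed_subspace_projection:
  fixes S :: "'a::{real_inner, complete_space} set"
  assumes S: "subspace S" "closed S"
  obtains p where "p \<in> S" "\<And>s. s \<in> S \<Longrightarrow> (f - p) \<bullet> s = 0"
proof -
  define d where "d = infdist f S"
  have ne: "S \<noteq> {}" using subspace_0[OF S(1)] by blast
  have d0: "d \<ge> 0" by (simp add: d_def infdist_nonneg)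
  have dle: "d \<le> norm (f - s)" if "s \<in> S" for s
    using infdist_le[OF that, of f] by (simp add: d_def dist_norm)
  have "\<exists>s\<in>S. norm (f - s) < d + 1 / real (Suc n)" for n
  proof -
    have "infdist f S < d + 1 / real (Suc n)" by (simp add: d_def)
    then show ?thesis unfolding infdist_notempty[OF ne]
      by (subst (asm) cInf_less_iff) (auto simp: ne dist_norm intro!: bdd_belowI2[where m=0])
  qed
  then obtain p where p: "\<And>n. p n \<in> S" "\<And>n. norm (f - p n) < d + 1 / real (Suc n)" by metis
  \<comment> \<open>The parallelogram law bounds the squared distance of two late members by this
    quantity, four times the gap between near-minimal and minimal squared distance.\<close>
  define q where "q N = 4 * (d + 1 / real (Suc N))\<^sup>2 - 4 * d\<^sup>2" for N
  have pq: "(dist (p m) (p n))\<^sup>2 \<le> q N" if "m \<ge> N" "n \<ge> N" for m n N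
  proof -
    have b: "(norm (f - p k))\<^sup>2 \<le> (d + 1 / real (Suc N))\<^sup>2" if "k \<ge> N" for k
    proof (rule power_mono)
      have "1 / real (Suc k) \<le> 1 / real (Suc N)" using that by (simp add: frac_le)
      then show "norm (f - p k) \<le> d + 1 / real (Suc N)" using p(2)[of k] by linarith
    qed simp
    have "(1/2) *\<^sub>R (p m + p n) \<in> S"
      by (intro subspace_scale subspace_add S p)
    from power_mono[OF dle[OF this] d0, of 2]
    have h: "4 * d\<^sup>2 \<le> 4 * (norm (f - (1/2) *\<^sub>R (p m + p n)))\<^sup>2" by simp
    have "(dist (p m) (p n))\<^sup>2 = 2 * (norm (f - p m))\<^sup>2 + 2 * (norm (f - p n))\<^sup>2
        - 4 * (norm (f - (1/2) *\<^sub>R (p m + p n)))\<^sup>2"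
      unfolding dist_norm power2_norm_eq_inner
      by (simp add: inner_diff_left inner_diff_right inner_add_left inner_add_right inner_commute algebra_simps)
    with b[OF that(1)] b[OF that(2)] h show ?thesis unfolding q_def by linarith
  qed
  have "q \<longlonglongrightarrow> 4 * (d + 0)\<^sup>2 - 4 * d\<^sup>2"
    unfolding q_def by (intro tendsto_intros LIMSEQ_Suc[OF lim_1_over_n] LIMSEQ_Suc[of "\<lambda>n. 1 / real n"])
  then have q0: "q \<longlonglongrightarrow> 0" by simp
  have "Cauchy p"
  proof (rule metric_CauchyI)
    fix e :: real assume "e > 0"
    then have "\<forall>\<^sub>F N in sequentially. q N < e\<^sup>2" using order_tendstoD(2)[OF q0, of "e\<^sup>2"] by simp
    then obtain N where "q N < e\<^sup>2" by (auto simp: eventually_sequentially)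
    then have "dist (p m) (p n) < e" if "m \<ge> N" "n \<ge> N" for m n
      using pq[OF that] \<open>e > 0\<close> power_less_imp_less_base[of "dist (p m) (p n)" 2 e] by linarith
    then show "\<exists>M. \<forall>m\<ge>M. \<forall>n\<ge>M. dist (p m) (p n) < e" by blast
  qed
  then obtain P where P: "p \<longlonglongrightarrow> P" using Cauchy_convergent_iff convergent_def by blast
  have PS: "P \<in> S" using closed_sequentially[OF S(2) _ P] p(1) by simp
  have "norm (f - P) \<le> d + 0"
  proof (rule LIMSEQ_le)
    show "(\<lambda>n. norm (f - p n)) \<longlonglongrightarrow> norm (f - P)" by (intro tendsto_intros P)
    show "(\<lambda>n. d + 1 / real (Suc n)) \<longlonglongrightarrow> d + 0"
      by (intro tendsto_intros LIMSEQ_Suc[of "\<lambda>n. 1 / real n"] lim_1_over_n)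
  qed (use p(2) less_imp_le in blast)
  then have nP: "norm (f - P) \<le> norm (f - s)" if "s \<in> S" for s using dle[OF that] by simp
  have "(f - P) \<bullet> s = 0" if s: "s \<in> S" for s
  proof (cases "s = 0")
    case False
    \<comment> \<open>The coefficient of the point nearest to \<open>f - P\<close> on the line
      through \<open>s\<close>.\<close>
    define t where "t = ((f - P) \<bullet> s) / (s \<bullet> s)"
    have ss: "s \<bullet> s > 0" using False by simp
    have "P + t *\<^sub>R s \<in> S" by (intro subspace_add subspace_scale S PS s)
    from power_mono[OF nP[OF this], of 2]
    have "(norm (f - P))\<^sup>2 \<le> (norm ((f - P) - t *\<^sub>R s))\<^sup>2" by (simp add: algebra_simps)
    also have "\<dots> = (norm (f - P))\<^sup>2 - 2 * t * ((f - P) \<bullet> s) + t\<^sup>2 * (s \<bullet> s)"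
      unfolding power2_norm_eq_inner
      by (simp add: inner_diff_left inner_diff_right inner_commute algebra_simps power2_eq_square)
    also have "\<dots> = (norm (f - P))\<^sup>2 - ((f - P) \<bullet> s)\<^sup>2 / (s \<bullet> s)"
      using ss unfolding t_def by (simp add: field_simps power2_eq_square)
    finally have "((f - P) \<bullet> s)\<^sup>2 / (s \<bullet> s) \<le> 0" by simp
    then have "((f - P) \<bullet> s)\<^sup>2 \<le> 0" using ss by (simp add: divide_le_0_iff)
    then show ?thesis by simp
  qed simp
  with PS that show ?thesis by blast
qed

lemma closed_subspace_eq_UNIV:
  fixes S :: "'a::{real_inner, complete_space} set"
  assumes "subspace S" "closed S" "\<And>x. (\<And>s. s \<in> S \<Longrightarrow> x \<bullet> s = 0) \<Longrightarrow> x = 0"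
  shows "S = UNIV"
proof -
  have "f \<in> S" for f
  proof -
    obtain p where "p \<in> S" "\<And>s. s \<in> S \<Longrightarrow> (f - p) \<bullet> s = 0"
      using closed_subspace_projection[OF assms(1,2)] by blast
    with assms(3)[of "f - p"] show ?thesis by simp
  qed
  then show ?thesis by blast
qed

subsection \<open>Totality of the exponentials\<close>

text \<open>By the mean value theorem the majorant \<open>W\<close> of the derivatives also bounds
  the difference quotients, so dominated convergence applies along every sequence tending to
  \<open>t0\<close>.\<close>

lemma has_real_derivative_integral:
  fixes F F' :: "real \<Rightarrow> 'a \<Rightarrow> real"
  assumes t0: "a < t0" "t0 < b"
    and F: "\<And>t. a < t \<Longrightarrow> t < b \<Longrightarrow> integrable M (F t)"
    and der: "\<And>t x. a < t \<Longrightarrow> t < b \<Longrightarrow> ((\<lambda>s. F s x) has_real_derivative F' t x) (at t)"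
    and W: "integrable M W" "\<And>t x. a < t \<Longrightarrow> t < b \<Longrightarrow> \<bar>F' t x\<bar> \<le> W x"
  shows "((\<lambda>t. \<integral>x. F t x \<partial>M) has_real_derivative (\<integral>x. F' t0 x \<partial>M)) (at t0)"
  unfolding has_field_derivative_iff
proof (subst tendsto_at_iff_sequentially, intro allI impI, unfold comp_def)
  fix X :: "nat \<Rightarrow> real"
  assume X0: "\<forall>i. X i \<in> UNIV - {t0}" and X: "X \<longlonglongrightarrow> t0"
  have "\<forall>\<^sub>F n in sequentially. a < X n \<and> X n < b"
    using order_tendstoD[OF X] t0 by (auto intro: eventually_conj)
  then obtain N where N: "\<And>n. n \<ge> N \<Longrightarrow> a < X n \<and> X n < b" by (auto simp: eventually_sequentially)
  \<comment> \<open>Dropping the first \<open>N\<close> terms keeps the sequence inside the interval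
    on which the hypotheses hold.\<close>
  define Y where "Y n = X (n + N)" for n
  have Y: "a < Y n" "Y n < b" "Y n \<noteq> t0" for n using N[of "n + N"] X0 by (auto simp: Y_def)
  have YX: "Y \<longlonglongrightarrow> t0" unfolding Y_def by (rule LIMSEQ_ignore_initial_segment[OF X])
  have lim: "(\<lambda>n. (F (Y n) x - F t0 x) / (Y n - t0)) \<longlonglongrightarrow> F' t0 x" for x
    using der[OF t0, of x] Y(3) YX unfolding has_field_derivative_iff tendsto_at_iff_sequentially comp_def
    by auto
  have bnd: "\<bar>(F (Y n) x - F t0 x) / (Y n - t0)\<bar> \<le> W x" for n x
  proof -
    have "\<bar>F (Y n) x - F t0 x\<bar> \<le> W x * \<bar>Y n - t0\<bar>"
      using field_differentiable_bound[of "{a<..<b}" "\<lambda>s. F s x" "\<lambda>s. F' s x" "W x" "Y n" t0]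
        der W(2) t0 Y by (auto simp: intro: has_field_derivative_at_within)
    then show ?thesis using Y(3)[of n] by (simp add: divide_le_eq)
  qed
  have "(\<lambda>n. \<integral>x. (F (Y n) x - F t0 x) / (Y n - t0) \<partial>M) \<longlonglongrightarrow> (\<integral>x. F' t0 x \<partial>M)"
  proof (rule integral_dominated_convergence[where w = W])
    have m: "(\<lambda>x. (F (Y n) x - F t0 x) / (Y n - t0)) \<in> borel_measurable M" for n
      using F[OF Y(1,2)] F[OF t0] by (auto intro!: borel_measurable_divide borel_measurable_diff)
    then show "(\<lambda>x. (F (Y n) x - F t0 x) / (Y n - t0)) \<in> borel_measurable M" for n .
    show "F' t0 \<in> borel_measurable M"
      by (rule borel_measurable_LIMSEQ_real[OF lim m])
  qed (use lim bnd W(1) in auto)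
  also have "(\<lambda>n. \<integral>x. (F (Y n) x - F t0 x) / (Y n - t0) \<partial>M)
      = (\<lambda>n. ((\<integral>x. F (Y n) x \<partial>M) - (\<integral>x. F t0 x \<partial>M)) / (Y n - t0))"
    using F[OF Y(1,2)] F[OF t0] by (simp add: Bochner_Integration.integral_diff)
  finally show "(\<lambda>n. ((\<integral>x. F (X n) x \<partial>M) - (\<integral>x. F t0 x \<partial>M)) / (X n - t0)) \<longlonglongrightarrow> (\<integral>x. F' t0 x \<partial>M)"
    unfolding Y_def by (rule LIMSEQ_offset)
qed

lemma sq_int_exp_norm: "sq_int (\<lambda>x::real^'n. exp (a * norm x + (norm x)\<^sup>2 / 8))"
proof -
  have "(exp (a * norm x + (norm x)\<^sup>2 / 8))\<^sup>2 = exp ((2 * a) * norm x + (norm x)\<^sup>2 / 4)" for x :: "real^'n"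
    by (simp add: power2_eq_square mult_exp_exp)
  then show ?thesis unfolding sq_int_def using integrable_gauss_exp_norm[of "2 * a", where 'n = 'n] by simp
qed

lemma sq_int_mult_bounded:
  assumes f: "sq_int f" and g: "g \<in> borel_measurable borel" "\<And>x. \<bar>g x\<bar> \<le> B"
  shows "sq_int (\<lambda>x. f x * g x)"
proof (rule sq_int_bound[OF sq_int_scale[OF f, of B]])
  show "(\<lambda>x. f x * g x) \<in> borel_measurable borel" using f g(1) by (auto simp: sq_int_def)
  fix x
  have "\<bar>g x\<bar> \<le> \<bar>B\<bar>" using g(2)[of x] by linarith
  then show "\<bar>f x * g x\<bar> \<le> \<bar>B * f x\<bar>" by (simp add: abs_mult mult.commute[of "\<bar>B\<bar>"] mult_left_mono)
qed

lemma abs_le_exp: "\<bar>u::real\<bar> ^ k \<le> exp (real k * \<bar>u\<bar>)"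
proof -
  have "\<bar>u\<bar> \<le> exp \<bar>u\<bar>" using exp_ge_add_one_self[of "\<bar>u\<bar>"] by linarith
  then have "\<bar>u\<bar> ^ k \<le> exp \<bar>u\<bar> ^ k" by (rule power_mono) simp
  then show ?thesis by (simp flip: exp_of_nat_mult)
qed

text \<open>Orthogonality to exp(xi . x) for every xi survives differentiation in xi, and each
  derivative in direction \<open>b\<close> brings down one factor x . b. The induction therefore
  keeps xi arbitrary.\<close>

lemma integral_exp_moments_eq_0:
  fixes v :: "real^'n \<Rightarrow> real"
  assumes v: "sq_int v" and 0: "\<And>\<xi>. (\<integral>x. v x * exp (\<xi> \<bullet> x) \<partial>gauss) = 0" and b: "norm b = 1"
  shows "(\<integral>x. v x * (x \<bullet> b) ^ k * exp (\<xi> \<bullet> x) \<partial>gauss) = 0"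
proof (induction k arbitrary: \<xi>)
  case 0 show ?case using assms(2) by simp
next
  case (Suc k)
  have [measurable]: "v \<in> borel_measurable borel" using v by (simp add: sq_int_def)
  have xb: "\<bar>x \<bullet> b\<bar> \<le> norm x" for x using Cauchy_Schwarz_ineq2[of x b] b by simp
  have bd: "\<bar>v x * (x \<bullet> b) ^ j * exp ((\<xi> + t *\<^sub>R b) \<bullet> x)\<bar>
      \<le> \<bar>v x * exp ((real j + norm \<xi> + 1) * norm x + (norm x)\<^sup>2 / 8)\<bar>" if t: "\<bar>t\<bar> < 1" for t x j
  proof -
    have "\<bar>x \<bullet> b\<bar> ^ j \<le> exp (real j * norm x)"
      using abs_le_exp[of "norm x" j] power_mono[OF xb[of x], of j] by simp
    moreover have "(\<xi> + t *\<^sub>R b) \<bullet> x \<le> (norm \<xi> + 1) * norm x"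
    proof -
      have "norm (\<xi> + t *\<^sub>R b) \<le> norm \<xi> + 1" using norm_triangle_ineq[of \<xi> "t *\<^sub>R b"] b t by simp
      then have "norm (\<xi> + t *\<^sub>R b) * norm x \<le> (norm \<xi> + 1) * norm x" by (rule mult_right_mono) simp
      then show ?thesis using norm_cauchy_schwarz[of "\<xi> + t *\<^sub>R b" x] by linarith
    qed
    ultimately have "\<bar>x \<bullet> b\<bar> ^ j * exp ((\<xi> + t *\<^sub>R b) \<bullet> x) \<le> exp (real j * norm x) * exp ((norm \<xi> + 1) * norm x)"
      by (intro mult_mono) auto
    also have "\<dots> \<le> exp ((real j + norm \<xi> + 1) * norm x + (norm x)\<^sup>2 / 8)"
      by (simp add: algebra_simps flip: exp_add)
    finally have "\<bar>v x\<bar> * (\<bar>x \<bullet> b\<bar> ^ j * exp ((\<xi> + t *\<^sub>R b) \<bullet> x))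
        \<le> \<bar>v x\<bar> * exp ((real j + norm \<xi> + 1) * norm x + (norm x)\<^sup>2 / 8)" by (rule mult_left_mono) simp
    then show ?thesis by (simp add: abs_mult power_abs mult.assoc)
  qed
  have int: "integrable gauss (\<lambda>x. v x * exp ((real j + norm \<xi> + 1) * norm x + (norm x)\<^sup>2 / 8))" for j
    by (rule sq_int_mult[OF v sq_int_exp_norm])
  have "((\<lambda>t. \<integral>x. v x * (x \<bullet> b) ^ k * exp ((\<xi> + t *\<^sub>R b) \<bullet> x) \<partial>gauss) has_real_derivative
     (\<integral>x. v x * (x \<bullet> b) ^ Suc k * exp ((\<xi> + 0 *\<^sub>R b) \<bullet> x) \<partial>gauss)) (at 0)"
  proof (rule has_real_derivative_integral[where a="-1" and b=1
        and W = "\<lambda>x. \<bar>v x * exp ((real (Suc k) + norm \<xi> + 1) * norm x + (norm x)\<^sup>2 / 8)\<bar>"])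
    fix t :: real assume t: "-1 < t" "t < 1"
    then have t': "\<bar>t\<bar> < 1" by simp
    show "integrable gauss (\<lambda>x. v x * (x \<bullet> b) ^ k * exp ((\<xi> + t *\<^sub>R b) \<bullet> x))"
      by (rule Bochner_Integration.integrable_bound[OF int[of k]])
         (use bd[OF t', of _ k] in auto)
    show "((\<lambda>s. v x * (x \<bullet> b) ^ k * exp ((\<xi> + s *\<^sub>R b) \<bullet> x)) has_real_derivative
        v x * (x \<bullet> b) ^ Suc k * exp ((\<xi> + t *\<^sub>R b) \<bullet> x)) (at t)" for x
      unfolding inner_add_left inner_scaleR_left
      by (auto intro!: derivative_eq_intros simp: inner_commute)
    show "\<bar>v x * (x \<bullet> b) ^ Suc k * exp ((\<xi> + t *\<^sub>R b) \<bullet> x)\<bar>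
      \<le> \<bar>v x * exp ((real (Suc k) + norm \<xi> + 1) * norm x + (norm x)\<^sup>2 / 8)\<bar>" for x
      by (rule bd[OF t'])
  qed (use int[of "Suc k"] in auto)
  moreover have "(\<lambda>t. \<integral>x. v x * (x \<bullet> b) ^ k * exp ((\<xi> + t *\<^sub>R b) \<bullet> x) \<partial>gauss) = (\<lambda>t. 0)"
    using Suc.IH by simp
  ultimately have "((\<lambda>t. 0) has_real_derivative (\<integral>x. v x * (x \<bullet> b) ^ Suc k * exp (\<xi> \<bullet> x) \<partial>gauss)) (at 0)"
    by simp
  then show ?case using DERIV_unique[OF _ DERIV_const] by blast
qed

section \<open>Multipliers that preserve orthogonality to the exponentials\<close>

definition exp_annihilator :: "(real^'n \<Rightarrow> real) \<Rightarrow> (real^'n \<Rightarrow> real) set" where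
  "exp_annihilator f = {\<phi>. \<phi> \<in> borel_measurable borel \<and> (\<exists>B. \<forall>x. \<bar>\<phi> x\<bar> \<le> B) \<and>
     (\<forall>\<xi>. (\<integral>x. (f x * \<phi> x) * exp (\<xi> \<bullet> x) \<partial>gauss) = 0)}"

text \<open>The annihilator is only a vector space, whereas its multipliers form an algebra closed
  under bounded pointwise limits. Once every Borel indicator is a multiplier, applying it to the
  constant 1 shows that \<open>f\<close> integrates to zero over every Borel set.\<close>

definition exp_multipliers :: "(real^'n \<Rightarrow> real) \<Rightarrow> (real^'n \<Rightarrow> real) set" where
  "exp_multipliers f = {\<psi>. \<psi> \<in> borel_measurable borel \<and> (\<exists>B. \<forall>x. \<bar>\<psi> x\<bar> \<le> B) \<and>
     (\<forall>\<phi>\<in>exp_annihilator f. (\<lambda>x. \<phi> x * \<psi> x) \<in> exp_annihilator f)}"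

lemma bounded_mult_ex:
  fixes f g :: "'a \<Rightarrow> real"
  assumes "\<exists>B. \<forall>x. \<bar>f x\<bar> \<le> B" "\<exists>B. \<forall>x. \<bar>g x\<bar> \<le> B"
  shows "\<exists>B. \<forall>x. \<bar>f x * g x\<bar> \<le> B"
proof -
  obtain A B where "\<And>x. \<bar>f x\<bar> \<le> A" "\<And>x. \<bar>g x\<bar> \<le> B" using assms by blast
  then have "\<bar>f x * g x\<bar> \<le> A * B" for x
    unfolding abs_mult by (intro mult_mono) (auto intro: order_trans[OF abs_ge_zero])
  then show ?thesis by blast
qed

lemma bounded_add_ex:
  fixes f g :: "'a \<Rightarrow> real"
  assumes "\<exists>B. \<forall>x. \<bar>f x\<bar> \<le> B" "\<exists>B. \<forall>x. \<bar>g x\<bar> \<le> B"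
  shows "\<exists>B. \<forall>x. \<bar>f x + g x\<bar> \<le> B"
proof -
  obtain A B where "\<And>x. \<bar>f x\<bar> \<le> A" "\<And>x. \<bar>g x\<bar> \<le> B" using assms by blast
  then have "\<bar>f x + g x\<bar> \<le> A + B" for x by (meson abs_triangle_ineq add_mono order_trans)
  then show ?thesis by blast
qed

context
  fixes f :: "real^'n \<Rightarrow> real"
  assumes f: "sq_int f"
begin

lemma annihilator_integrable:
  assumes "\<phi> \<in> borel_measurable borel" "\<exists>B. \<forall>x. \<bar>\<phi> x\<bar> \<le> B"
  shows "integrable gauss (\<lambda>x. (f x * \<phi> x) * exp (\<xi> \<bullet> x))"
  using assms by (auto intro!: sq_int_mult sq_int_exp sq_int_mult_bounded f)

lemma exp_multipliers_const: "(\<lambda>x. c) \<in> exp_multipliers f"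
proof -
  have "(\<integral>x. (f x * (\<phi> x * c)) * exp (\<xi> \<bullet> x) \<partial>gauss) = 0"
    if "(\<integral>x. (f x * \<phi> x) * exp (\<xi> \<bullet> x) \<partial>gauss) = 0" for \<phi> \<xi>
  proof -
    have "(\<integral>x. (f x * (\<phi> x * c)) * exp (\<xi> \<bullet> x) \<partial>gauss) = (\<integral>x. c * ((f x * \<phi> x) * exp (\<xi> \<bullet> x)) \<partial>gauss)"
      by (simp add: mult_ac)
    then show ?thesis using that by simp
  qed
  then show ?thesis
    by (auto simp: exp_multipliers_def exp_annihilator_def intro!: bounded_mult_ex)
qed

lemma exp_multipliers_mult:
  assumes "\<psi> \<in> exp_multipliers f" "\<theta> \<in> exp_multipliers f"
  shows "(\<lambda>x. \<psi> x * \<theta> x) \<in> exp_multipliers f"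
proof -
  have "(\<lambda>x. \<phi> x * (\<psi> x * \<theta> x)) \<in> exp_annihilator f" if "\<phi> \<in> exp_annihilator f" for \<phi>
  proof -
    have "(\<lambda>x. \<phi> x * \<psi> x) \<in> exp_annihilator f"
      using assms(1) that by (simp add: exp_multipliers_def)
    then have "(\<lambda>x. (\<phi> x * \<psi> x) * \<theta> x) \<in> exp_annihilator f"
      using assms(2) by (simp add: exp_multipliers_def)
    then show ?thesis by (simp add: mult.assoc)
  qed
  then show ?thesis using assms
    by (auto simp: exp_multipliers_def intro!: bounded_mult_ex)
qed

lemma exp_multipliers_add:
  assumes \<psi>: "\<psi> \<in> exp_multipliers f" and \<theta>: "\<theta> \<in> exp_multipliers f"
  shows "(\<lambda>x. \<psi> x + \<theta> x) \<in> exp_multipliers f"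
proof -
  have "(\<lambda>x. \<phi> x * (\<psi> x + \<theta> x)) \<in> exp_annihilator f" if p: "\<phi> \<in> exp_annihilator f" for \<phi>
  proof -
    have a: "(\<lambda>x. \<phi> x * \<psi> x) \<in> exp_annihilator f" and b: "(\<lambda>x. \<phi> x * \<theta> x) \<in> exp_annihilator f"
      using assms p unfolding exp_multipliers_def by auto
    have "(\<integral>x. (f x * (\<phi> x * \<psi> x + \<phi> x * \<theta> x)) * exp (\<xi> \<bullet> x) \<partial>gauss) = 0" for \<xi>
    proof -
      have "(\<integral>x. (f x * (\<phi> x * \<psi> x + \<phi> x * \<theta> x)) * exp (\<xi> \<bullet> x) \<partial>gauss)
        = (\<integral>x. (f x * (\<phi> x * \<psi> x)) * exp (\<xi> \<bullet> x) + (f x * (\<phi> x * \<theta> x)) * exp (\<xi> \<bullet> x) \<partial>gauss)"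
        by (simp add: algebra_simps)
      also have "\<dots> = (\<integral>x. (f x * (\<phi> x * \<psi> x)) * exp (\<xi> \<bullet> x) \<partial>gauss) + (\<integral>x. (f x * (\<phi> x * \<theta> x)) * exp (\<xi> \<bullet> x) \<partial>gauss)"
        using a b by (intro Bochner_Integration.integral_add annihilator_integrable)
          (auto simp: exp_annihilator_def)
      finally show ?thesis using a b by (simp add: exp_annihilator_def)
    qed
    then show ?thesis using a b
      by (auto simp: exp_annihilator_def distrib_left intro!: bounded_add_ex)
  qed
  then show ?thesis using assms
    by (auto simp: exp_multipliers_def intro!: bounded_add_ex)
qed

lemma exp_multipliers_sum:
  assumes "\<And>i. i \<in> I \<Longrightarrow> \<psi> i \<in> exp_multipliers f"
  shows "(\<lambda>x. \<Sum>i\<in>I. \<psi> i x) \<in> exp_multipliers f"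
  using assms
proof (induction I rule: infinite_finite_induct)
  case (insert i I)
  then show ?case using exp_multipliers_add[of "\<psi> i" "\<lambda>x. \<Sum>i\<in>I. \<psi> i x"] by simp
qed (simp_all add: exp_multipliers_const)

lemma exp_multipliers_prod:
  assumes "\<And>i. i \<in> I \<Longrightarrow> \<psi> i \<in> exp_multipliers f"
  shows "(\<lambda>x. \<Prod>i\<in>I. \<psi> i x) \<in> exp_multipliers f"
  using assms
proof (induction I rule: infinite_finite_induct)
  case (insert i I)
  then show ?case using exp_multipliers_mult[of "\<psi> i" "\<lambda>x. \<Prod>i\<in>I. \<psi> i x"] by simp
qed (simp_all add: exp_multipliers_const)

lemma exp_multipliers_power:
  assumes "\<psi> \<in> exp_multipliers f" shows "(\<lambda>x. \<psi> x ^ k) \<in> exp_multipliers f"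
  using exp_multipliers_prod[of "{..<k}" "\<lambda>_. \<psi>"] assms by simp

lemma exp_multipliers_lim:
  assumes \<psi>: "\<And>n. \<psi> n \<in> exp_multipliers f" and B: "\<And>n x. \<bar>\<psi> n x\<bar> \<le> B"
    and lim: "\<And>x. (\<lambda>n. \<psi> n x) \<longlonglongrightarrow> \<theta> x"
  shows "\<theta> \<in> exp_multipliers f"
proof -
  have [measurable]: "f \<in> borel_measurable borel" using f by (simp add: sq_int_def)
  have [measurable]: "\<psi> n \<in> borel_measurable borel" for n using \<psi> by (simp add: exp_multipliers_def)
  have m[measurable]: "\<theta> \<in> borel_measurable borel" by (rule borel_measurable_LIMSEQ_real[OF lim]) simp
  have b: "\<bar>\<theta> x\<bar> \<le> B" for x
    by (rule LIMSEQ_le_const2[OF tendsto_rabs[OF lim]]) (use B in auto)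
  have "(\<lambda>x. \<phi> x * \<theta> x) \<in> exp_annihilator f" if p: "\<phi> \<in> exp_annihilator f" for \<phi>
  proof -
    have [measurable]: "\<phi> \<in> borel_measurable borel" using p by (simp add: exp_annihilator_def)
    have "(\<integral>x. (f x * (\<phi> x * \<theta> x)) * exp (\<xi> \<bullet> x) \<partial>gauss) = 0" for \<xi>
    proof (rule LIMSEQ_unique)
      show "(\<lambda>n. \<integral>x. (f x * (\<phi> x * \<psi> n x)) * exp (\<xi> \<bullet> x) \<partial>gauss)
          \<longlonglongrightarrow> (\<integral>x. (f x * (\<phi> x * \<theta> x)) * exp (\<xi> \<bullet> x) \<partial>gauss)"
      proof (rule integral_dominated_convergence[where w = "\<lambda>x. B * \<bar>(f x * \<phi> x) * exp (\<xi> \<bullet> x)\<bar>"])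
        show "integrable gauss (\<lambda>x. B * \<bar>(f x * \<phi> x) * exp (\<xi> \<bullet> x)\<bar>)"
          using annihilator_integrable[of \<phi> \<xi>] p by (auto simp: exp_annihilator_def)
        have "\<bar>\<psi> n x\<bar> * \<bar>(f x * \<phi> x) * exp (\<xi> \<bullet> x)\<bar> \<le> B * \<bar>(f x * \<phi> x) * exp (\<xi> \<bullet> x)\<bar>" for n x
          by (intro mult_right_mono B) simp
        then show "AE x in gauss. norm ((f x * (\<phi> x * \<psi> n x)) * exp (\<xi> \<bullet> x)) \<le> B * \<bar>(f x * \<phi> x) * exp (\<xi> \<bullet> x)\<bar>" for n
          by (auto simp: abs_mult mult_ac)
        show "AE x in gauss. (\<lambda>n. (f x * (\<phi> x * \<psi> n x)) * exp (\<xi> \<bullet> x)) \<longlonglongrightarrow> (f x * (\<phi> x * \<theta> x)) * exp (\<xi> \<bullet> x)"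
          by (intro AE_I2 tendsto_intros lim)
      qed measurable
      have "(\<lambda>x. \<phi> x * \<psi> n x) \<in> exp_annihilator f" for n
        using \<psi>[of n] p by (simp add: exp_multipliers_def)
      then show "(\<lambda>n. \<integral>x. (f x * (\<phi> x * \<psi> n x)) * exp (\<xi> \<bullet> x) \<partial>gauss) \<longlonglongrightarrow> 0"
        by (simp add: exp_annihilator_def)
    qed
    then show ?thesis using p b by (auto simp: exp_annihilator_def intro!: bounded_mult_ex)
  qed
  then show ?thesis using b by (auto simp: exp_multipliers_def)
qed

text \<open>Expanding the Gaussian factor into a power series reduces the claim to the vanishing
  moments; the weight \<open>1/8\<close> keeps the series dominated by a square integrable function.\<close>
lemma exp_multipliers_gaussian:
  assumes b: "norm b = 1"
  shows "(\<lambda>x. exp (- (x \<bullet> b - y)\<^sup>2 / 8)) \<in> exp_multipliers f"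
proof -
  have [measurable]: "f \<in> borel_measurable borel" using f by (simp add: sq_int_def)
  have "(\<lambda>x. \<phi> x * exp (- (x \<bullet> b - y)\<^sup>2 / 8)) \<in> exp_annihilator f" if p: "\<phi> \<in> exp_annihilator f" for \<phi>
  proof -
    have [measurable]: "\<phi> \<in> borel_measurable borel" using p by (simp add: exp_annihilator_def)
    have v: "sq_int (\<lambda>x. f x * \<phi> x)"
      using p f sq_int_mult_bounded unfolding exp_annihilator_def by blast
    have 0: "(\<integral>x. (f x * \<phi> x) * (x \<bullet> b) ^ k * exp (\<xi> \<bullet> x) \<partial>gauss) = 0" for k \<xi>
      using p integral_exp_moments_eq_0[OF v _ b] by (simp add: exp_annihilator_def)
    have *: "(\<integral>x. (f x * \<phi> x) * exp (- (x \<bullet> b)\<^sup>2 / 8) * exp (\<xi> \<bullet> x) \<partial>gauss) = 0" for \<xi>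
    proof (rule LIMSEQ_unique)
      let ?s = "\<lambda>n x. \<Sum>k<n. (- (x \<bullet> b)\<^sup>2 / 8) ^ k /\<^sub>R fact k"
      show "(\<lambda>n. \<integral>x. (f x * \<phi> x) * ?s n x * exp (\<xi> \<bullet> x) \<partial>gauss)
          \<longlonglongrightarrow> (\<integral>x. (f x * \<phi> x) * exp (- (x \<bullet> b)\<^sup>2 / 8) * exp (\<xi> \<bullet> x) \<partial>gauss)"
      proof (rule integral_dominated_convergence[where w = "\<lambda>x. \<bar>(f x * \<phi> x) * exp (norm \<xi> * norm x + (norm x)\<^sup>2 / 8)\<bar>"])
        show "integrable gauss (\<lambda>x. \<bar>(f x * \<phi> x) * exp (norm \<xi> * norm x + (norm x)\<^sup>2 / 8)\<bar>)"
          by (intro integrable_abs sq_int_mult[OF v sq_int_exp_norm])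
        have "\<bar>?s n x * exp (\<xi> \<bullet> x)\<bar> \<le> exp (norm \<xi> * norm x + (norm x)\<^sup>2 / 8)" for n x
        proof -
          have "\<bar>?s n x\<bar> \<le> (\<Sum>k<n. ((x \<bullet> b)\<^sup>2 / 8) ^ k /\<^sub>R fact k)"
            by (rule order_trans[OF sum_abs], rule sum_mono) (simp add: abs_mult power_abs)
          also have "\<dots> \<le> exp ((x \<bullet> b)\<^sup>2 / 8)"
            using exp_converges[of "(x \<bullet> b)\<^sup>2 / 8"]
            by (intro sum_le_suminf[of "\<lambda>k. ((x \<bullet> b)\<^sup>2 / 8) ^ k /\<^sub>R fact k" "{..<n}", THEN order_trans])
               (auto simp: sums_iff)
          also have "(x \<bullet> b)\<^sup>2 \<le> (norm x)\<^sup>2"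
            using Cauchy_Schwarz_ineq2[of x b] b power_mono[of "\<bar>x \<bullet> b\<bar>" "norm x" 2] by simp
          finally have "\<bar>?s n x\<bar> \<le> exp ((norm x)\<^sup>2 / 8)" by simp
          moreover have "exp (\<xi> \<bullet> x) \<le> exp (norm \<xi> * norm x)" by (simp add: norm_cauchy_schwarz)
          ultimately have "\<bar>?s n x\<bar> * exp (\<xi> \<bullet> x) \<le> exp ((norm x)\<^sup>2 / 8) * exp (norm \<xi> * norm x)"
            by (intro mult_mono) auto
          then show ?thesis by (simp add: abs_mult exp_add mult.commute)
        qed
        from mult_left_mono[OF this abs_ge_zero]
        have "\<bar>f x * \<phi> x\<bar> * \<bar>?s n x * exp (\<xi> \<bullet> x)\<bar> \<le> \<bar>f x * \<phi> x\<bar> * exp (norm \<xi> * norm x + (norm x)\<^sup>2 / 8)" for n x .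
        then have "\<bar>(f x * \<phi> x) * ?s n x * exp (\<xi> \<bullet> x)\<bar> \<le> \<bar>(f x * \<phi> x) * exp (norm \<xi> * norm x + (norm x)\<^sup>2 / 8)\<bar>" for n x
          by (simp add: abs_mult mult.assoc)
        then show "AE x in gauss. norm ((f x * \<phi> x) * ?s n x * exp (\<xi> \<bullet> x))
            \<le> \<bar>(f x * \<phi> x) * exp (norm \<xi> * norm x + (norm x)\<^sup>2 / 8)\<bar>" for n by simp
        have "(\<lambda>n. ?s n x) \<longlonglongrightarrow> exp (- (x \<bullet> b)\<^sup>2 / 8)" for x
          using exp_converges[of "- (x \<bullet> b)\<^sup>2 / 8"] by (simp add: sums_def)
        then show "AE x in gauss. (\<lambda>n. (f x * \<phi> x) * ?s n x * exp (\<xi> \<bullet> x))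
            \<longlonglongrightarrow> (f x * \<phi> x) * exp (- (x \<bullet> b)\<^sup>2 / 8) * exp (\<xi> \<bullet> x)"
          by (intro AE_I2 tendsto_intros)
      qed measurable
      have i: "integrable gauss (\<lambda>x. (f x * \<phi> x) * (x \<bullet> b) ^ k * exp (\<xi> \<bullet> x))" for k
      proof (rule Bochner_Integration.integrable_bound)
        show "integrable gauss (\<lambda>x. (f x * \<phi> x) * exp ((real k + norm \<xi>) * norm x + (norm x)\<^sup>2 / 8))"
          by (rule sq_int_mult[OF v sq_int_exp_norm])
        have "\<bar>(x \<bullet> b) ^ k * exp (\<xi> \<bullet> x)\<bar> \<le> exp ((real k + norm \<xi>) * norm x + (norm x)\<^sup>2 / 8)" for x
        proof -
          have "\<bar>x \<bullet> b\<bar> ^ k \<le> exp (real k * norm x)"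
            using abs_le_exp[of "norm x" k] power_mono[of "\<bar>x \<bullet> b\<bar>" "norm x" k]
              Cauchy_Schwarz_ineq2[of x b] b by simp
          moreover have "exp (\<xi> \<bullet> x) \<le> exp (norm \<xi> * norm x)" by (simp add: norm_cauchy_schwarz)
          ultimately have "\<bar>x \<bullet> b\<bar> ^ k * exp (\<xi> \<bullet> x) \<le> exp (real k * norm x) * exp (norm \<xi> * norm x)"
            by (intro mult_mono) auto
          also have "\<dots> \<le> exp ((real k + norm \<xi>) * norm x + (norm x)\<^sup>2 / 8)"
            by (simp add: algebra_simps flip: exp_add)
          finally show ?thesis by (simp add: abs_mult power_abs)
        qed
        from mult_left_mono[OF this abs_ge_zero]
        have "\<bar>f x * \<phi> x\<bar> * \<bar>(x \<bullet> b) ^ k * exp (\<xi> \<bullet> x)\<bar> \<le> \<bar>f x * \<phi> x\<bar> * exp ((real k + norm \<xi>) * norm x + (norm x)\<^sup>2 / 8)" for x .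
        then show "AE x in gauss. norm ((f x * \<phi> x) * (x \<bullet> b) ^ k * exp (\<xi> \<bullet> x))
            \<le> norm ((f x * \<phi> x) * exp ((real k + norm \<xi>) * norm x + (norm x)\<^sup>2 / 8))"
          by (simp add: abs_mult mult.assoc)
      qed measurable
      have "(\<integral>x. (f x * \<phi> x) * ?s n x * exp (\<xi> \<bullet> x) \<partial>gauss)
          = (\<integral>x. (\<Sum>k<n. ((- 1 / 8) ^ k / fact k) * ((f x * \<phi> x) * (x \<bullet> b) ^ (2 * k) * exp (\<xi> \<bullet> x))) \<partial>gauss)" for n
      proof (rule Bochner_Integration.integral_cong[OF refl])
        fix x
        have "(- (x \<bullet> b)\<^sup>2 / 8) ^ k /\<^sub>R fact k = ((- 1 / 8) ^ k / fact k) * (x \<bullet> b) ^ (2 * k)" for k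
        proof -
          have "- (x \<bullet> b)\<^sup>2 / 8 = (- 1 / 8) * (x \<bullet> b)\<^sup>2" by simp
          then show ?thesis by (simp only: power_mult_distrib power_mult) (simp add: field_simps)
        qed
        then show "(f x * \<phi> x) * ?s n x * exp (\<xi> \<bullet> x)
            = (\<Sum>k<n. ((- 1 / 8) ^ k / fact k) * ((f x * \<phi> x) * (x \<bullet> b) ^ (2 * k) * exp (\<xi> \<bullet> x)))"
          by (simp only: sum_distrib_left sum_distrib_right mult_ac)
      qed
      also have "\<dots> n = 0" for n
        by (subst Bochner_Integration.integral_sum) (auto simp: 0 intro!: integrable_mult_right i)
      finally show "(\<lambda>n. \<integral>x. (f x * \<phi> x) * ?s n x * exp (\<xi> \<bullet> x) \<partial>gauss) \<longlonglongrightarrow> 0"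
        by simp
    qed
    have "(\<integral>x. (f x * (\<phi> x * exp (- (x \<bullet> b - y)\<^sup>2 / 8))) * exp (\<xi> \<bullet> x) \<partial>gauss) = 0" for \<xi>
    proof -
      \<comment> \<open>In -(u - y)^2/8 the cross term u y/4 moves xi by (y/4) b and the remainder
        is the centred Gaussian times a constant. This is why orthogonality is demanded for every
        xi.\<close>
      have "exp (- (x \<bullet> b - y)\<^sup>2 / 8) * exp (\<xi> \<bullet> x)
          = exp (- y\<^sup>2 / 8) * (exp (- (x \<bullet> b)\<^sup>2 / 8) * exp ((\<xi> + (y / 4) *\<^sub>R b) \<bullet> x))" for x
        by (simp add: inner_add_left inner_commute power2_eq_square algebra_simps add_divide_distrib diff_divide_distrib
            flip: exp_add)
      then have "(f x * (\<phi> x * exp (- (x \<bullet> b - y)\<^sup>2 / 8))) * exp (\<xi> \<bullet> x)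
          = exp (- y\<^sup>2 / 8) * ((f x * \<phi> x) * exp (- (x \<bullet> b)\<^sup>2 / 8) * exp ((\<xi> + (y / 4) *\<^sub>R b) \<bullet> x))" for x
        by (simp only: mult.assoc mult.left_commute[of "exp (- y\<^sup>2 / 8)"])
      then show ?thesis using * by (simp only:) simp
    qed
    moreover have "\<exists>B. \<forall>x. \<bar>exp (- (x \<bullet> b - y)\<^sup>2 / 8)\<bar> \<le> (B::real)" by (intro exI[of _ 1]) simp
    then have "\<exists>B. \<forall>x. \<bar>\<phi> x * exp (- (x \<bullet> b - y)\<^sup>2 / 8)\<bar> \<le> B"
      using p by (intro bounded_mult_ex) (simp_all add: exp_annihilator_def)
    ultimately show ?thesis by (simp add: exp_annihilator_def)
  qed
  moreover have "\<exists>B. \<forall>x. \<bar>exp (- (x \<bullet> b - y)\<^sup>2 / 8)\<bar> \<le> (B::real)" by (intro exI[of _ 1]) simp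
  ultimately show ?thesis by (auto simp: exp_multipliers_def)
qed

text \<open>Weierstrass: Bernstein polynomials in a multiplier are multipliers by the algebra
  structure, and the bounded limit is a multiplier again.\<close>

lemma exp_multipliers_continuous:
  fixes F :: "real \<Rightarrow> real"
  assumes \<psi>: "\<psi> \<in> exp_multipliers f" and r: "\<And>x. \<psi> x \<in> {0..1}" and F: "continuous_on {0..1} F"
  shows "(\<lambda>x. F (\<psi> x)) \<in> exp_multipliers f"
proof -
  have "\<exists>n. \<forall>v\<in>{0..1}. \<bar>F v - (\<Sum>k\<le>n. F (k / n) * Bernstein n k v)\<bar> < 1 / real (Suc j)" for j
  proof -
    obtain N where "\<forall>n x. N \<le> n \<and> x \<in> {0..1} \<longrightarrow> \<bar>F x - (\<Sum>k\<le>n. F (k/n) * Bernstein n k x)\<bar> < 1 / real (Suc j)"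
      using Bernstein_Weierstrass[OF F, of "1 / real (Suc j)"] by auto
    then show ?thesis by (intro exI[of _ N]) blast
  qed
  then obtain n where n: "\<And>j v. v \<in> {0..1} \<Longrightarrow>
      \<bar>F v - (\<Sum>k\<le>n j. F (k / n j) * Bernstein (n j) k v)\<bar> < 1 / real (Suc j)" by metis
  have "bounded (F ` {0..1})" by (intro compact_imp_bounded compact_continuous_image F) simp
  then obtain K where K: "\<And>v. v \<in> {0..1} \<Longrightarrow> \<bar>F v\<bar> \<le> K"
    unfolding bounded_iff by (metis imageI real_norm_def)
  show ?thesis
  proof (rule exp_multipliers_lim[where B = "K + 1"])
    fix j
    show "(\<lambda>x. \<Sum>k\<le>n j. F (k / n j) * Bernstein (n j) k (\<psi> x)) \<in> exp_multipliers f"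
      unfolding Bernstein_def diff_conv_add_uminus
      by (intro exp_multipliers_sum exp_multipliers_mult exp_multipliers_const exp_multipliers_power \<psi>
           exp_multipliers_add) (use exp_multipliers_mult[OF exp_multipliers_const[of "-1"] \<psi>] in simp)
    show "\<bar>\<Sum>k\<le>n j. F (k / n j) * Bernstein (n j) k (\<psi> x)\<bar> \<le> K + 1" for x
    proof -
      have "1 / real (Suc j) \<le> 1" by simp
      then show ?thesis using n[OF r[of x], of j] K[OF r[of x]] by linarith
    qed
  next
    fix x
    show "(\<lambda>j. \<Sum>k\<le>n j. F (k / n j) * Bernstein (n j) k (\<psi> x)) \<longlonglongrightarrow> F (\<psi> x)"
    proof (rule LIMSEQ_I)
      fix e :: real assume "e > 0"
      then obtain N where N: "1 / real (Suc N) < e" using reals_Archimedean by (auto simp: inverse_eq_divide)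
      have "norm ((\<Sum>k\<le>n j. F (k / n j) * Bernstein (n j) k (\<psi> x)) - F (\<psi> x)) < e" if "j \<ge> N" for j
      proof -
        have "1 / real (Suc j) \<le> 1 / real (Suc N)" using that by (simp add: frac_le)
        then show ?thesis using n[OF r[of x], of j] N by (simp add: abs_minus_commute)
      qed
      then show "\<exists>N. \<forall>j\<ge>N. norm ((\<Sum>k\<le>n j. F (k / n j) * Bernstein (n j) k (\<psi> x)) - F (\<psi> x)) < e" by blast
    qed
  qed
qed

text \<open>The slab is the set where the Gaussian in x . b exceeds its value \<open>c\<close> at
  distance \<open>r\<close> from the centre, and the indicator of exceeding \<open>c\<close> is a
  pointwise limit of continuous ramps.\<close>

lemma exp_multipliers_slab:
  assumes b: "norm b = 1" and r: "r > 0"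
  shows "indicator {x. \<bar>x \<bullet> b - y\<bar> < r} \<in> exp_multipliers f"
proof -
  define \<psi> where "\<psi> x = exp (- (x \<bullet> b - y)\<^sup>2 / 8)" for x
  define c where "c = exp (- r\<^sup>2 / 8)"
  have \<psi>: "\<psi> \<in> exp_multipliers f" unfolding \<psi>_def by (rule exp_multipliers_gaussian[OF b])
  have iff: "\<bar>x \<bullet> b - y\<bar> < r \<longleftrightarrow> c < \<psi> x" for x
  proof -
    have "\<bar>x \<bullet> b - y\<bar> < r \<longleftrightarrow> \<bar>x \<bullet> b - y\<bar>\<^sup>2 < r\<^sup>2"
      using r power_strict_mono[of "\<bar>x \<bullet> b - y\<bar>" r 2] power_less_imp_less_base[of "\<bar>x \<bullet> b - y\<bar>" 2 r]
      by (intro iffI) (simp_all only: zero_less_numeral abs_ge_zero less_imp_le)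
    then show ?thesis by (simp add: \<psi>_def c_def)
  qed
  show ?thesis
  proof (rule exp_multipliers_lim[where B = 1])
    fix n
    show "(\<lambda>x. max 0 (min 1 (real n * (\<psi> x - c)))) \<in> exp_multipliers f"
      by (rule exp_multipliers_continuous[OF \<psi>]) (auto simp: \<psi>_def intro!: continuous_intros)
    show "\<bar>max 0 (min 1 (real n * (\<psi> x - c)))\<bar> \<le> 1" for x by auto
  next
    fix x
    show "(\<lambda>n. max 0 (min 1 (real n * (\<psi> x - c)))) \<longlonglongrightarrow> indicator {x. \<bar>x \<bullet> b - y\<bar> < r} x"
    proof (cases "c < \<psi> x")
      case True
      then obtain N where N: "1 < real N * (\<psi> x - c)" using reals_Archimedean3[of "\<psi> x - c"] by auto
      have "max 0 (min 1 (real n * (\<psi> x - c))) = 1" if "n \<ge> N" for n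
      proof -
        have "real N * (\<psi> x - c) \<le> real n * (\<psi> x - c)" using that True by (intro mult_right_mono) auto
        then show ?thesis using N by simp
      qed
      then have "\<forall>\<^sub>F n in sequentially. max 0 (min 1 (real n * (\<psi> x - c))) = 1"
        by (rule eventually_sequentiallyI)
      then show ?thesis using True by (simp add: iff tendsto_eventually)
    next
      case False
      then have le: "real n * (\<psi> x - c) \<le> 0" for n by (simp add: mult_le_0_iff)
      have "max 0 (min 1 (real n * (\<psi> x - c))) = 0" for n using le[of n] by linarith
      then show ?thesis using False by (simp add: iff)
    qed
  qed
qed

lemma exp_multipliers_compl:
  assumes "indicator A \<in> exp_multipliers f" shows "indicator (- A) \<in> exp_multipliers f"
proof -
  have "(\<lambda>x. 1 + (-1) * indicator A x) \<in> exp_multipliers f"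
    by (intro exp_multipliers_add exp_multipliers_mult exp_multipliers_const assms)
  also have "(\<lambda>x. 1 + (-1) * indicator A x) = (indicator (- A) :: _ \<Rightarrow> real)"
    by (auto simp: indicator_def)
  finally show ?thesis .
qed

lemma exp_multipliers_UN:
  fixes A :: "nat \<Rightarrow> (real^'n) set"
  assumes "\<And>i. indicator (A i) \<in> exp_multipliers f"
  shows "indicator (\<Union>i. A i) \<in> exp_multipliers f"
proof (rule exp_multipliers_lim[where B = 1])
  fix n
  \<comment> \<open>One minus the product of the complements is the indicator of a finite
    union.\<close>
  show "(\<lambda>x. 1 + (-1) * (\<Prod>i<n. indicator (- A i) x)) \<in> exp_multipliers f"
    by (intro exp_multipliers_add exp_multipliers_mult exp_multipliers_const exp_multipliers_prod
         exp_multipliers_compl assms)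
  show "\<bar>1 + (-1) * (\<Prod>i<n. indicator (- A i) x :: real)\<bar> \<le> 1" for x
  proof -
    have "0 \<le> (\<Prod>i<n. indicator (- A i) x :: real)" "(\<Prod>i<n. indicator (- A i) x :: real) \<le> 1"
      by (auto intro: prod_nonneg prod_le_1)
    then show ?thesis by linarith
  qed
next
  fix x
  show "(\<lambda>n. 1 + (-1) * (\<Prod>i<n. indicator (- A i) x)) \<longlonglongrightarrow> (indicator (\<Union>i. A i) x :: real)"
  proof (cases "x \<in> (\<Union>i. A i)")
    case True
    then obtain i where i: "x \<in> A i" by blast
    have "(\<Prod>i<n. indicator (- A i) x) = (0::real)" if "n \<ge> Suc i" for n
      using i that by (intro prod_zero) (auto intro!: bexI[of _ i])
    then have "\<forall>\<^sub>F n in sequentially. 1 + (-1) * (\<Prod>i<n. indicator (- A i) x) = (1::real)"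
      by (intro eventually_sequentiallyI[of "Suc i"]) auto
    then show ?thesis using True by (simp add: tendsto_eventually)
  qed (simp add: indicator_def)
qed

lemma exp_multipliers_borel:
  assumes "A \<in> sets borel" shows "indicator A \<in> exp_multipliers f"
proof -
  have b: "i \<in> Basis \<Longrightarrow> indicator {x. x \<bullet> i < a} \<in> exp_multipliers f" for i :: "real^'n" and a
  proof -
    assume i: "i \<in> Basis"
    \<comment> \<open>Slabs whose right face stays at \<open>a\<close> while the left face recedes
      exhaust the half-space.\<close>
    have "{x. x \<bullet> i < a} = (\<Union>n. {x. \<bar>x \<bullet> i - (a - real (Suc n))\<bar> < real (Suc n)})"
    proof (intro equalityI subsetI)
      fix x assume "x \<in> {x. x \<bullet> i < a}"
      moreover obtain n where "(a - x \<bullet> i) / 2 < real n" using reals_Archimedean2 by blast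
      ultimately have "\<bar>x \<bullet> i - (a - real (Suc n))\<bar> < real (Suc n)" by (auto simp: abs_if)
      then show "x \<in> (\<Union>n. {x. \<bar>x \<bullet> i - (a - real (Suc n))\<bar> < real (Suc n)})" by blast
    qed auto
    then show ?thesis using i by (simp only:) (intro exp_multipliers_UN exp_multipliers_slab; simp)
  qed
  have "A \<in> sigma_sets UNIV ((\<lambda>(a, i). {x. x \<bullet> i < a}) ` (UNIV \<times> Basis))"
    using assms by (subst (asm) borel_eq_halfspace_less) simp
  then show ?thesis
  proof (induction rule: sigma_sets.induct)
    case Empty
    then show ?case using exp_multipliers_const[of 0] by (simp add: indicator_def[abs_def])
  next
    case (Compl a)
    then show ?case using exp_multipliers_compl[of a] by (simp add: Compl_eq_Diff_UNIV)
  qed (use b in \<open>auto intro: exp_multipliers_UN\<close>)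
qed

text \<open>Integrating \<open>f\<close> over the sets where it is positive and where it is negative
  gives zero, so both parts vanish almost everywhere.\<close>

lemma exp_total:
  assumes "\<And>\<xi>. (\<integral>x. f x * exp (\<xi> \<bullet> x) \<partial>gauss) = 0"
  shows "AE x in gauss. f x = 0"
proof -
  have [measurable]: "f \<in> borel_measurable borel" using f by (simp add: sq_int_def)
  have "(\<lambda>x. 1) \<in> exp_annihilator f"
    using assms by (auto simp: exp_annihilator_def)
  then have 0: "(\<integral>x. f x * indicator A x \<partial>gauss) = 0" if "A \<in> sets borel" for A
  proof -
    have "(\<lambda>x. 1 * indicator A x) \<in> exp_annihilator f"
      using exp_multipliers_borel[OF that] \<open>(\<lambda>x. 1) \<in> exp_annihilator f\<close>
      by (simp only: exp_multipliers_def mem_Collect_eq)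
    then have "(\<integral>x. (f x * (1 * indicator A x)) * exp (0 \<bullet> x) \<partial>gauss) = 0" unfolding exp_annihilator_def by blast
    then show ?thesis by simp
  qed
  have i: "integrable gauss (\<lambda>x. f x * indicator A x)" if "A \<in> sets borel" for A
    using integrable_mult_indicator[of A gauss f] that by (simp add: sq_int_integrable f mult.commute)
  have "AE x in gauss. f x * indicator {x. f x > 0} x = 0"
    using 0[of "{x. f x > 0}"] integral_nonneg_eq_0_iff_AE[OF i[of "{x. f x > 0}"]]
    by (simp add: indicator_def)
  moreover have "AE x in gauss. - (f x * indicator {x. f x < 0} x) = 0"
    using 0[of "{x. f x < 0}"] integral_nonneg_eq_0_iff_AE[OF integrable_minus[OF i[of "{x. f x < 0}"]]]
    by (simp add: indicator_def)
  ultimately show ?thesis by eventually_elim (auto simp: indicator_def split: if_splits)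
qed

end

subsection \<open>Coherent vectors\<close>

text \<open>The density of the translated equilibrium f_inf(x - xi) relative to f_inf;
  \<open>coh 0\<close> is the constant 1. These are the exponential vectors of Fock space, not
  normalised to length 1.\<close>

definition coh :: "real^'n \<Rightarrow> 'n gl2" where
  "coh \<xi> = abs_gl2 (\<lambda>x. exp (\<xi> \<bullet> x - (norm \<xi>)\<^sup>2 / 2))"

lemma sq_int_coh: "sq_int (\<lambda>x. exp (\<xi> \<bullet> x - (norm \<xi>)\<^sup>2 / 2))"
  using sq_int_scale[OF sq_int_exp[of \<xi>], of "exp (- (norm \<xi>)\<^sup>2 / 2)"]
  by (simp flip: exp_add)

lemma inner_coh_abs:
  assumes "sq_int f"
  shows "abs_gl2 f \<bullet> coh \<xi> = exp (- (norm \<xi>)\<^sup>2 / 2) * (\<integral>x. f x * exp (\<xi> \<bullet> x) \<partial>gauss)"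
proof -
  have "abs_gl2 f \<bullet> coh \<xi> = (\<integral>x. f x * exp (\<xi> \<bullet> x - (norm \<xi>)\<^sup>2 / 2) \<partial>gauss)"
    unfolding coh_def by (rule inner_abs_gl2[OF assms sq_int_coh])
  also have "\<dots> = (\<integral>x. exp (- (norm \<xi>)\<^sup>2 / 2) * (f x * exp (\<xi> \<bullet> x)) \<partial>gauss)"
  proof (intro Bochner_Integration.integral_cong refl)
    have "u * exp (v - w / 2) = exp (- w / 2) * (u * exp v)" for u v w :: real
    proof -
      have "exp (v - w / 2) = exp v * exp (- w / 2)" by (simp flip: exp_add)
      then show ?thesis by (simp add: mult_ac)
    qed
    then show "f x * exp (\<xi> \<bullet> x - (norm \<xi>)\<^sup>2 / 2) = exp (- (norm \<xi>)\<^sup>2 / 2) * (f x * exp (\<xi> \<bullet> x))" for x .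
  qed
  finally show ?thesis by simp
qed

lemma inner_coh: "coh \<xi> \<bullet> coh \<eta> = exp (\<xi> \<bullet> \<eta>)"
proof -
  have "coh \<xi> \<bullet> coh \<eta> = (\<integral>x. exp (- (norm \<xi>)\<^sup>2 / 2 - (norm \<eta>)\<^sup>2 / 2) * exp ((\<xi> + \<eta>) \<bullet> x) \<partial>gauss)"
    unfolding coh_def by (subst inner_abs_gl2[OF sq_int_coh sq_int_coh])
      (simp add: inner_add_left algebra_simps flip: exp_add)
  also have "\<dots> = exp (- (norm \<xi>)\<^sup>2 / 2 - (norm \<eta>)\<^sup>2 / 2) * exp ((norm (\<xi> + \<eta>))\<^sup>2 / 2)"
    by (simp only: integral_mult_right_zero integral_gauss_exp)
  also have "\<dots> = exp (\<xi> \<bullet> \<eta>)"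
    unfolding power2_norm_eq_inner
    by (simp add: inner_add_left inner_add_right inner_commute add_divide_distrib flip: exp_add)
  finally show ?thesis .
qed

lemma norm_coh_0: "norm (coh 0) = 1"
  by (simp add: norm_eq_sqrt_inner inner_coh)

lemma coh_total:
  assumes "\<And>\<xi>. h \<bullet> coh \<xi> = 0" shows "h = 0"
proof -
  obtain f where f: "sq_int f" "h = abs_gl2 f" by (rule gl2_cases)
  have "AE x in gauss. f x = 0"
    by (rule exp_total[OF f(1)]) (use assms inner_coh_abs[OF f(1)] f(2) in simp)
  then show ?thesis using f by (simp add: gl2_eq_iff sq_int_0 zero_gl2.abs_eq)
qed

lemma gl2_eqI: "(\<And>\<xi>. g \<bullet> coh \<xi> = h \<bullet> coh \<xi>) \<Longrightarrow> g = h"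
  using coh_total[of "g - h"] by (simp add: inner_diff_left)

lemma coh_dense:
  assumes "subspace S" "closed S" "\<And>\<xi>. coh \<xi> \<in> S"
  shows "h \<in> S"
  using closed_subspace_eq_UNIV[OF assms(1,2)] coh_total assms(3) by blast

lemma subspace_closure:
  fixes S :: "'a::real_normed_vector set"
  assumes "subspace S" shows "subspace (closure S)"
proof (rule subspaceI)
  show "0 \<in> closure S" using subspace_0[OF assms] closure_subset by blast
  fix x y assume "x \<in> closure S" "y \<in> closure S"
  then obtain X Y where "\<And>n. X n \<in> S" "X \<longlonglongrightarrow> x" "\<And>n. Y n \<in> S" "Y \<longlonglongrightarrow> y"
    unfolding closure_sequential by blast
  then have "\<forall>n. X n + Y n \<in> S" "(\<lambda>n. X n + Y n) \<longlonglongrightarrow> x + y"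
    by (auto intro: subspace_add[OF assms] tendsto_add)
  then show "x + y \<in> closure S" unfolding closure_sequential by (intro exI[of _ "\<lambda>n. X n + Y n"]) blast
next
  fix x c assume "x \<in> closure S"
  then obtain X where "\<And>n. X n \<in> S" "X \<longlonglongrightarrow> x" unfolding closure_sequential by blast
  then have "\<forall>n. c *\<^sub>R X n \<in> S" "(\<lambda>n. c *\<^sub>R X n) \<longlonglongrightarrow> c *\<^sub>R x"
    by (auto intro: subspace_scale[OF assms] tendsto_intros)
  then show "c *\<^sub>R x \<in> closure S" unfolding closure_sequential by (intro exI[of _ "\<lambda>n. c *\<^sub>R X n"]) blast
qed

lemma closure_span_coh: "closure (span (range coh)) = (UNIV :: 'n::finite gl2 set)"
proof -
  have "h \<in> closure (span (range coh))" for h :: "'n::finite gl2"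
    by (rule coh_dense) (auto intro: closure_subset[THEN subsetD] span_base subspace_closure)
  then show ?thesis by blast
qed

lemma span_coh_representation:
  assumes "h \<in> span (range coh)"
  obtains F a where "finite F" "h = (\<Sum>\<xi>\<in>F. a \<xi> *\<^sub>R coh \<xi>)"
proof -
  have "\<exists>F a. finite F \<and> h = (\<Sum>\<xi>\<in>F. a \<xi> *\<^sub>R coh \<xi>)"
    using assms
  proof (induction rule: span_induct_alt)
    case base show ?case by (intro exI[of _ "{}"]) simp
  next
    case (step c x y)
    then obtain F a \<xi> where F: "finite F" "y = (\<Sum>\<xi>\<in>F. a \<xi> *\<^sub>R coh \<xi>)" and x: "x = coh \<xi>" by auto
    define a' where "a' \<eta> = (if \<eta> \<in> F then a \<eta> else 0) + (if \<eta> = \<xi> then c else 0)" for \<eta>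
    have "(\<Sum>\<eta>\<in>insert \<xi> F. a' \<eta> *\<^sub>R coh \<eta>)
        = (\<Sum>\<eta>\<in>insert \<xi> F. (if \<eta> \<in> F then a \<eta> *\<^sub>R coh \<eta> else 0)) + (\<Sum>\<eta>\<in>insert \<xi> F. (if \<eta> = \<xi> then c *\<^sub>R coh \<eta> else 0))"
      unfolding sum.distrib[symmetric] a'_def by (intro sum.cong refl) (simp add: scaleR_add_left)
    also have "(\<Sum>\<eta>\<in>insert \<xi> F. (if \<eta> \<in> F then a \<eta> *\<^sub>R coh \<eta> else 0)) = (\<Sum>\<eta>\<in>F. a \<eta> *\<^sub>R coh \<eta>)"
      using F(1) by (intro sum.mono_neutral_cong_right) auto
    also have "(\<Sum>\<eta>\<in>insert \<xi> F. (if \<eta> = \<xi> then c *\<^sub>R coh \<eta> else 0)) = c *\<^sub>R coh \<xi>"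
      using F(1) by (simp add: sum.delta)
    finally have "c *\<^sub>R x + y = (\<Sum>\<eta>\<in>insert \<xi> F. a' \<eta> *\<^sub>R coh \<eta>)" using F x by simp
    then show ?case using F(1) by (intro exI[of _ "insert \<xi> F"] exI[of _ a']) simp
  qed
  with that show ?thesis by blast
qed

subsection \<open>Positive semidefinite kernels\<close>

definition psd_on :: "'i set \<Rightarrow> ('i \<Rightarrow> 'i \<Rightarrow> real) \<Rightarrow> bool" where
  "psd_on F D \<longleftrightarrow> (\<forall>a. 0 \<le> (\<Sum>i\<in>F. \<Sum>j\<in>F. a i * a j * D i j))"

lemma psd_on_add: "psd_on F D \<Longrightarrow> psd_on F E \<Longrightarrow> psd_on F (\<lambda>i j. D i j + E i j)"
  by (simp add: psd_on_def distrib_left sum.distrib)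

lemma psd_on_scale:
  assumes "psd_on F D" "0 \<le> c" shows "psd_on F (\<lambda>i j. c * D i j)"
proof -
  have "(\<Sum>i\<in>F. \<Sum>j\<in>F. a i * a j * (c * D i j)) = c * (\<Sum>i\<in>F. \<Sum>j\<in>F. a i * a j * D i j)" for a
    by (simp add: sum_distrib_left mult_ac)
  then show ?thesis using assms by (simp add: psd_on_def)
qed

lemma psd_on_one: "psd_on F (\<lambda>i j. 1)"
proof -
  have "(\<Sum>i\<in>F. \<Sum>j\<in>F. a i * a j * 1) = (\<Sum>i\<in>F. a i)\<^sup>2" for a :: "'a \<Rightarrow> real"
    by (simp add: power2_eq_square sum_product)
  then show ?thesis by (simp add: psd_on_def)
qed

text \<open>Schur's product theorem with a Gram kernel as second factor: in an orthonormal basis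
  each coordinate of \<open>u\<close> is absorbed into the coefficients \<open>a\<close>, which
  leaves a sum of forms of \<open>D\<close>.\<close>

lemma psd_on_mult_inner:
  fixes u :: "'i \<Rightarrow> 'b::euclidean_space"
  assumes "psd_on F D"
  shows "psd_on F (\<lambda>i j. D i j * (u i \<bullet> u j))"
  unfolding psd_on_def
proof
  fix a :: "'i \<Rightarrow> real"
  have "(\<Sum>i\<in>F. \<Sum>j\<in>F. a i * a j * (D i j * (u i \<bullet> u j)))
      = (\<Sum>i\<in>F. \<Sum>j\<in>F. \<Sum>b\<in>Basis. (a i * (u i \<bullet> b)) * (a j * (u j \<bullet> b)) * D i j)"
    by (subst euclidean_inner) (simp add: sum_distrib_left mult_ac)
  also have "\<dots> = (\<Sum>i\<in>F. \<Sum>b\<in>Basis. \<Sum>j\<in>F. (a i * (u i \<bullet> b)) * (a j * (u j \<bullet> b)) * D i j)"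
    by (intro sum.cong refl sum.swap)
  also have "\<dots> = (\<Sum>b\<in>Basis. \<Sum>i\<in>F. \<Sum>j\<in>F. (a i * (u i \<bullet> b)) * (a j * (u j \<bullet> b)) * D i j)"
    by (rule sum.swap)
  also have "\<dots> \<ge> 0"
  proof (rule sum_nonneg)
    show "0 \<le> (\<Sum>i\<in>F. \<Sum>j\<in>F. (a i * (u i \<bullet> b)) * (a j * (u j \<bullet> b)) * D i j)" for b
      using assms[unfolded psd_on_def, rule_format, of "\<lambda>i. a i * (u i \<bullet> b)"] .
  qed
  finally show "0 \<le> (\<Sum>i\<in>F. \<Sum>j\<in>F. a i * a j * (D i j * (u i \<bullet> u j)))" .
qed

lemma psd_on_mult_inner_power:
  fixes u :: "'i \<Rightarrow> 'b::euclidean_space"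
  assumes "psd_on F D"
  shows "psd_on F (\<lambda>i j. D i j * (u i \<bullet> u j) ^ n)"
proof (induction n)
  case (Suc n)
  from psd_on_mult_inner[OF this, of u] show ?case by (simp add: mult_ac)
qed (use assms in simp)

lemma power2_norm_sum:
  "(norm (\<Sum>x\<in>F. a x *\<^sub>R v x))\<^sup>2 = (\<Sum>x\<in>F. \<Sum>y\<in>F. a x * a y * (v x \<bullet> v y))"
  for v :: "'i \<Rightarrow> 'b::real_inner"
  unfolding power2_norm_eq_inner inner_sum_left
  unfolding inner_sum_right by (simp add: mult_ac)

text \<open>For s the combination of the vectors with coefficients a, the form equals rho^2 |s|^2 -
  |A s|^2.\<close>

lemma psd_on_contraction:
  fixes A :: "'b::euclidean_space \<Rightarrow> 'b"
  assumes A: "linear A" and \<rho>: "\<And>x. norm (A x) \<le> \<rho> * norm x"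
  shows "psd_on F (\<lambda>x y. \<rho>\<^sup>2 * (x \<bullet> y) - A x \<bullet> A y)"
  unfolding psd_on_def
proof
  fix a :: "'b \<Rightarrow> real"
  let ?s = "\<Sum>x\<in>F. a x *\<^sub>R x"
  have e: "(\<Sum>x\<in>F. \<Sum>y\<in>F. a x * a y * (g x \<bullet> g y)) = (norm (\<Sum>x\<in>F. a x *\<^sub>R g x))\<^sup>2" for g :: "'b \<Rightarrow> 'b"
    by (simp add: power2_norm_sum)
  have "(norm (A ?s))\<^sup>2 \<le> (\<rho> * norm ?s)\<^sup>2" by (rule power_mono[OF \<rho>]) simp
  moreover have "A ?s = (\<Sum>x\<in>F. a x *\<^sub>R A x)" using A by (simp add: linear_sum linear_cmul)
  moreover have "(\<Sum>x\<in>F. \<Sum>y\<in>F. a x * a y * (\<rho>\<^sup>2 * (x \<bullet> y) - A x \<bullet> A y))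
     = \<rho>\<^sup>2 * (\<Sum>x\<in>F. \<Sum>y\<in>F. a x * a y * (x \<bullet> y)) - (\<Sum>x\<in>F. \<Sum>y\<in>F. a x * a y * (A x \<bullet> A y))"
    by (simp add: right_diff_distrib sum_subtractf sum_distrib_left mult_ac)
  ultimately show "0 \<le> (\<Sum>x\<in>F. \<Sum>y\<in>F. a x * a y * (\<rho>\<^sup>2 * (x \<bullet> y) - A x \<bullet> A y))"
    unfolding e[of "\<lambda>x. x"] e[of A] by (simp add: power_mult_distrib)
qed

text \<open>With X = x . y and Y = A x . A y, the induction splits rho^(2n+2) X^(n+1) - Y^(n+1) into
  rho^2 X (rho^(2n) X^n - Y^n) and (rho^2 X - Y) Y^n, each a positive semidefinite kernel times Gram
  kernels.\<close>

lemma psd_on_contraction_power: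
  fixes A :: "'b::euclidean_space \<Rightarrow> 'b"
  assumes A: "linear A" and \<rho>: "\<And>x. norm (A x) \<le> \<rho> * norm x"
  shows "psd_on F (\<lambda>x y. \<rho>\<^sup>2 ^ n * (x \<bullet> y) ^ n - (A x \<bullet> A y) ^ n)"
proof (induction n)
  case 0 show ?case by (simp add: psd_on_def)
next
  case (Suc n)
  have 1: "psd_on F (\<lambda>x y. \<rho>\<^sup>2 * ((\<rho>\<^sup>2 ^ n * (x \<bullet> y) ^ n - (A x \<bullet> A y) ^ n) * (x \<bullet> y)))"
    by (intro psd_on_scale psd_on_mult_inner Suc) simp
  have 2: "psd_on F (\<lambda>x y. (\<rho>\<^sup>2 * (x \<bullet> y) - A x \<bullet> A y) * (A x \<bullet> A y) ^ n)"
    by (intro psd_on_mult_inner_power psd_on_contraction assms)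
  show ?case using psd_on_add[OF 1 2] by (simp add: algebra_simps)
qed

text \<open>Schur's product theorem applied to each term of the exponential series.\<close>
lemma psd_on_exp_contraction:
  fixes A :: "'b::euclidean_space \<Rightarrow> 'b"
  assumes A: "linear A" and \<rho>: "\<And>x. norm (A x) \<le> \<rho> * norm x" "0 \<le> \<rho>" "\<rho> \<le> 1"
  shows "psd_on F (\<lambda>x y. \<rho>\<^sup>2 * (exp (x \<bullet> y) - 1) - (exp (A x \<bullet> A y) - 1))"
  unfolding psd_on_def
proof
  fix a :: "'b \<Rightarrow> real"
  define q where "q n = (\<Sum>x\<in>F. \<Sum>y\<in>F. a x * a y * (\<rho>\<^sup>2 * ((x \<bullet> y) ^ Suc n / fact (Suc n)) - (A x \<bullet> A y) ^ Suc n / fact (Suc n)))" for n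
  have e: "(\<lambda>n. u ^ Suc n / fact (Suc n)) sums (exp u - 1)" for u :: real
    using exp_converges[of u] unfolding sums_Suc_iff[where f="\<lambda>n. u ^ n / fact n"] by (simp add: field_simps)
  have "q sums (\<Sum>x\<in>F. \<Sum>y\<in>F. a x * a y * (\<rho>\<^sup>2 * (exp (x \<bullet> y) - 1) - (exp (A x \<bullet> A y) - 1)))"
    unfolding q_def by (intro sums_sum sums_mult sums_diff e)
  moreover have "0 \<le> q n" for n
  proof -
    \<comment> \<open>Here \<open>\<rho> \<le> 1\<close> enters: degree n + 1 comes with the factor
      rho^(2n+2), which is weakened to rho^2, the factor that is sharp in degree 1. Degree 0 is
      absent because of the subtracted 1.\<close>
    have 1: "psd_on F (\<lambda>x y. (\<rho>\<^sup>2 - \<rho>\<^sup>2 ^ Suc n) * (1 * (x \<bullet> y) ^ Suc n))"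
    proof (rule psd_on_scale[OF psd_on_mult_inner_power[OF psd_on_one]])
      have "\<rho>\<^sup>2 \<le> 1" using \<rho> by (simp add: power_le_one)
      then have "\<rho>\<^sup>2 ^ Suc n \<le> \<rho>\<^sup>2" using power_le_one[of "\<rho>\<^sup>2" n] by (simp add: mult_left_le)
      then show "0 \<le> \<rho>\<^sup>2 - \<rho>\<^sup>2 ^ Suc n" by simp
    qed
    have "psd_on F (\<lambda>x y. (1 / fact (Suc n)) * ((\<rho>\<^sup>2 - \<rho>\<^sup>2 ^ Suc n) * (1 * (x \<bullet> y) ^ Suc n)
        + (\<rho>\<^sup>2 ^ Suc n * (x \<bullet> y) ^ Suc n - (A x \<bullet> A y) ^ Suc n)))"
      by (intro psd_on_scale psd_on_add 1 psd_on_contraction_power A \<rho>) simp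
    also have "(\<lambda>x y. (1 / fact (Suc n)) * ((\<rho>\<^sup>2 - \<rho>\<^sup>2 ^ Suc n) * (1 * (x \<bullet> y) ^ Suc n)
        + (\<rho>\<^sup>2 ^ Suc n * (x \<bullet> y) ^ Suc n - (A x \<bullet> A y) ^ Suc n)))
      = (\<lambda>x y. \<rho>\<^sup>2 * ((x \<bullet> y) ^ Suc n / fact (Suc n)) - (A x \<bullet> A y) ^ Suc n / fact (Suc n))"
    proof -
      have "(1 / c) * ((r - p) * (1 * X) + (p * X - Y)) = r * (X / c) - Y / c" for c r p X Y :: real
        by (simp add: algebra_simps diff_divide_distrib)
      then show ?thesis by (simp only:)
    qed
    finally show ?thesis unfolding psd_on_def q_def by blast
  qed
  ultimately show "0 \<le> (\<Sum>x\<in>F. \<Sum>y\<in>F. a x * a y * (\<rho>\<^sup>2 * (exp (x \<bullet> y) - 1) - (exp (A x \<bullet> A y) - 1)))"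
    by (rule sums_le[OF _ sums_zero, rotated])
qed

subsection \<open>Second quantization of a contraction\<close>

text \<open>A weak characterisation: the pairings with the total family \<open>coh\<close> determine
  \<open>g\<close>. Linearity and compatibility with limits then follow from uniqueness, without
  choosing a representation of \<open>h\<close>.\<close>

definition is_Gam :: "(real^'n \<Rightarrow> real^'n) \<Rightarrow> 'n gl2 \<Rightarrow> 'n gl2 \<Rightarrow> bool" where
  "is_Gam A h g \<longleftrightarrow> (\<forall>\<xi>. g \<bullet> coh \<xi> = h \<bullet> coh (adjoint A \<xi>))"

definition Gam :: "(real^'n \<Rightarrow> real^'n) \<Rightarrow> 'n gl2 \<Rightarrow> 'n gl2" where
  "Gam A h = (THE g. is_Gam A h g)"

lemma is_Gam_unique: "is_Gam A h g \<Longrightarrow> is_Gam A h g' \<Longrightarrow> g = g'"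
  by (rule gl2_eqI) (simp add: is_Gam_def)

lemma is_Gam_add: "is_Gam A h g \<Longrightarrow> is_Gam A h' g' \<Longrightarrow> is_Gam A (h + h') (g + g')"
  by (simp add: is_Gam_def inner_add_left)

lemma is_Gam_diff: "is_Gam A h g \<Longrightarrow> is_Gam A h' g' \<Longrightarrow> is_Gam A (h - h') (g - g')"
  by (simp add: is_Gam_def inner_diff_left)

lemma is_Gam_scale: "is_Gam A h g \<Longrightarrow> is_Gam A (c *\<^sub>R h) (c *\<^sub>R g)"
  by (simp add: is_Gam_def)

lemma is_Gam_coh: "linear A \<Longrightarrow> is_Gam A (coh \<eta>) (coh (A \<eta>))"
  unfolding is_Gam_def inner_coh using adjoint_works[of A] by (simp add: inner_commute)

lemma is_Gam_sum:
  "(\<And>i. i \<in> F \<Longrightarrow> is_Gam A (h i) (g i)) \<Longrightarrow> is_Gam A (\<Sum>i\<in>F. h i) (\<Sum>i\<in>F. g i)"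
  by (simp add: is_Gam_def inner_sum_left)

context
  fixes A :: "real^'n \<Rightarrow> real^'n" and \<rho> :: real
  assumes A: "linear A" and \<rho>: "\<And>x. norm (A x) \<le> \<rho> * norm x" "0 \<le> \<rho>" "\<rho> \<le> 1"
begin

text \<open>On finite combinations the squared norms are the forms of the kernels exp(x . y) and
  exp(A x . A y), and the squared equilibrium component is the form of the constant kernel 1. The
  kernel inequality is therefore literally the bound on the complement of
  \<open>coh 0\<close>.\<close>

lemma is_Gam_span:
  assumes "h \<in> span (range coh)"
  obtains g where "is_Gam A h g" "norm g \<le> norm h" "norm (g - (h \<bullet> coh 0) *\<^sub>R coh 0) \<le> \<rho> * norm h"
proof -
  obtain F a where F: "finite F" "h = (\<Sum>\<xi>\<in>F. a \<xi> *\<^sub>R coh \<xi>)" by (rule span_coh_representation[OF assms])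
  define g where "g = (\<Sum>\<xi>\<in>F. a \<xi> *\<^sub>R coh (A \<xi>))"
  define s where "s = (\<Sum>\<xi>\<in>F. a \<xi>)"
  have g: "is_Gam A h g"
    unfolding F(2) g_def by (intro is_Gam_sum is_Gam_scale is_Gam_coh A)
  have s: "h \<bullet> coh 0 = s" "g \<bullet> coh 0 = s"
    by (simp_all add: F(2) g_def s_def inner_sum_left inner_coh)
  have nh: "(norm h)\<^sup>2 = (\<Sum>x\<in>F. \<Sum>y\<in>F. a x * a y * exp (x \<bullet> y))"
    by (simp add: F(2) power2_norm_sum inner_coh)
  have ng: "(norm g)\<^sup>2 = (\<Sum>x\<in>F. \<Sum>y\<in>F. a x * a y * exp (A x \<bullet> A y))"
    by (simp add: g_def power2_norm_sum inner_coh)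
  have ss: "s\<^sup>2 = (\<Sum>x\<in>F. \<Sum>y\<in>F. a x * a y)"
    by (simp add: s_def power2_eq_square sum_product)
  have "0 \<le> (\<Sum>x\<in>F. \<Sum>y\<in>F. a x * a y * (\<rho>\<^sup>2 * (exp (x \<bullet> y) - 1) - (exp (A x \<bullet> A y) - 1)))"
    using psd_on_exp_contraction[OF A \<rho>] unfolding psd_on_def by blast
  also have "\<dots> = \<rho>\<^sup>2 * ((norm h)\<^sup>2 - s\<^sup>2) - ((norm g)\<^sup>2 - s\<^sup>2)"
    unfolding nh ng ss by (simp add: algebra_simps sum_subtractf sum.distrib sum_distrib_left)
  finally have main: "(norm g)\<^sup>2 - s\<^sup>2 \<le> \<rho>\<^sup>2 * ((norm h)\<^sup>2 - s\<^sup>2)" by simp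
  have proj: "(norm (k - s *\<^sub>R coh 0))\<^sup>2 = (norm k)\<^sup>2 - s\<^sup>2" if "k \<bullet> coh 0 = s" for k :: "'n gl2"
    using that unfolding power2_norm_eq_inner
    by (simp add: inner_diff_left inner_diff_right inner_commute inner_coh power2_eq_square)
  have hs: "0 \<le> (norm h)\<^sup>2 - s\<^sup>2" unfolding proj[OF s(1), symmetric] by simp
  have r1: "\<rho>\<^sup>2 \<le> 1" using \<rho> by (simp add: power_le_one)
  have "(norm g)\<^sup>2 - s\<^sup>2 \<le> 1 * ((norm h)\<^sup>2 - s\<^sup>2)"
    using main mult_right_mono[OF r1 hs] by linarith
  then have "(norm g)\<^sup>2 \<le> (norm h)\<^sup>2" by simp
  then have n1: "norm g \<le> norm h" by (rule power2_le_imp_le) simp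
  have "\<rho>\<^sup>2 * ((norm h)\<^sup>2 - s\<^sup>2) \<le> \<rho>\<^sup>2 * (norm h)\<^sup>2" by (intro mult_left_mono) simp_all
  then have "(norm (g - s *\<^sub>R coh 0))\<^sup>2 \<le> (\<rho> * norm h)\<^sup>2"
    unfolding proj[OF s(2)] using main by (simp add: power_mult_distrib)
  then have "norm (g - s *\<^sub>R coh 0) \<le> \<rho> * norm h"
    by (rule power2_le_imp_le) (simp add: \<rho>)
  with that g n1 s(1) show ?thesis by blast
qed

text \<open>Extension by density. Uniqueness identifies the image of a difference with the
  difference of the images, so the contraction bound transports the Cauchy property from the data to
  the images.\<close>

lemma is_Gam_exists:
  obtains g where "is_Gam A h g" "norm g \<le> norm h" "norm (g - (h \<bullet> coh 0) *\<^sub>R coh 0) \<le> \<rho> * norm h"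
proof -
  have "h \<in> closure (span (range coh))" by (simp add: closure_span_coh)
  then obtain H where H: "\<And>n. H n \<in> span (range coh)" "H \<longlonglongrightarrow> h"
    unfolding closure_sequential by blast
  have "\<exists>g. is_Gam A (H n) g \<and> norm g \<le> norm (H n) \<and> norm (g - (H n \<bullet> coh 0) *\<^sub>R coh 0) \<le> \<rho> * norm (H n)" for n
    using is_Gam_span[OF H(1)[of n]] by metis
  then obtain G where G: "\<And>n. is_Gam A (H n) (G n)" "\<And>n. norm (G n) \<le> norm (H n)"
    "\<And>n. norm (G n - (H n \<bullet> coh 0) *\<^sub>R coh 0) \<le> \<rho> * norm (H n)" by metis
  have d: "dist (G m) (G n) \<le> dist (H m) (H n)" for m n
  proof -
    obtain g where g: "is_Gam A (H m - H n) g" "norm g \<le> norm (H m - H n)"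
      using is_Gam_span[OF span_diff[OF H(1)[of m] H(1)[of n]]] by metis
    have "g = G m - G n" using is_Gam_unique[OF g(1) is_Gam_diff[OF G(1) G(1)]] .
    then show ?thesis using g(2) by (simp add: dist_norm)
  qed
  have "Cauchy H" using H(2) by (rule LIMSEQ_imp_Cauchy)
  then have "Cauchy G" unfolding Cauchy_def using d by (meson order_le_less_trans)
  then obtain g where g: "G \<longlonglongrightarrow> g" using Cauchy_convergent_iff convergent_def by blast
  show ?thesis
  proof (rule that[of g])
    have "g \<bullet> coh \<xi> = h \<bullet> coh (adjoint A \<xi>)" for \<xi>
    proof (rule LIMSEQ_unique)
      show "(\<lambda>n. G n \<bullet> coh \<xi>) \<longlonglongrightarrow> g \<bullet> coh \<xi>" by (intro tendsto_intros g)
      show "(\<lambda>n. G n \<bullet> coh \<xi>) \<longlonglongrightarrow> h \<bullet> coh (adjoint A \<xi>)"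
        using G(1) unfolding is_Gam_def by (simp only:) (intro tendsto_intros H)
    qed
    then show "is_Gam A h g" by (simp add: is_Gam_def)
    show "norm g \<le> norm h"
      by (rule LIMSEQ_le[OF tendsto_norm[OF g] tendsto_norm[OF H(2)]]) (use G(2) in blast)
    show "norm (g - (h \<bullet> coh 0) *\<^sub>R coh 0) \<le> \<rho> * norm h"
    proof (rule LIMSEQ_le)
      show "(\<lambda>n. norm (G n - (H n \<bullet> coh 0) *\<^sub>R coh 0)) \<longlonglongrightarrow> norm (g - (h \<bullet> coh 0) *\<^sub>R coh 0)"
        by (intro tendsto_intros g H)
      show "(\<lambda>n. \<rho> * norm (H n)) \<longlonglongrightarrow> \<rho> * norm h" by (intro tendsto_intros H)
    qed (use G(3) in blast)
  qed
qed

lemma Gam_eqI: "is_Gam A h g \<Longrightarrow> Gam A h = g"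
  unfolding Gam_def by (rule the_equality) (auto intro: is_Gam_unique)

lemma is_Gam_Gam: "is_Gam A h (Gam A h)"
  using is_Gam_exists[of h] Gam_eqI by metis

lemma Gam_inner: "Gam A h \<bullet> coh \<xi> = h \<bullet> coh (adjoint A \<xi>)"
  using is_Gam_Gam unfolding is_Gam_def by blast

lemma Gam_coh: "Gam A (coh \<eta>) = coh (A \<eta>)"
  by (rule Gam_eqI[OF is_Gam_coh[OF A]])

lemma Gam_add: "Gam A (g + h) = Gam A g + Gam A h"
  by (intro Gam_eqI is_Gam_add is_Gam_Gam)

lemma Gam_diff: "Gam A (g - h) = Gam A g - Gam A h"
  by (intro Gam_eqI is_Gam_diff is_Gam_Gam)

lemma Gam_scale: "Gam A (c *\<^sub>R h) = c *\<^sub>R Gam A h"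
  by (intro Gam_eqI is_Gam_scale is_Gam_Gam)

lemma norm_Gam: "norm (Gam A h) \<le> norm h"
  using is_Gam_exists[of h] Gam_eqI by metis

lemma norm_Gam_perp: "norm (Gam A h - (h \<bullet> coh 0) *\<^sub>R coh 0) \<le> \<rho> * norm h"
  using is_Gam_exists[of h] Gam_eqI by metis

end

subsection \<open>The exponential of a linear operator\<close>

text \<open>exp(t T) applied to a vector, as a series of vectors, so that linearity, commutation
  with \<open>T\<close> and adjoints are read off term by term.\<close>

definition opexp :: "('a::euclidean_space \<Rightarrow> 'a) \<Rightarrow> real \<Rightarrow> 'a \<Rightarrow> 'a" where
  "opexp T t x = (\<Sum>k. (t ^ k / fact k) *\<^sub>R (T ^^ k) x)"

lemma linear_funpow: "linear T \<Longrightarrow> linear (T ^^ k)" for T :: "'a::real_vector \<Rightarrow> 'a"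
  by (induction k) (auto intro: linear_compose simp: linear_id[unfolded id_def] id_def)

lemma norm_funpow_le:
  fixes T :: "'a::real_normed_vector \<Rightarrow> 'a"
  assumes "\<And>x. norm (T x) \<le> K * norm x" "0 \<le> K"
  shows "norm ((T ^^ k) x) \<le> K ^ k * norm x"
proof (induction k)
  case (Suc k)
  have "norm ((T ^^ Suc k) x) \<le> K * norm ((T ^^ k) x)" using assms(1) by simp
  also have "\<dots> \<le> K * (K ^ k * norm x)" by (intro mult_left_mono Suc assms)
  finally show ?case by (simp add: mult_ac)
qed simp

context
  fixes T :: "'a::euclidean_space \<Rightarrow> 'a"
  assumes T: "linear T"
begin

lemma operator_bound: obtains K where "0 \<le> K" "\<And>x. norm (T x) \<le> K * norm x"
  using linear_bounded_pos[OF T] by (metis less_imp_le)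

lemma opexp_norm_summable: "summable (\<lambda>k. norm ((t ^ k / fact k) *\<^sub>R (T ^^ k) x))"
proof -
  obtain K where K: "0 \<le> K" "\<And>x. norm (T x) \<le> K * norm x" using operator_bound by blast
  show ?thesis
  proof (rule summable_comparison_test')
    show "summable (\<lambda>k. (\<bar>t\<bar> * K) ^ k /\<^sub>R fact k * norm x)"
      by (intro summable_mult2 summable_exp_generic)
    show "norm (norm ((t ^ k / fact k) *\<^sub>R (T ^^ k) x)) \<le> (\<bar>t\<bar> * K) ^ k /\<^sub>R fact k * norm x" if "k \<ge> 0" for k
      using mult_left_mono[OF norm_funpow_le[OF K(2,1), of k x], of "\<bar>t\<bar> ^ k / fact k"]
      by (simp add: power_mult_distrib power_abs field_simps)
  qed
qed

lemma opexp_sums: "(\<lambda>k. (t ^ k / fact k) *\<^sub>R (T ^^ k) x) sums opexp T t x"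
  unfolding opexp_def by (rule summable_sums[OF summable_norm_cancel[OF opexp_norm_summable]])

lemma opexp_0: "opexp T 0 x = x"
proof -
  have "(\<lambda>k. (0 ^ k / fact k) *\<^sub>R (T ^^ k) x) sums x"
  proof -
    have "(\<lambda>k. (0 ^ k / fact k) *\<^sub>R (T ^^ k) x) = (\<lambda>k. if k = 0 then (T ^^ k) x else 0)" by auto
    then show ?thesis using sums_single[of 0 "\<lambda>k. (T ^^ k) x"] by simp
  qed
  then show ?thesis using opexp_sums[of 0 x] sums_unique2 by blast
qed

lemma linear_opexp: "linear (opexp T t)"
proof (rule linearI)
  fix x y c
  have l: "linear (T ^^ k)" for k by (rule linear_funpow[OF T])
  show "opexp T t (x + y) = opexp T t x + opexp T t y"
    using sums_add[OF opexp_sums[of t x] opexp_sums[of t y]] opexp_sums[of t "x + y"]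
    by (simp add: linear_add[OF l] scaleR_add_right sums_unique2)
  show "opexp T t (c *\<^sub>R x) = c *\<^sub>R opexp T t x"
    using bounded_linear.sums[OF bounded_linear_scaleR_right opexp_sums[of t x], of c] opexp_sums[of t "c *\<^sub>R x"]
    by (simp add: linear_cmul[OF l] mult.commute sums_unique2)
qed

lemma opexp_commute: "T (opexp T t x) = opexp T t (T x)"
proof -
  have "bounded_linear T" using T by (simp add: linear_conv_bounded_linear)
  from bounded_linear.sums[OF this opexp_sums[of t x]] opexp_sums[of t "T x"]
  show ?thesis by (simp add: linear_cmul[OF T] funpow_swap1 sums_unique2)
qed

text \<open>Each coordinate is a scalar power series in t, and the coefficients of its formal
  derivative are those belonging to \<open>T x\<close>.\<close>

lemma opexp_has_vector_derivative: "((\<lambda>t. opexp T t x) has_vector_derivative T (opexp T t x)) (at t)"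
  unfolding has_vector_derivative_def
proof (subst has_derivative_componentwise_within, intro ballI)
  fix b :: 'a assume "b \<in> Basis"
  define c where "c k = ((T ^^ k) x \<bullet> b) / fact k" for k
  have s: "(\<lambda>k. c k * s ^ k) sums (opexp T s x \<bullet> b)" for s
    using bounded_linear.sums[OF bounded_linear_inner_left opexp_sums[of s x], of b]
    by (simp add: c_def mult_ac)
  have e: "opexp T s x \<bullet> b = (\<Sum>k. c k * s ^ k)" for s using s sums_unique by blast
  have d: "diffs c k = ((T ^^ k) (T x) \<bullet> b) / fact k" for k
    by (simp add: diffs_def c_def funpow_swap1 field_simps del: of_nat_Suc)
  have "(\<lambda>k. diffs c k * t ^ k) sums (opexp T t (T x) \<bullet> b)"
    using bounded_linear.sums[OF bounded_linear_inner_left opexp_sums[of t "T x"], of b]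
    by (simp add: d mult_ac)
  then have "(\<Sum>k. diffs c k * t ^ k) = T (opexp T t x) \<bullet> b" by (simp add: opexp_commute sums_iff)
  moreover have "((\<lambda>s. \<Sum>k. c k * s ^ k) has_real_derivative (\<Sum>k. diffs c k * t ^ k)) (at t)"
    by (rule termdiffs_strong_converges_everywhere) (use s sums_summable in blast)
  ultimately show "((\<lambda>s. opexp T s x \<bullet> b) has_derivative (\<lambda>h. h *\<^sub>R T (opexp T t x) \<bullet> b)) (at t)"
    unfolding e by (simp add: has_field_derivative_def mult_commute_abs)
qed

text \<open>The tail from degree n on is at most |t|^n K^n times the series of exp K, because |t|
  \<le> 1 and 1/(k+n)! \<le> 1/k!.\<close>

lemma opexp_remainder:
  obtains M where "0 \<le> M"
    "\<And>t x. \<bar>t\<bar> \<le> 1 \<Longrightarrow> norm (opexp T t x - (\<Sum>k<n. (t ^ k / fact k) *\<^sub>R (T ^^ k) x)) \<le> M * \<bar>t\<bar> ^ n * norm x"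
proof -
  obtain K where K: "0 \<le> K" "\<And>x. norm (T x) \<le> K * norm x" using operator_bound by blast
  have "norm (opexp T t x - (\<Sum>k<n. (t ^ k / fact k) *\<^sub>R (T ^^ k) x)) \<le> (K ^ n * exp K) * \<bar>t\<bar> ^ n * norm x"
    if t: "\<bar>t\<bar> \<le> 1" for t x
  proof -
    let ?f = "\<lambda>k. (t ^ k / fact k) *\<^sub>R (T ^^ k) x"
    have sm: "summable ?f" by (rule summable_norm_cancel[OF opexp_norm_summable])
    have b: "norm (?f (k + n)) \<le> (K ^ k / fact k) * (K ^ n * \<bar>t\<bar> ^ n * norm x)" for k
    proof -
      have "\<bar>t\<bar> ^ k / fact (k + n) \<le> 1 / fact k"
        by (intro frac_le power_le_one fact_mono) (use t in auto)
      then have "\<bar>t\<bar> ^ k / fact (k + n) * (\<bar>t\<bar> ^ n * norm ((T ^^ (k + n)) x))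
          \<le> 1 / fact k * (\<bar>t\<bar> ^ n * (K ^ (k + n) * norm x))"
        by (intro mult_mono norm_funpow_le K) auto
      then show ?thesis by (simp add: power_add power_abs mult_ac abs_mult)
    qed
    have es: "(\<lambda>k. (K ^ k / fact k) * (K ^ n * \<bar>t\<bar> ^ n * norm x)) sums (exp K * (K ^ n * \<bar>t\<bar> ^ n * norm x))"
      using exp_converges[of K] by (intro sums_mult2) (simp add: field_simps)
    have "opexp T t x - (\<Sum>k<n. ?f k) = (\<Sum>k. ?f (k + n))"
      unfolding opexp_def suminf_minus_initial_segment[OF sm] ..
    also have "norm \<dots> \<le> (\<Sum>k. (K ^ k / fact k) * (K ^ n * \<bar>t\<bar> ^ n * norm x))"
      by (rule norm_suminf_le[OF b sums_summable[OF es]])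
    also have "\<dots> = exp K * (K ^ n * \<bar>t\<bar> ^ n * norm x)" by (rule sums_unique[OF es, symmetric])
    finally show ?thesis by (simp add: mult_ac)
  qed
  with that[of "K ^ n * exp K"] K show ?thesis by simp
qed

end

lemma opexp_adjoint:
  assumes T: "linear T" and T': "linear T'" and adj: "\<And>x y. T x \<bullet> y = x \<bullet> T' y"
  shows "opexp T t x \<bullet> y = x \<bullet> opexp T' t y"
proof -
  have "(T ^^ k) x \<bullet> y = x \<bullet> (T' ^^ k) y" for k x y
    by (induction k arbitrary: x y) (auto simp: adj funpow_swap1)
  then have "(\<lambda>k. (t ^ k / fact k) * (x \<bullet> (T' ^^ k) y)) sums (opexp T t x \<bullet> y)"
    using bounded_linear.sums[OF bounded_linear_inner_left opexp_sums[OF T, of t x], of y] by simp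
  moreover have "(\<lambda>k. (t ^ k / fact k) * (x \<bullet> (T' ^^ k) y)) sums (x \<bullet> opexp T' t y)"
    using bounded_linear.sums[OF bounded_linear_inner_right opexp_sums[OF T', of t y], of x] by simp
  ultimately show ?thesis by (rule sums_unique2)
qed

subsection \<open>Orthogonal projections\<close>

definition oproj :: "'a::euclidean_space set \<Rightarrow> 'a \<Rightarrow> 'a" where
  "oproj N x = (THE p. p \<in> N \<and> (\<forall>s\<in>N. (x - p) \<bullet> s = 0))"

lemma oproj_eqI:
  assumes "subspace N" "p \<in> N" "\<And>s. s \<in> N \<Longrightarrow> (x - p) \<bullet> s = 0"
  shows "oproj N x = p"
  unfolding oproj_def
proof (rule the_equality)
  fix p' assume p': "p' \<in> N \<and> (\<forall>s\<in>N. (x - p') \<bullet> s = 0)"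
  have "p - p' \<in> N" using assms p' by (intro subspace_diff) auto
  then have "(x - p') \<bullet> (p - p') - (x - p) \<bullet> (p - p') = 0" using assms p' by simp
  then have "(p - p') \<bullet> (p - p') = 0" by (simp add: inner_diff_left)
  then show "p' = p" by simp
qed (use assms in auto)

lemma
  assumes "subspace N"
  shows oproj_mem: "oproj N x \<in> N" and oproj_orth: "s \<in> N \<Longrightarrow> (x - oproj N x) \<bullet> s = 0"
proof -
  obtain p where "p \<in> N" "\<And>s. s \<in> N \<Longrightarrow> (x - p) \<bullet> s = 0"
    using closed_subspace_projection[OF assms closed_subspace[OF assms]] by blast
  with oproj_eqI[OF assms this]
  show "oproj N x \<in> N" "s \<in> N \<Longrightarrow> (x - oproj N x) \<bullet> s = 0" by auto
qed

lemma oproj_self: "subspace N \<Longrightarrow> x \<in> N \<Longrightarrow> oproj N x = x"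
  by (rule oproj_eqI) auto

lemma linear_oproj:
  assumes N: "subspace N" shows "linear (oproj N)"
proof (rule linearI)
  fix x y c
  show "oproj N (x + y) = oproj N x + oproj N y"
  proof (rule oproj_eqI[OF N])
    show "(x + y - (oproj N x + oproj N y)) \<bullet> s = 0" if "s \<in> N" for s
      using oproj_orth[OF N that, of x] oproj_orth[OF N that, of y] by (simp add: inner_diff_left inner_add_left)
  qed (intro subspace_add N oproj_mem)
  show "oproj N (c *\<^sub>R x) = c *\<^sub>R oproj N x"
  proof (rule oproj_eqI[OF N])
    show "(c *\<^sub>R x - c *\<^sub>R oproj N x) \<bullet> s = 0" if "s \<in> N" for s
      using oproj_orth[OF N that, of x] by (simp add: inner_diff_left)
  qed (intro subspace_scale N oproj_mem)
qed

subsection \<open>Short-time decay of a dissipative linear semigroup\<close>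

text \<open>Stated for an abstract pair so that it serves both C and its transpose, for which only
  the sign of \<open>A\<close> changes.\<close>

locale dissipative_operator =
  fixes S A :: "'a::euclidean_space \<Rightarrow> 'a"
  assumes S: "linear S" and S_sym: "S x \<bullet> y = x \<bullet> S y" and S_psd: "0 \<le> x \<bullet> S x"
    and A: "linear A" and A_skew: "A x \<bullet> y = - (x \<bullet> A y)"
begin

definition gen :: "'a \<Rightarrow> 'a" where "gen x = - (S x + A x)"

definition evol :: "real \<Rightarrow> 'a \<Rightarrow> 'a" where "evol = opexp gen"

definition q :: "'a \<Rightarrow> real" where "q x = x \<bullet> S x"

lemma linear_gen: "linear gen"
  using S A unfolding gen_def by (intro linear_compose_neg linear_compose_add)

lemma linear_evol: "linear (evol t)"
  unfolding evol_def by (rule linear_opexp[OF linear_gen])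

lemma evol_0: "evol 0 x = x"
  unfolding evol_def by (rule opexp_0[OF linear_gen])

lemma evol_has_vector_derivative: "((\<lambda>t. evol t x) has_vector_derivative gen (evol t x)) (at t)"
  unfolding evol_def by (rule opexp_has_vector_derivative[OF linear_gen])

lemma continuous_on_evol: "continuous_on U (\<lambda>t. evol t x)"
  by (rule continuous_on_subset[OF continuous_on_vector_derivative[of UNIV]])
     (auto intro: has_vector_derivative_at_within[OF evol_has_vector_derivative])

lemma continuous_on_S: "continuous_on U f \<Longrightarrow> continuous_on U (\<lambda>x. S (f x))"
  by (rule bounded_linear.continuous_on) (use S in \<open>simp_all add: linear_conv_bounded_linear\<close>)

lemma continuous_on_q: "continuous_on U f \<Longrightarrow> continuous_on U (\<lambda>x. q (f x))"
  unfolding q_def by (intro continuous_intros continuous_on_S)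

lemma inner_gen: "x \<bullet> gen x = - q x"
  using A_skew[of x x] by (simp add: gen_def q_def inner_diff_right inner_commute)

text \<open>A nonnegative form that vanishes at x is minimal there, but a step along -S x would
  lower it to first order unless S x = 0.\<close>

lemma q_eq_0: assumes "q x = 0" shows "S x = 0"
proof (rule ccontr)
  assume "S x \<noteq> 0"
  define a where "a = S x \<bullet> S x"
  define k where "k = S x \<bullet> S (S x)"
  \<comment> \<open>This step size keeps \<open>e * k\<close> at most \<open>a\<close>, hence below
    the first-order gain \<open>2 * a\<close>; the summand 1 covers \<open>k = 0\<close>.\<close>
  define e where "e = a / (k + 1)"
  have a: "a > 0" using \<open>S x \<noteq> 0\<close> by (simp add: a_def)
  have k: "k \<ge> 0" unfolding k_def by (rule S_psd)
  have "0 \<le> (x - e *\<^sub>R S x) \<bullet> S (x - e *\<^sub>R S x)" by (rule S_psd)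
  also have "\<dots> = q x - 2 * e * a + e\<^sup>2 * k"
    using S_sym[of x "S x"]
    by (simp add: linear_diff[OF S] linear_cmul[OF S] inner_diff_left inner_diff_right a_def k_def q_def
        power2_eq_square inner_commute algebra_simps)
  finally have "0 \<le> e * (e * k - 2 * a)" using assms by (simp add: power2_eq_square algebra_simps)
  moreover have "e > 0" using a k by (simp add: e_def)
  ultimately have "2 * a \<le> e * k" by (simp add: zero_le_mult_iff)
  moreover have "e * k \<le> a" using a k by (simp add: e_def field_simps)
  ultimately show False using a by linarith
qed

lemma q_add: "q (x + y) = q x + 2 * (x \<bullet> S y) + q y"
  using S_sym[of x y] by (simp add: q_def linear_add[OF S] inner_add_left inner_add_right inner_commute)

lemma q_add_kernel: "S u = 0 \<Longrightarrow> q (u + v) = q v"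
  using S_sym[of u v] unfolding q_add by (simp add: q_def)

lemma q_scale: "q (c *\<^sub>R x) = c\<^sup>2 * q x"
  by (simp add: q_def linear_cmul[OF S] power2_eq_square)

text \<open>The mean dissipation over [0, t], with time rescaled to the unit interval. The squared
  norm drops by 2 t J, so a decay of order t^(2m+1) corresponds to J of order t^(2m).\<close>

definition J :: "real \<Rightarrow> 'a \<Rightarrow> real" where
  "J t x = integral {0..1} (\<lambda>\<sigma>. q (evol (t * \<sigma>) x))"

lemma continuous_on_q_evol: "continuous_on {0..1} (\<lambda>\<sigma>. q (evol (t * \<sigma>) x))"
  by (intro continuous_on_q continuous_on_compose2[OF continuous_on_evol] continuous_intros) auto

lemma norm_evol_eq: "(norm (evol t x))\<^sup>2 = (norm x)\<^sup>2 - 2 * t * J t x"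
proof -
  have v: "((\<lambda>\<sigma>. evol (t * \<sigma>) x) has_vector_derivative t *\<^sub>R gen (evol (t * \<sigma>) x)) (at \<sigma>)" for \<sigma>
    using vector_diff_chain_at[of "\<lambda>\<sigma>. t * \<sigma>" t \<sigma> "\<lambda>t. evol t x", OF _ evol_has_vector_derivative]
    by (auto simp: comp_def intro!: derivative_eq_intros simp flip: has_real_derivative_iff_has_vector_derivative)
  have "((\<lambda>\<sigma>. evol (t * \<sigma>) x \<bullet> evol (t * \<sigma>) x) has_vector_derivative - 2 * t * q (evol (t * \<sigma>) x)) (at \<sigma>)" for \<sigma>
  proof -
    have "((\<lambda>\<sigma>. evol (t * \<sigma>) x \<bullet> evol (t * \<sigma>) x) has_derivative
       (\<lambda>h. evol (t * \<sigma>) x \<bullet> (h *\<^sub>R t *\<^sub>R gen (evol (t * \<sigma>) x)) + (h *\<^sub>R t *\<^sub>R gen (evol (t * \<sigma>) x)) \<bullet> evol (t * \<sigma>) x)) (at \<sigma>)"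
      using v[of \<sigma>] unfolding has_vector_derivative_def by (intro has_derivative_inner)
    then show ?thesis unfolding has_vector_derivative_def
      by (rule has_derivative_eq_rhs) (auto simp: inner_gen inner_commute)
  qed
  then have "((\<lambda>\<sigma>. - 2 * t * q (evol (t * \<sigma>) x)) has_integral
      (evol (t * 1) x \<bullet> evol (t * 1) x) - (evol (t * 0) x \<bullet> evol (t * 0) x)) {0..1}"
    by (rule fundamental_theorem_of_calculus[OF zero_le_one has_vector_derivative_at_within])
  from integral_unique[OF this]
  have "integral {0..1} (\<lambda>\<sigma>. - 2 * t * q (evol (t * \<sigma>) x)) = (norm (evol t x))\<^sup>2 - (norm x)\<^sup>2"
    unfolding power2_norm_eq_inner by (simp only: mult_zero_right mult_1_right evol_0)
  then show ?thesis by (simp add: J_def)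
qed

lemma J_nonneg: "0 \<le> J t x"
  unfolding J_def by (intro integral_nonneg integrable_continuous_real continuous_on_q_evol) (simp add: q_def S_psd)

lemma J_scale: "J t (c *\<^sub>R x) = c\<^sup>2 * J t x"
  by (simp add: J_def linear_cmul[OF linear_evol] q_scale)

lemma norm_evol_le: "0 \<le> t \<Longrightarrow> norm (evol t x) \<le> norm x"
  using J_nonneg[of t x] by (intro power2_le_imp_le[of "norm (evol t x)" "norm x"]) (simp_all add: norm_evol_eq)

text \<open>The common kernel of the first j observability blocks S A^i. The strict bound on i makes
  \<open>N 0\<close> the whole space.\<close>

definition N :: "nat \<Rightarrow> 'a set" where "N j = {x. \<forall>i<j. S ((A ^^ i) x) = 0}"

lemma subspace_N: "subspace (N j)"
  unfolding N_def
  by (rule subspaceI) (simp_all add: linear_0 linear_add linear_cmul linear_funpow S A)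

lemma N_0: "N 0 = UNIV" by (simp add: N_def)

lemma N_mono: "i \<le> j \<Longrightarrow> N j \<subseteq> N i" by (auto simp: N_def)

text \<open>On \<open>N j\<close> the operator S annihilates all A-iterates of order below j, so up
  to the power j the generator acts as -A.\<close>

lemma gen_power_N: "x \<in> N j \<Longrightarrow> i \<le> j \<Longrightarrow> (gen ^^ i) x = (-1) ^ i *\<^sub>R (A ^^ i) x"
proof (induction i)
  case (Suc i)
  then have "S ((A ^^ i) x) = 0" by (simp add: N_def)
  then show ?case using Suc by (simp add: gen_def linear_cmul S A)
qed simp

text \<open>The first j Taylor coefficients of the orbit of x are thus invisible to S, and S applied
  to the orbit is of order t^j. This is the source of the powers of t in the expansion.\<close>

lemma S_gen_power_N: "x \<in> N j \<Longrightarrow> i < j \<Longrightarrow> S ((gen ^^ i) x) = 0"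
  by (simp add: gen_power_N linear_cmul S) (simp add: N_def)

end

section \<open>Rescaling along the filtration \<open>N\<close> and the leading constant\<close>

locale dissipative_index = dissipative_operator +
  fixes m :: nat
  assumes N_Suc_m: "N (Suc m) = {0}" and N_m: "N m \<noteq> {0}"
begin

text \<open>Since the spaces decrease, this is the orthogonal projection onto the part of
  \<open>N j\<close> that is orthogonal to \<open>N (Suc j)\<close>.\<close>

definition D :: "nat \<Rightarrow> 'a \<Rightarrow> 'a" where "D j x = oproj (N j) x - oproj (N (Suc j)) x"

lemma linear_D: "linear (D j)"
  unfolding D_def by (intro linear_compose_sub linear_oproj subspace_N)

lemma D_mem: "D j x \<in> N j"
  unfolding D_def using N_mono[of j "Suc j"] oproj_mem[OF subspace_N]
  by (intro subspace_diff subspace_N) auto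

lemma D_orth: assumes "s \<in> N (Suc j)" shows "D j x \<bullet> s = 0"
proof -
  have "s \<in> N j" using assms N_mono[of j "Suc j"] by auto
  then show ?thesis
    using oproj_orth[OF subspace_N assms, of x] oproj_orth[OF subspace_N, of s j x]
    by (simp add: D_def inner_diff_left)
qed

lemma oproj_D: "oproj (N i) (D k x) = (if i \<le> k then D k x else 0)"
proof (cases "i \<le> k")
  case True
  then have "D k x \<in> N i" using D_mem N_mono by blast
  then show ?thesis using oproj_self[OF subspace_N] True by simp
next
  case False
  then have "N i \<subseteq> N (Suc k)" by (intro N_mono) simp
  then show ?thesis using False
    by (auto intro!: oproj_eqI[OF subspace_N] subspace_0[OF subspace_N] D_orth)
qed

lemma D_D: "D j (D k x) = (if j = k then D k x else 0)"
  unfolding D_def[of j] by (auto simp: oproj_D)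

lemma D_inner: assumes "i \<noteq> j" shows "D i x \<bullet> D j y = 0"
proof -
  have "D i x \<bullet> D j y = 0" if "i < j" for i j x y
    using D_orth[of "D j y" i x] D_mem[of j y] N_mono[of "Suc i" j] that by auto
  from this[of i j x y] this[of j i y x] assms show ?thesis by (metis inner_commute linorder_neqE_nat)
qed

lemma sum_D: "(\<Sum>j\<le>m. D j x) = x"
proof -
  have "(\<Sum>j<Suc m. oproj (N (Suc j)) x - oproj (N j) x) = oproj (N (Suc m)) x - oproj (N 0) x"
    by (rule sum_lessThan_telescope)
  also have "oproj (N (Suc m)) x = 0" using oproj_mem[OF subspace_N, of "Suc m" x] by (simp add: N_Suc_m)
  also have "oproj (N 0) x = x" by (rule oproj_self[OF subspace_N]) (simp add: N_0)
  finally have "(\<Sum>j<Suc m. - D j x) = - x" by (simp add: D_def)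
  then show ?thesis by (simp add: sum_negf lessThan_Suc_atMost)
qed

lemma norm_sum_D: "(norm (\<Sum>j\<le>m. a j *\<^sub>R D j x))\<^sup>2 = (\<Sum>j\<le>m. (a j)\<^sup>2 * (norm (D j x))\<^sup>2)"
proof -
  have "(norm (\<Sum>j\<le>m. a j *\<^sub>R D j x))\<^sup>2 = (\<Sum>i\<le>m. \<Sum>j\<le>m. a i * a j * (D i x \<bullet> D j x))"
    by (rule power2_norm_sum)
  also have "\<dots> = (\<Sum>i\<le>m. \<Sum>j\<le>m. if j = i then (a i)\<^sup>2 * (norm (D i x))\<^sup>2 else 0)"
    by (intro sum.cong refl) (simp add: D_inner dot_square_norm power2_eq_square)
  finally show ?thesis by simp
qed

lemma norm_D_le: "i \<le> m \<Longrightarrow> norm (D i x) \<le> norm x"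
proof -
  assume i: "i \<le> m"
  have "(norm (D i x))\<^sup>2 \<le> (\<Sum>j\<le>m. (1::real)\<^sup>2 * (norm (D j x))\<^sup>2)"
    using i member_le_sum[of i "{..m}" "\<lambda>j. (norm (D j x))\<^sup>2"] by simp
  also have "\<dots> = (norm x)\<^sup>2" using norm_sum_D[of "\<lambda>_. 1" x] sum_D[of x] by simp
  finally show ?thesis by (rule power2_le_imp_le) simp
qed

text \<open>A vector \<open>x\<close> is rescaled as \<open>x = Y t z\<close>: the component in
  \<open>N j\<close> orthogonal to \<open>N (j + 1)\<close> is weighted by \<open>t ^ (m - j)\<close>, which makes all components
  contribute to the dissipation at the same order in \<open>t\<close>.\<close>
definition Y :: "real \<Rightarrow> 'a \<Rightarrow> 'a" where "Y t z = (\<Sum>j\<le>m. t ^ (m - j) *\<^sub>R D j z)"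

definition E :: "nat \<Rightarrow> 'a \<Rightarrow> 'a" where "E k x = (1 / fact k) *\<^sub>R (gen ^^ k) x"

text \<open>The leading profile of the rescaled orbit: at time t \<sigma> the vector
  \<open>Y t z\<close> has moved to t^m \<open>w \<sigma> z\<close>, up to higher order and up to
  vectors killed by S.\<close>

definition w :: "real \<Rightarrow> 'a \<Rightarrow> 'a" where "w \<sigma> z = (\<Sum>j\<le>m. \<sigma> ^ j *\<^sub>R E j (D j z))"

text \<open>The limit of J t (Y t z) / t^(2m), that is, the integral over [0, 1] of
  \<open>q (w \<sigma> z)\<close>; the denominators come from integrating \<sigma>^(i+j).\<close>

definition Q :: "'a \<Rightarrow> real" where
  "Q z = (\<Sum>i\<le>m. \<Sum>j\<le>m. (E i (D i z) \<bullet> S (E j (D j z))) / real (Suc (i + j)))"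

lemma linear_E: "linear (E k)"
  unfolding E_def by (intro linear_compose_scale_right linear_funpow linear_gen)

lemma continuous_on_w: "continuous_on U (\<lambda>\<sigma>. w \<sigma> z)"
  unfolding w_def by (intro continuous_intros)

text \<open>In the Taylor series of component j, the orders below j are killed by S and go into
  \<open>u\<close>; order j meets the weight t^(m-j) and always yields t^m; the higher orders are
  O(t^(m+1)).\<close>

lemma evol_Y_expansion:
  obtains K where "0 \<le> K"
    "\<And>t \<sigma> z. 0 \<le> t \<Longrightarrow> t \<le> 1 \<Longrightarrow> 0 \<le> \<sigma> \<Longrightarrow> \<sigma> \<le> 1 \<Longrightarrow>
      \<exists>u r. evol (t * \<sigma>) (Y t z) = u + (t ^ m *\<^sub>R w \<sigma> z + r) \<and> S u = 0 \<and> norm r \<le> K * t ^ Suc m * norm z"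
proof -
  have "\<exists>M\<ge>0. \<forall>t x. \<bar>t\<bar> \<le> 1 \<longrightarrow> norm (evol t x - (\<Sum>k<Suc j. t ^ k *\<^sub>R E k x)) \<le> M * \<bar>t\<bar> ^ Suc j * norm x" for j
  proof -
    obtain M where "0 \<le> M" "\<And>t x. \<bar>t\<bar> \<le> 1 \<Longrightarrow>
        norm (opexp gen t x - (\<Sum>k<Suc j. (t ^ k / fact k) *\<^sub>R (gen ^^ k) x)) \<le> M * \<bar>t\<bar> ^ Suc j * norm x"
      using opexp_remainder[OF linear_gen, of "Suc j"] by blast
    then show ?thesis by (intro exI[of _ M]) (simp add: evol_def E_def del: sum.lessThan_Suc)
  qed
  then obtain M where M: "\<And>j. 0 \<le> M j"
    "\<And>j t x. \<bar>t\<bar> \<le> 1 \<Longrightarrow> norm (evol t x - (\<Sum>k<Suc j. t ^ k *\<^sub>R E k x)) \<le> M j * \<bar>t\<bar> ^ Suc j * norm x" by metis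
  show ?thesis
  proof (rule that[of "\<Sum>j\<le>m. M j"])
    show "0 \<le> (\<Sum>j\<le>m. M j)" by (intro sum_nonneg M)
    fix t \<sigma> z assume t: "0 \<le> t" "t \<le> (1::real)" and \<sigma>: "0 \<le> \<sigma>" "\<sigma> \<le> (1::real)"
    have s: "\<bar>t * \<sigma>\<bar> \<le> 1" using t \<sigma> by (simp add: mult_le_one)
    define u where "u = (\<Sum>j\<le>m. t ^ (m - j) *\<^sub>R (\<Sum>k<j. (t * \<sigma>) ^ k *\<^sub>R E k (D j z)))"
    define R where "R j = evol (t * \<sigma>) (D j z) - (\<Sum>k<Suc j. (t * \<sigma>) ^ k *\<^sub>R E k (D j z))" for j
    define r where "r = (\<Sum>j\<le>m. t ^ (m - j) *\<^sub>R R j)"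
    have "evol (t * \<sigma>) (Y t z) = (\<Sum>j\<le>m. t ^ (m - j) *\<^sub>R evol (t * \<sigma>) (D j z))"
      unfolding Y_def by (simp add: linear_sum[OF linear_evol] linear_cmul[OF linear_evol])
    also have "\<dots> = (\<Sum>j\<le>m. t ^ (m - j) *\<^sub>R (\<Sum>k<j. (t * \<sigma>) ^ k *\<^sub>R E k (D j z))
        + (t ^ m *\<^sub>R (\<sigma> ^ j *\<^sub>R E j (D j z)) + t ^ (m - j) *\<^sub>R R j))"
    proof (rule sum.cong[OF refl])
      fix j assume "j \<in> {..m}"
      then have "t ^ m = t ^ (m - j) * t ^ j" by (simp flip: power_add)
      then show "t ^ (m - j) *\<^sub>R evol (t * \<sigma>) (D j z) = t ^ (m - j) *\<^sub>R (\<Sum>k<j. (t * \<sigma>) ^ k *\<^sub>R E k (D j z))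
        + (t ^ m *\<^sub>R (\<sigma> ^ j *\<^sub>R E j (D j z)) + t ^ (m - j) *\<^sub>R R j)"
        unfolding R_def by (simp add: power_mult_distrib scaleR_add_right scaleR_diff_right)
    qed
    also have "\<dots> = u + (t ^ m *\<^sub>R w \<sigma> z + r)"
      by (simp add: u_def w_def r_def sum.distrib scaleR_sum_right)
    finally have 1: "evol (t * \<sigma>) (Y t z) = u + (t ^ m *\<^sub>R w \<sigma> z + r)" .
    have 2: "S u = 0"
      unfolding u_def E_def linear_sum[OF S] linear_cmul[OF S] using S_gen_power_N[OF D_mem] by simp
    have "norm (t ^ (m - j) *\<^sub>R R j) \<le> M j * (t ^ Suc m * norm z)" if j: "j \<le> m" for j
    proof -
      have "norm (R j) \<le> M j * \<bar>t * \<sigma>\<bar> ^ Suc j * norm (D j z)" unfolding R_def by (rule M(2)[OF s])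
      also have "\<dots> \<le> M j * t ^ Suc j * norm z"
        using t \<sigma> M(1)[of j] by (intro mult_mono norm_D_le j mult_left_mono power_mono) (auto intro: mult_left_le)
      finally have "t ^ (m - j) * norm (R j) \<le> t ^ (m - j) * (M j * t ^ Suc j * norm z)"
        using t by (intro mult_left_mono) auto
      also have "\<dots> = M j * ((t ^ (m - j) * t ^ Suc j) * norm z)" by (simp only: mult_ac)
      also have "t ^ (m - j) * t ^ Suc j = t ^ Suc m" using j by (simp del: power_Suc flip: power_add)
      finally show ?thesis using t by simp
    qed
    then have "norm r \<le> (\<Sum>j\<le>m. M j * (t ^ Suc m * norm z))"
      unfolding r_def by (intro sum_norm_le) auto
    then have 3: "norm r \<le> (\<Sum>j\<le>m. M j) * t ^ Suc m * norm z" by (simp add: sum_distrib_right mult.assoc)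
    from 1 2 3 show "\<exists>u r. evol (t * \<sigma>) (Y t z) = u + (t ^ m *\<^sub>R w \<sigma> z + r) \<and> S u = 0 \<and> norm r \<le> (\<Sum>j\<le>m. M j) * t ^ Suc m * norm z"
      by blast
  qed
qed

lemma w_bound: obtains W where "0 \<le> W" "\<And>\<sigma> z. 0 \<le> \<sigma> \<Longrightarrow> \<sigma> \<le> 1 \<Longrightarrow> norm (w \<sigma> z) \<le> W * norm z"
proof -
  have "\<exists>B>0. \<forall>x. norm (E j x) \<le> B * norm x" for j
    using linear_bounded_pos[OF linear_E, of j] by metis
  then obtain B where B: "\<And>j. B j > 0" "\<And>j x. norm (E j x) \<le> B j * norm x" by metis
  show ?thesis
  proof (rule that[of "\<Sum>j\<le>m. B j"])
    show "0 \<le> (\<Sum>j\<le>m. B j)" by (intro sum_nonneg less_imp_le B)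
    fix \<sigma> :: real and z assume \<sigma>: "0 \<le> \<sigma>" "\<sigma> \<le> 1"
    have "norm (\<sigma> ^ j *\<^sub>R E j (D j z)) \<le> B j * norm z" if "j \<le> m" for j
    proof -
      have "norm (E j (D j z)) \<le> B j * norm z"
        using B(2)[of j "D j z"] mult_left_mono[OF norm_D_le[OF that, of z], of "B j"] B(1)[of j] by linarith
      moreover have "\<sigma> ^ j * norm (E j (D j z)) \<le> 1 * norm (E j (D j z))"
        using \<sigma> by (intro mult_right_mono power_le_one) auto
      ultimately show ?thesis using \<sigma> by simp
    qed
    then show "norm (w \<sigma> z) \<le> (\<Sum>j\<le>m. B j) * norm z"
      unfolding w_def sum_distrib_right by (intro sum_norm_le) auto
  qed
qed

lemma q_w_has_integral: "((\<lambda>\<sigma>. q (w \<sigma> z)) has_integral Q z) {0..1}"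
proof -
  have p: "((\<lambda>\<sigma>::real. \<sigma> ^ k * c) has_integral c / real (Suc k)) {0..1}" for k c
  proof -
    have "((\<lambda>\<sigma>::real. \<sigma> ^ k * c) has_integral c * 1 ^ Suc k / real (Suc k) - c * 0 ^ Suc k / real (Suc k)) {0..1}"
      by (rule fundamental_theorem_of_calculus)
         (auto intro!: derivative_eq_intros simp: has_real_derivative_iff_has_vector_derivative[symmetric]
           simp del: of_nat_Suc power_Suc)
    then show ?thesis by simp
  qed
  have "q (w \<sigma> z) = (\<Sum>i\<le>m. \<Sum>j\<le>m. \<sigma> ^ (i + j) * (E i (D i z) \<bullet> S (E j (D j z))))" for \<sigma>
    unfolding q_def w_def linear_sum[OF S] linear_cmul[OF S] inner_sum_left
    unfolding inner_sum_right by (simp add: power_add mult_ac)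
  then show ?thesis unfolding Q_def by (simp only:) (intro has_integral_sum p; simp)
qed

lemma Q_nonneg: "0 \<le> Q z"
  using has_integral_nonneg[OF q_w_has_integral] by (simp add: q_def S_psd)

lemma Q_scale: "Q (c *\<^sub>R z) = c\<^sup>2 * Q z"
  unfolding Q_def linear_cmul[OF linear_D] linear_cmul[OF linear_E] linear_cmul[OF S]
  by (simp add: sum_distrib_left power2_eq_square mult_ac)

lemma continuous_on_Q: "continuous_on U Q"
proof -
  have "linear (\<lambda>z. E i (D i z))" "linear (\<lambda>z. S (E i (D i z)))" for i
    using linear_compose[OF linear_D linear_E] linear_compose[OF linear_compose[OF linear_D linear_E] S]
    by (simp_all add: comp_def)
  then show ?thesis unfolding Q_def by (intro continuous_intros linear_continuous_on) (auto simp: linear_conv_bounded_linear)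
qed

text \<open>A continuous nonnegative integrand with integral zero vanishes, so S
  \<open>w \<sigma> z\<close> is a polynomial in \<sigma> that is zero on [0, 1] and all its
  coefficients vanish. This puts \<open>D j z\<close> into \<open>N (Suc j)\<close>, to which it is
  orthogonal.\<close>

lemma Q_eq_0: assumes "Q z = 0" shows "z = 0"
proof -
  have c: "continuous_on {0..1} (\<lambda>\<sigma>. q (w \<sigma> z))" by (intro continuous_on_q continuous_on_w)
  have "q (w \<sigma> z) = 0" if "\<sigma> \<in> {0..1}" for \<sigma>
  proof -
    have "integral {0..1} (\<lambda>\<sigma>. q (w \<sigma> z)) = 0" using q_w_has_integral[of z] assms by (simp add: integral_unique)
    then show ?thesis using integral_eq_0_iff[OF c] that by (simp add: q_def S_psd)
  qed
  then have Sw: "S (w \<sigma> z) = 0" if "\<sigma> \<in> {0..1}" for \<sigma> using that q_eq_0 by blast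
  have SE: "S (E j (D j z)) = 0" if j: "j \<le> m" for j
  proof (rule euclidean_eqI)
    fix b :: 'a assume "b \<in> Basis"
    have z: "(\<Sum>i\<le>m. (S (E i (D i z)) \<bullet> b) * \<sigma> ^ i) = 0" if "\<sigma> \<in> {0..1}" for \<sigma>
    proof -
      have "S (w \<sigma> z) \<bullet> b = (\<Sum>i\<le>m. (S (E i (D i z)) \<bullet> b) * \<sigma> ^ i)"
        unfolding w_def linear_sum[OF S] linear_cmul[OF S] inner_sum_left by (simp add: mult.commute)
      then show ?thesis using Sw[OF that] by simp
    qed
    have inf: "infinite {\<sigma>::real. (\<Sum>i\<le>m. (S (E i (D i z)) \<bullet> b) * \<sigma> ^ i) = 0}"
    proof
      assume "finite {\<sigma>::real. (\<Sum>i\<le>m. (S (E i (D i z)) \<bullet> b) * \<sigma> ^ i) = 0}"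
      then have "finite {0..1::real}" by (rule finite_subset[rotated]) (use z in auto)
      then show False using infinite_Icc[of 0 "1::real"] by simp
    qed
    then have "S (E j (D j z)) \<bullet> b = 0"
      using polyfun_finite_roots[of "\<lambda>i. S (E i (D i z)) \<bullet> b" m] j by blast
    then show "S (E j (D j z)) \<bullet> b = 0 \<bullet> b" by simp
  qed
  have "D j z = 0" if j: "j \<le> m" for j
  proof -
    have "S ((A ^^ j) (D j z)) = 0"
      using SE[OF j] unfolding E_def gen_power_N[OF D_mem order_refl] linear_cmul[OF S] by simp
    then have "D j z \<in> N (Suc j)" using D_mem[of j z] by (auto simp: N_def less_Suc_eq)
    from D_orth[OF this, of z] show ?thesis by simp
  qed
  then show ?thesis using sum_D[of z] by simp
qed

text \<open>The kernel part \<open>u\<close> drops out of \<open>q\<close> by symmetry of S; what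
  remains is the form of t^m w perturbed by a vector of order t^(m+1), uniformly on the time
  interval.\<close>

lemma J_Y_expansion:
  obtains K where "0 \<le> K"
    "\<And>t z. 0 \<le> t \<Longrightarrow> t \<le> 1 \<Longrightarrow> \<bar>J t (Y t z) - t ^ (2 * m) * Q z\<bar> \<le> K * t ^ (2 * m + 1) * (norm z)\<^sup>2"
proof -
  obtain K where K: "0 \<le> K"
    "\<And>t \<sigma> z. 0 \<le> t \<Longrightarrow> t \<le> 1 \<Longrightarrow> 0 \<le> \<sigma> \<Longrightarrow> \<sigma> \<le> 1 \<Longrightarrow>
      \<exists>u r. evol (t * \<sigma>) (Y t z) = u + (t ^ m *\<^sub>R w \<sigma> z + r) \<and> S u = 0 \<and> norm r \<le> K * t ^ Suc m * norm z"
    using evol_Y_expansion by blast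
  obtain W where W: "0 \<le> W" "\<And>\<sigma> z. 0 \<le> \<sigma> \<Longrightarrow> \<sigma> \<le> 1 \<Longrightarrow> norm (w \<sigma> z) \<le> W * norm z"
    using w_bound by blast
  obtain k where k: "0 \<le> k" "\<And>x. norm (S x) \<le> k * norm x" using operator_bound[OF S] by blast
  \<comment> \<open>Collects the cross term 2 t^m (w . S r) and the square r . S r, whose power
    t^(2m+2) is weakened to t^(2m+1) using t \<le> 1.\<close>
  define L where "L = 2 * W * k * K + k * K\<^sup>2"
  have main: "\<bar>q (evol (t * \<sigma>) (Y t z)) - t ^ (2 * m) * q (w \<sigma> z)\<bar> \<le> L * t ^ (2 * m + 1) * (norm z)\<^sup>2"
    if t: "0 \<le> t" "t \<le> 1" and \<sigma>: "0 \<le> \<sigma>" "\<sigma> \<le> 1" for t \<sigma> z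
  proof -
    obtain u r where ur: "evol (t * \<sigma>) (Y t z) = u + (t ^ m *\<^sub>R w \<sigma> z + r)" "S u = 0" "norm r \<le> K * t ^ Suc m * norm z"
      using K(2)[OF t \<sigma>] by blast
    have "q (evol (t * \<sigma>) (Y t z)) = q (t ^ m *\<^sub>R w \<sigma> z + r)"
      by (simp only: ur(1) q_add_kernel[OF ur(2)])
    then have "q (evol (t * \<sigma>) (Y t z)) - t ^ (2 * m) * q (w \<sigma> z) = 2 * t ^ m * (w \<sigma> z \<bullet> S r) + r \<bullet> S r"
      by (simp add: q_add q_scale power_even_eq) (simp add: q_def)
    moreover have "\<bar>w \<sigma> z \<bullet> S r\<bar> \<le> (W * norm z) * (k * (K * t ^ Suc m * norm z))"
    proof -
      have "\<bar>w \<sigma> z \<bullet> S r\<bar> \<le> norm (w \<sigma> z) * norm (S r)" by (rule Cauchy_Schwarz_ineq2)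
      also have "\<dots> \<le> (W * norm z) * (k * (K * t ^ Suc m * norm z))"
        using W(2)[OF \<sigma>, of z] k(2)[of r] mult_left_mono[OF ur(3) k(1)] W(1) by (intro mult_mono) auto
      finally show ?thesis .
    qed
    from mult_left_mono[OF this, of "2 * t ^ m"]
    have "\<bar>2 * t ^ m * (w \<sigma> z \<bullet> S r)\<bar> \<le> 2 * t ^ m * ((W * norm z) * (k * (K * t ^ Suc m * norm z)))"
      using t by (simp add: abs_mult)
    moreover have "\<bar>r \<bullet> S r\<bar> \<le> (k * K\<^sup>2 * t ^ (2 * m + 1) * (norm z)\<^sup>2)"
    proof -
      have "\<bar>r \<bullet> S r\<bar> \<le> norm r * norm (S r)" by (rule Cauchy_Schwarz_ineq2)
      also have "\<dots> \<le> (K * t ^ Suc m * norm z) * (k * (K * t ^ Suc m * norm z))"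
        using ur(3) k(2)[of r] mult_left_mono[OF ur(3) k(1)] K(1) t by (intro mult_mono) auto
      also have "\<dots> = k * K\<^sup>2 * (norm z)\<^sup>2 * (t ^ (2 * m + 1) * t)"
      proof -
        have "t ^ (2 * m + 1) = t ^ m * t ^ m * t" by (simp add: mult_2 power_add)
        then show ?thesis by (simp only: power2_eq_square power_Suc mult_ac)
      qed
      also have "\<dots> \<le> k * K\<^sup>2 * (norm z)\<^sup>2 * (t ^ (2 * m + 1) * 1)"
        using t k(1) by (intro mult_left_mono) auto
      finally show ?thesis by (simp add: mult_ac)
    qed
    moreover have "2 * t ^ m * ((W * norm z) * (k * (K * t ^ Suc m * norm z))) + k * K\<^sup>2 * t ^ (2 * m + 1) * (norm z)\<^sup>2
        = L * t ^ (2 * m + 1) * (norm z)\<^sup>2"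
    proof -
      have e: "t ^ (2 * m + 1) = t ^ m * t ^ m * t" by (simp add: mult_2 power_add)
      have "2 * a * ((W * n) * (k * (K * (t * a) * n))) + k * K\<^sup>2 * (a * a * t) * n\<^sup>2
          = (2 * W * k * K + k * K\<^sup>2) * (a * a * t) * n\<^sup>2" for a n :: real
        by (simp add: algebra_simps power2_eq_square)
      then show ?thesis by (simp only: L_def e power_Suc)
    qed
    ultimately show ?thesis by linarith
  qed
  show ?thesis
  proof (rule that[of L])
    show "0 \<le> L" using W K k by (simp add: L_def)
    fix t :: real and z assume t: "0 \<le> t" "t \<le> 1"
    have i1: "continuous_on {0..1} (\<lambda>\<sigma>. q (evol (t * \<sigma>) (Y t z)))" by (rule continuous_on_q_evol)
    have i2: "continuous_on {0..1} (\<lambda>\<sigma>. t ^ (2 * m) * q (w \<sigma> z))"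
      by (intro continuous_intros continuous_on_q continuous_on_w)
    have "J t (Y t z) - t ^ (2 * m) * Q z = integral {0..1} (\<lambda>\<sigma>. q (evol (t * \<sigma>) (Y t z)) - t ^ (2 * m) * q (w \<sigma> z))"
      using integral_unique[OF q_w_has_integral]
      by (subst integral_diff) (auto intro: integrable_continuous_real i1 i2 simp: J_def)
    moreover have "norm (integral {0..1} (\<lambda>\<sigma>. q (evol (t * \<sigma>) (Y t z)) - t ^ (2 * m) * q (w \<sigma> z)))
        \<le> L * t ^ (2 * m + 1) * (norm z)\<^sup>2 * (1 - 0)"
      by (rule integral_bound) (use main[OF t] in \<open>auto intro: continuous_on_diff i1 i2\<close>)
    ultimately show "\<bar>J t (Y t z) - t ^ (2 * m) * Q z\<bar> \<le> L * t ^ (2 * m + 1) * (norm z)\<^sup>2" by simp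
  qed
qed

lemma Q_coercive: obtains l where "0 < l" "\<And>z. l * (norm z)\<^sup>2 \<le> Q z"
proof -
  obtain z0 where z0: "z0 \<in> sphere 0 1" "\<And>z. z \<in> sphere (0::'a) 1 \<Longrightarrow> Q z0 \<le> Q z"
    using continuous_attains_inf[OF compact_sphere _ continuous_on_Q, of "0::'a" 1] by auto
  have "Q z0 > 0" using Q_nonneg[of z0] Q_eq_0[of z0] z0(1) by fastforce
  moreover have "Q z0 * (norm z)\<^sup>2 \<le> Q z" for z
  proof (cases "z = 0")
    case False
    have "Q z0 \<le> Q ((1 / norm z) *\<^sub>R z)" using False by (intro z0) simp
    then show ?thesis using False by (simp add: Q_scale power_divide field_simps)
  qed (simp add: Q_nonneg)
  ultimately show ?thesis using that by blast
qed

text \<open>A unit vector x = Y t z satisfies 1 = sum of t^(2(m-j)) |D j z|^2, so in the limit only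
  the last component is constrained, while the others are free to lower Q. Hence \<open>c\<close> is
  an infimum over all z with |D m z| = 1.\<close>

lemma J_bounds:
  obtains c K t0 where "0 < c" "0 \<le> K" "0 < t0" "t0 \<le> 1"
    "\<And>t x. 0 < t \<Longrightarrow> t \<le> t0 \<Longrightarrow> norm x = 1 \<Longrightarrow> t ^ (2 * m) * (c - K * t) \<le> J t x"
    "\<And>t. 0 < t \<Longrightarrow> t \<le> t0 \<Longrightarrow> \<exists>x. norm x = 1 \<and> J t x \<le> t ^ (2 * m) * (c + K * t)"
proof -
  obtain K where K: "0 \<le> K"
    "\<And>t z. 0 \<le> t \<Longrightarrow> t \<le> 1 \<Longrightarrow> \<bar>J t (Y t z) - t ^ (2 * m) * Q z\<bar> \<le> K * t ^ (2 * m + 1) * (norm z)\<^sup>2"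
    using J_Y_expansion by blast
  obtain l where l: "0 < l" "\<And>z. l * (norm z)\<^sup>2 \<le> Q z" using Q_coercive by blast
  define Z where "Z = {z. norm (D m z) = 1}"
  define c where "c = (INF z\<in>Z. Q z)"
  have "Z \<noteq> {}"
  proof -
    obtain z where z: "z \<in> N m" "z \<noteq> 0" using N_m subspace_0[OF subspace_N[of m]] by blast
    have "oproj (N (Suc m)) z = 0" using oproj_mem[OF subspace_N, of "Suc m" z] by (simp add: N_Suc_m)
    then have "D m z = z" using oproj_self[OF subspace_N z(1)] by (simp add: D_def)
    then have "(1 / norm z) *\<^sub>R z \<in> Z" using z(2) by (simp add: Z_def linear_cmul[OF linear_D])
    then show ?thesis by blast
  qed
  have bdd: "bdd_below (Q ` Z)" by (rule bdd_belowI2[of _ 0]) (rule Q_nonneg)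
  have "l \<le> Q z" if "z \<in> Z" for z
  proof -
    have "1 \<le> (norm z)\<^sup>2" using norm_D_le[of m z] that power_mono[of 1 "norm z" 2] by (simp add: Z_def)
    then have "l * 1 \<le> l * (norm z)\<^sup>2" using l(1) by (intro mult_left_mono) auto
    then show ?thesis using l(2)[of z] by simp
  qed
  then have "l \<le> c" unfolding c_def by (intro cINF_greatest \<open>Z \<noteq> {}\<close>)
  then have c: "0 < c" using l by linarith
  have cQ: "c * (norm (D m z))\<^sup>2 \<le> Q z" for z
  proof (cases "D m z = 0")
    case False
    then have "(1 / norm (D m z)) *\<^sub>R z \<in> Z" by (simp add: Z_def linear_cmul[OF linear_D])
    from cINF_lower[OF bdd this] have "c \<le> Q z / (norm (D m z))\<^sup>2"
      by (simp add: c_def Q_scale power_divide)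
    then show ?thesis using False by (simp add: field_simps)
  qed (simp add: Q_nonneg)
  \<comment> \<open>The lower bound splits at |z|^2 = B: beyond it, coercivity alone keeps Q z - K t
    |z|^2 above (l/2) B = c; below it, all error terms are uniformly O(t).\<close>
  define B where "B = 2 * c / l"
  define K' where "K' = c * B + K * B + 1 + K * (c + 1) / l"
  have B: "B > 0" using c l by (simp add: B_def)
  have K': "c * B + K * B \<le> K'" "1 + K * (c + 1) / l \<le> K'" "0 \<le> K'"
    using B K(1) c l by (simp_all add: K'_def)
  \<comment> \<open>Small enough for K t \<le> l/2, so that the error consumes at most half of the
    coercivity.\<close>
  define t0 where "t0 = min 1 (l / (2 * (K + 1)))"
  have t0: "0 < t0" "t0 \<le> 1" using l(1) K(1) by (auto simp: t0_def)
  have Kt: "K * t \<le> l / 2" if "t \<le> t0" "0 < t" for t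
  proof -
    have "t \<le> l / (2 * (K + 1))" using that by (simp add: t0_def)
    then have "(K + 1) * t \<le> l / 2" using K(1) by (simp add: field_simps)
    then show ?thesis using that by (simp add: algebra_simps)
  qed
  have low: "t ^ (2 * m) * (c - K' * t) \<le> J t x" if t: "0 < t" "t \<le> t0" and x: "norm x = 1" for t x
  proof -
    have t1: "0 \<le> t" "t \<le> 1" using t t0 by auto
    \<comment> \<open>Inverts the rescaling \<open>Y t\<close>, which is possible since t >
      0.\<close>
    define z where "z = (\<Sum>k\<le>m. (1 / t ^ (m - k)) *\<^sub>R D k x)"
    have Dz: "D j z = (1 / t ^ (m - j)) *\<^sub>R D j x" if "j \<le> m" for j
    proof -
      have "D j z = (\<Sum>k\<le>m. if k = j then (1 / t ^ (m - k)) *\<^sub>R D k x else 0)"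
        unfolding z_def linear_sum[OF linear_D] linear_cmul[OF linear_D] by (intro sum.cong refl) (simp add: D_D)
      then show ?thesis using that by simp
    qed
    have Yz: "Y t z = x"
      unfolding Y_def using t(1) sum_D[of x] by (simp add: Dz)
    have "1 = (\<Sum>j\<le>m. (t ^ (m - j))\<^sup>2 * (norm (D j z))\<^sup>2)"
      using norm_sum_D[of "\<lambda>j. t ^ (m - j)" z] Yz x by (simp add: Y_def)
    \<comment> \<open>Every component j < m carries a weight of at most t^2, so |D m z|^2 falls
      short of 1 by at most t^2 |z|^2.\<close>
    also have "\<dots> \<le> (\<Sum>j\<le>m. (if j = m then (norm (D m z))\<^sup>2 else 0) + t\<^sup>2 * (norm (D j z))\<^sup>2)"
    proof (rule sum_mono)
      fix j assume j: "j \<in> {..m}"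
      show "(t ^ (m - j))\<^sup>2 * (norm (D j z))\<^sup>2 \<le> (if j = m then (norm (D m z))\<^sup>2 else 0) + t\<^sup>2 * (norm (D j z))\<^sup>2"
      proof (cases "j = m")
        case False
        have "t ^ (m - j) \<le> t ^ 1" using j False t1 by (intro power_decreasing) auto
        then have "(t ^ (m - j))\<^sup>2 \<le> t\<^sup>2" using t1 by (intro power_mono) auto
        then show ?thesis using False by (simp add: mult_right_mono)
      qed simp
    qed
    also have "\<dots> = (norm (D m z))\<^sup>2 + t\<^sup>2 * (norm z)\<^sup>2"
      using norm_sum_D[of "\<lambda>_. 1" z] sum_D[of z] by (simp add: sum.distrib sum_distrib_left[symmetric])
    finally have one: "1 - t\<^sup>2 * (norm z)\<^sup>2 \<le> (norm (D m z))\<^sup>2" by simp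
    have "c * (1 - t\<^sup>2 * (norm z)\<^sup>2) \<le> c * (norm (D m z))\<^sup>2" using one c by (intro mult_left_mono) auto
    then have Q1: "c - c * t\<^sup>2 * (norm z)\<^sup>2 \<le> Q z" using cQ[of z] by (simp add: algebra_simps)
    have "t ^ (2 * m) * Q z - K * t ^ (2 * m + 1) * (norm z)\<^sup>2 \<le> J t x" using K(2)[OF t1, of z] Yz by simp
    then have J1: "t ^ (2 * m) * (Q z - K * t * (norm z)\<^sup>2) \<le> J t x" by (simp add: algebra_simps)
    have "c - K' * t \<le> Q z - K * t * (norm z)\<^sup>2"
    proof (cases "(norm z)\<^sup>2 \<le> B")
      case True
      have "c * t\<^sup>2 * (norm z)\<^sup>2 \<le> c * t * B"
      proof (rule mult_mono[OF _ True])
        have "t\<^sup>2 \<le> t" using t1 by (simp add: power2_eq_square mult_left_le)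
        then show "c * t\<^sup>2 \<le> c * t" using c by simp
      qed (use c t1 in auto)
      moreover have "K * t * (norm z)\<^sup>2 \<le> K * t * B" using K(1) t1 True by (intro mult_left_mono) auto
      moreover have "(c * B + K * B) * t \<le> K' * t" using K'(1) t1(1) by (rule mult_right_mono)
      ultimately show ?thesis using Q1 by (simp add: algebra_simps)
    next
      case False
      have "c = l / 2 * B" using l(1) by (simp add: B_def)
      also have "\<dots> \<le> l / 2 * (norm z)\<^sup>2" using False l(1) by (intro mult_left_mono) auto
      also have "\<dots> \<le> (l - K * t) * (norm z)\<^sup>2" using Kt[OF t(2,1)] by (intro mult_right_mono) auto
      also have "\<dots> \<le> Q z - K * t * (norm z)\<^sup>2" using l(2)[of z] by (simp add: algebra_simps)
      finally show ?thesis using mult_nonneg_nonneg[OF K'(3) t1(1)] by linarith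
    qed
    then have "t ^ (2 * m) * (c - K' * t) \<le> t ^ (2 * m) * (Q z - K * t * (norm z)\<^sup>2)"
      using t1 by (intro mult_left_mono) auto
    with J1 show ?thesis by linarith
  qed
  have up: "\<exists>x. norm x = 1 \<and> J t x \<le> t ^ (2 * m) * (c + K' * t)" if t: "0 < t" "t \<le> t0" for t
  proof -
    have t1: "0 \<le> t" "t \<le> 1" using t t0 by auto
    have "(INF z\<in>Z. Q z) < c + t" using t by (simp add: c_def)
    then obtain z where z: "z \<in> Z" "Q z < c + t" using \<open>Z \<noteq> {}\<close> bdd by (auto simp: cINF_less_iff)
    have "l * (norm z)\<^sup>2 \<le> c + 1" using l(2)[of z] z(2) t1 by linarith
    then have nz: "(norm z)\<^sup>2 \<le> (c + 1) / l" using l(1) by (simp add: field_simps)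
    have "1 = (norm (D m z))\<^sup>2" using z(1) by (simp add: Z_def)
    also have "\<dots> \<le> (\<Sum>j\<le>m. (t ^ (m - j))\<^sup>2 * (norm (D j z))\<^sup>2)"
      using member_le_sum[of m "{..m}" "\<lambda>j. (t ^ (m - j))\<^sup>2 * (norm (D j z))\<^sup>2"] by simp
    also have "\<dots> = (norm (Y t z))\<^sup>2" by (simp add: norm_sum_D Y_def)
    finally have nY: "1 \<le> (norm (Y t z))\<^sup>2" .
    then have Y0: "Y t z \<noteq> 0" by auto
    \<comment> \<open>Normalising divides J by |Y t z|^2 \<ge> 1, which can only lower it.\<close>
    define x where "x = (1 / norm (Y t z)) *\<^sub>R Y t z"
    have "J t x = J t (Y t z) / (norm (Y t z))\<^sup>2" by (simp add: x_def J_scale power_divide)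
    also have "\<dots> \<le> J t (Y t z)" using nY J_nonneg[of t "Y t z"] Y0 by (simp add: divide_le_eq mult_le_cancel_left1)
    also have "\<dots> \<le> t ^ (2 * m) * Q z + K * t ^ (2 * m + 1) * (norm z)\<^sup>2" using K(2)[OF t1, of z] by simp
    also have "\<dots> = t ^ (2 * m) * (Q z + K * t * (norm z)\<^sup>2)" by (simp add: algebra_simps)
    also have "\<dots> \<le> t ^ (2 * m) * (c + K' * t)"
    proof (rule mult_left_mono)
      have "K * t * (norm z)\<^sup>2 \<le> K * t * ((c + 1) / l)" using nz K(1) t1 by (intro mult_left_mono) auto
      moreover have "(1 + K * (c + 1) / l) * t \<le> K' * t" using K'(2) t1(1) by (rule mult_right_mono)
      ultimately show "Q z + K * t * (norm z)\<^sup>2 \<le> c + K' * t" using z(2) by (simp add: algebra_simps)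
    qed (use t1 in auto)
    finally show ?thesis using Y0 by (intro exI[of _ x]) (simp add: x_def)
  qed
  show ?thesis by (rule that[OF c K'(3) t0 low up])
qed

theorem onorm_evol_asymptotics:
  "\<exists>c>0. (\<lambda>t. onorm (evol t) - (1 - c * t ^ (2 * m + 1))) \<in> O[at_right 0](\<lambda>t. t ^ (2 * m + 2))"
proof -
  obtain c K t0 where cK: "0 < c" "0 \<le> K" "0 < t0" "t0 \<le> 1"
    and low: "\<And>t x. 0 < t \<Longrightarrow> t \<le> t0 \<Longrightarrow> norm x = 1 \<Longrightarrow> t ^ (2 * m) * (c - K * t) \<le> J t x"
    and up: "\<And>t. 0 < t \<Longrightarrow> t \<le> t0 \<Longrightarrow> \<exists>x. norm x = 1 \<and> J t x \<le> t ^ (2 * m) * (c + K * t)"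
    using J_bounds by blast
  \<comment> \<open>Gives c t < 1/2, so that the factor R + (1 - c s) stays above 1/2 when the
    estimate of the squared norm is turned into one of the norm.\<close>
  define t1 where "t1 = min t0 (1 / (2 * c))"
  have bound: "\<bar>onorm (evol t) - (1 - c * t ^ (2 * m + 1))\<bar> \<le> 2 * (2 * K + c\<^sup>2) * t ^ (2 * m + 2)"
    if t: "0 < t" "t < t1" for t
  proof -
    have t': "t \<le> t0" "t \<le> 1" "0 \<le> t" using t cK by (auto simp: t1_def)
    define R where "R = onorm (evol t)"
    define s where "s = t ^ (2 * m + 1)"
    have bl: "bounded_linear (evol t)" using linear_evol by (simp add: linear_conv_bounded_linear)
    have R0: "0 \<le> R" unfolding R_def by (rule onorm_pos_le[OF bl])
    have s: "0 \<le> s" "s \<le> t" using t' power_decreasing[of 1 "2 * m + 1" t] by (auto simp: s_def)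
    have "c * t < 1 / 2" using t cK(1) by (simp add: t1_def field_simps)
    then have cs: "c * s \<le> 1 / 2" using s mult_left_mono[OF s(2), of c] cK by linarith
    have st: "t ^ (2 * m + 2) = s * t" by (simp add: s_def)
    have p: "2 * t * (t ^ (2 * m) * y) = 2 * s * y" for y by (simp add: s_def)
    have upper: "R\<^sup>2 \<le> 1 - 2 * c * s + 2 * K * (s * t)"
    proof -
      let ?U = "1 - 2 * s * (c - K * t)"
      have nx: "norm (evol t x) \<le> sqrt ?U * norm x" for x
      proof (cases "x = 0")
        case False
        define e where "e = (1 / norm x) *\<^sub>R x"
        have e: "norm e = 1" "x = norm x *\<^sub>R e" using False by (simp_all add: e_def)
        have "(norm (evol t e))\<^sup>2 \<le> ?U"
          using mult_left_mono[OF low[OF t(1) t'(1) e(1)], of "2 * t"] t' unfolding norm_evol_eq e(1) p by simp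
        then have "norm (evol t e) \<le> sqrt ?U" by (rule real_le_rsqrt)
        then have "norm x * norm (evol t e) \<le> norm x * sqrt ?U" by (rule mult_left_mono) simp
        moreover have "norm (evol t x) = norm x * norm (evol t e)"
          by (subst e(2)) (simp add: linear_cmul[OF linear_evol])
        ultimately show ?thesis by (simp add: mult.commute)
      qed (simp add: linear_0[OF linear_evol])
      \<comment> \<open>A unit vector makes the bound \<open>nx\<close> say that
        \<open>sqrt ?U\<close> is nonnegative; since real \<open>sqrt\<close> is odd, the radicand
        is nonnegative as well.\<close>
      obtain e :: 'a where e: "norm e = 1" using vector_choose_size[of 1] by auto
      have U: "0 \<le> ?U"
      proof -
        have "0 \<le> sqrt ?U" using order_trans[OF norm_ge_zero nx[of e]] e by simp
        then show ?thesis by simp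
      qed
      have "R \<le> sqrt ?U" unfolding R_def by (rule onorm_bound) (use nx U in auto)
      then have "R\<^sup>2 \<le> (sqrt ?U)\<^sup>2" using R0 by (intro power_mono) auto
      then show ?thesis using U by (simp add: algebra_simps)
    qed
    have lower: "1 - 2 * c * s - 2 * K * (s * t) \<le> R\<^sup>2"
    proof -
      obtain x where x: "norm x = 1" "J t x \<le> t ^ (2 * m) * (c + K * t)" using up[OF t(1) t'(1)] by blast
      have "norm (evol t x) \<le> R" using onorm[OF bl, of x] x(1) by (simp add: R_def)
      then have "(norm (evol t x))\<^sup>2 \<le> R\<^sup>2" by (intro power_mono) auto
      moreover have "2 * t * J t x \<le> 2 * s * (c + K * t)"
        using mult_left_mono[OF x(2), of "2 * t"] t' unfolding p by simp
      ultimately show ?thesis unfolding norm_evol_eq x(1) by (simp add: algebra_simps)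
    qed
    \<comment> \<open>Because s \<le> t, the square of the leading term c s joins the error of order
      s t = t^(2m+2).\<close>
    have "s * s \<le> s * t" using s by (intro mult_left_mono) auto
    then have ss: "c\<^sup>2 * (s * s) \<le> c\<^sup>2 * (s * t)" "0 \<le> c\<^sup>2 * (s * s)" by (auto intro: mult_left_mono)
    have "(R - (1 - c * s)) * (R + (1 - c * s)) = R\<^sup>2 - (1 - 2 * c * s) - c\<^sup>2 * (s * s)"
      by (simp add: power2_eq_square algebra_simps)
    then have "\<bar>(R - (1 - c * s)) * (R + (1 - c * s))\<bar> \<le> 2 * K * (s * t) + c\<^sup>2 * (s * t)"
      using upper lower ss by linarith
    moreover have "\<bar>R - (1 - c * s)\<bar> * (1 / 2) \<le> \<bar>R - (1 - c * s)\<bar> * \<bar>R + (1 - c * s)\<bar>"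
      using R0 cs by (intro mult_left_mono) auto
    ultimately have "\<bar>R - (1 - c * s)\<bar> \<le> 2 * (2 * K * (s * t) + c\<^sup>2 * (s * t))" by (simp add: abs_mult)
    then show ?thesis unfolding R_def s_def[symmetric] st by (simp add: algebra_simps)
  qed
  have "\<forall>\<^sub>F t in at_right 0. norm (onorm (evol t) - (1 - c * t ^ (2 * m + 1))) \<le> 2 * (2 * K + c\<^sup>2) * norm (t ^ (2 * m + 2))"
    unfolding eventually_at_right_field
    by (rule exI[of _ t1]) (use bound cK in \<open>auto simp: t1_def\<close>)
  then have "(\<lambda>t. onorm (evol t) - (1 - c * t ^ (2 * m + 1))) \<in> O[at_right 0](\<lambda>t. t ^ (2 * m + 2))"
    by (rule bigoI)
  then show ?thesis using cK(1) by blast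
qed

end

subsection \<open>The weighted space as a Gaussian Hilbert space\<close>

definition toL :: "(real^'n \<Rightarrow> real) \<Rightarrow> 'n gl2" where
  "toL f = abs_gl2 (\<lambda>x. f x / f_inf x)"

text \<open>Chooses a representative, since solutions of the equation are functions and not
  classes.\<close>

definition ofL :: "'n gl2 \<Rightarrow> real^'n \<Rightarrow> real" where
  "ofL h x = rep_gl2 h x * f_inf x"

lemma f_inf_nz [simp]: "f_inf x \<noteq> 0"
  using f_inf_pos[of x] by simp

lemma in_H_iff: "in_H f \<longleftrightarrow> sq_int (\<lambda>x. f x / f_inf x)"
proof -
  have m: "f \<in> borel_measurable borel \<longleftrightarrow> (\<lambda>x. f x / f_inf x) \<in> borel_measurable borel"
  proof
    assume "(\<lambda>x. f x / f_inf x) \<in> borel_measurable borel"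
    then have "(\<lambda>x. f x / f_inf x * f_inf x) \<in> borel_measurable borel"
      by (rule borel_measurable_times) measurable
    then show "f \<in> borel_measurable borel" by simp
  next
    assume "f \<in> borel_measurable borel"
    then show "(\<lambda>x. f x / f_inf x) \<in> borel_measurable borel"
      by (rule borel_measurable_divide) measurable
  qed
  have "integrable lborel (\<lambda>x. (f x)\<^sup>2 / f_inf x) \<longleftrightarrow> integrable gauss (\<lambda>x. (f x / f_inf x)\<^sup>2)"
    if [measurable]: "f \<in> borel_measurable borel"
    by (subst integrable_gauss_iff) (auto simp: power2_eq_square)
  then show ?thesis using m unfolding in_H_def sq_int_def by auto
qed

lemma H_norm_eq: assumes "in_H f" shows "H_norm f = norm (toL f)"
proof -
  have f: "sq_int (\<lambda>x. f x / f_inf x)" using assms by (simp add: in_H_iff)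
  have [measurable]: "f \<in> borel_measurable borel" using assms by (simp add: in_H_def)
  have "(\<integral>x. (f x / f_inf x)\<^sup>2 \<partial>gauss) = (\<integral>x. (f x)\<^sup>2 / f_inf x \<partial>lborel)"
    by (subst integral_gauss) (auto simp: power2_eq_square)
  then show ?thesis by (simp add: H_norm_def toL_def norm_abs_gl2[OF f])
qed

lemma in_H_diff: "in_H f \<Longrightarrow> in_H g \<Longrightarrow> in_H (\<lambda>x. f x - g x)"
  unfolding in_H_iff diff_divide_distrib by (rule sq_int_diff)

lemma toL_diff: "in_H f \<Longrightarrow> in_H g \<Longrightarrow> toL (\<lambda>x. f x - g x) = toL f - toL g"
  unfolding in_H_iff toL_def diff_divide_distrib by (simp add: diff_abs_gl2)

lemma in_H_ofL: "in_H (ofL h)"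
  unfolding in_H_iff ofL_def by (simp add: sq_int_rep)

lemma toL_ofL: "toL (ofL h) = h"
  unfolding toL_def ofL_def by simp

lemma H_norm_diff: "in_H f \<Longrightarrow> in_H g \<Longrightarrow> H_norm (\<lambda>x. f x - g x) = norm (toL f - toL g)"
  by (simp add: H_norm_eq in_H_diff toL_diff)

text \<open>The Lebesgue pairing of the weak formulation is the Gaussian inner product once the
  solution is divided by \<open>f_inf\<close>; the test function is left as it is.\<close>

lemma integral_eq_inner_toL:
  assumes f: "in_H f" and \<phi>: "sq_int \<phi>"
  shows "(\<integral>x. f x * \<phi> x \<partial>lborel) = toL f \<bullet> abs_gl2 \<phi>"
proof -
  have s: "sq_int (\<lambda>x. f x / f_inf x)" using f by (simp add: in_H_iff)
  have [measurable]: "(\<lambda>x. f x / f_inf x) \<in> borel_measurable borel" "\<phi> \<in> borel_measurable borel"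
    using s \<phi> by (simp_all add: sq_int_def)
  have "toL f \<bullet> abs_gl2 \<phi> = (\<integral>x. (f x / f_inf x) * \<phi> x \<partial>gauss)"
    unfolding toL_def by (rule inner_abs_gl2[OF s \<phi>])
  also have "\<dots> = (\<integral>x. (f x / f_inf x) * \<phi> x * f_inf x \<partial>lborel)" by (rule integral_gauss) measurable
  finally show ?thesis by (simp add: mult.commute)
qed

lemma coh_0: "coh 0 = abs_gl2 (\<lambda>x. 1)"
  by (simp add: coh_def)

lemma in_H_Pi0: "in_H (Pi0 f)"
  by (simp add: in_H_iff Pi0_def sq_int_const)

lemma toL_Pi0:
  assumes "in_H f" shows "toL (Pi0 f) = (toL f \<bullet> coh 0) *\<^sub>R coh 0"
proof -
  have "(\<integral>y. f y * f_inf y / f_inf y \<partial>lborel) = toL f \<bullet> coh 0"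
    unfolding coh_0 using integral_eq_inner_toL[OF assms sq_int_const[of 1]] by simp
  then show ?thesis unfolding coh_0 by (simp add: toL_def Pi0_def scaleR_abs_gl2 sq_int_const)
qed

subsection \<open>Compactly supported test functions\<close>

lemma continuous_bounded_support:
  fixes f :: "'a::euclidean_space \<Rightarrow> 'b::real_normed_vector"
  assumes f: "continuous_on UNIV f" and b: "bounded {x. f x \<noteq> 0}"
  obtains B where "0 \<le> B" "\<And>x. norm (f x) \<le> B"
proof -
  have "compact (f ` closure {x. f x \<noteq> 0})"
    using b by (intro compact_continuous_image continuous_on_subset[OF f]) (auto simp: compact_closure)
  from compact_imp_bounded[OF this] obtain B where "\<forall>y\<in>f ` closure {x. f x \<noteq> 0}. norm y \<le> B"
    unfolding bounded_iff ..
  then have B: "\<And>x. x \<in> closure {x. f x \<noteq> 0} \<Longrightarrow> norm (f x) \<le> B" by simp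
  have "norm (f x) \<le> max B 0" for x
    using B[of x] closure_subset[of "{x. f x \<noteq> 0}"] by (cases "f x = 0") (auto simp: le_max_iff_disj)
  then show ?thesis using that[of "max B 0"] by simp
qed

text \<open>Passing to the closure leaves an open set on which the function vanishes. Consequently
  gradient and Hessian of a test function again have bounded support and are bounded.\<close>

lemma has_derivative_zero_outside:
  fixes f :: "'a::real_normed_vector \<Rightarrow> 'b::real_normed_vector"
  assumes "(f has_derivative f') (at x)" "x \<notin> closure {x. f x \<noteq> 0}"
  shows "f' = (\<lambda>h. 0)"
proof -
  have "((\<lambda>x. 0) has_derivative f') (at x)"
    by (rule has_derivative_transform_within_open[OF assms(1), of "- closure {x. f x \<noteq> 0}"])
       (use assms(2) closure_subset[of "{x. f x \<noteq> 0}"] in auto)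
  then show ?thesis using has_derivative_unique has_derivative_const by blast
qed

lemma gradient_bounded_support:
  fixes \<psi> :: "real^'n \<Rightarrow> real"
  assumes "\<And>x. (\<psi> has_derivative (\<lambda>h. G x \<bullet> h)) (at x)" "bounded {x. \<psi> x \<noteq> 0}"
  shows "bounded {x. G x \<noteq> 0}"
proof (rule bounded_subset[OF bounded_closure[OF assms(2)]], safe, rule ccontr)
  fix x assume "G x \<noteq> 0" "x \<notin> closure {x. \<psi> x \<noteq> 0}"
  with has_derivative_zero_outside[OF assms(1), of x] have "G x \<bullet> G x = 0" by metis
  with \<open>G x \<noteq> 0\<close> show False by simp
qed

lemma jacobian_bounded_support:
  fixes g :: "real^'n \<Rightarrow> real^'n"
  assumes "\<And>x. (g has_derivative (\<lambda>h. Hs x *v h)) (at x)" "bounded {x. g x \<noteq> 0}"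
  shows "bounded {x. Hs x \<noteq> 0}"
proof (rule bounded_subset[OF bounded_closure[OF assms(2)]], safe, rule ccontr)
  fix x assume "Hs x \<noteq> 0" "x \<notin> closure {x. g x \<noteq> 0}"
  with has_derivative_zero_outside[OF assms(1), of x] have "Hs x *v h = 0 *v h" for h
    by (simp add: fun_eq_iff)
  then have "Hs x = 0" by (simp add: matrix_eq)
  with \<open>Hs x \<noteq> 0\<close> show False by simp
qed

lemma continuous_on_derivative: "(\<And>x. (f has_derivative f' x) (at x)) \<Longrightarrow> continuous_on UNIV f"
  by (meson has_derivative_continuous continuous_at_imp_continuous_on)

lemma sq_int_continuous_bounded_support:
  fixes f :: "real^'n \<Rightarrow> real"
  assumes "continuous_on UNIV f" "bounded {x. f x \<noteq> 0}" shows "sq_int f"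
proof -
  obtain B where "\<And>x. norm (f x) \<le> B" using continuous_bounded_support[OF assms] by blast
  then show ?thesis by (intro sq_int_bounded[of f B] borel_measurable_continuous_onI assms) auto
qed

subsection \<open>Integration by parts against the Gaussian measure\<close>

lemma integral_gauss_shift:
  fixes \<phi> :: "real^'n \<Rightarrow> real"
  assumes [measurable]: "\<phi> \<in> borel_measurable borel"
  shows "(\<integral>y. \<phi> (y + \<xi>) \<partial>gauss) = (\<integral>y. exp (\<xi> \<bullet> y - (norm \<xi>)\<^sup>2 / 2) * \<phi> y \<partial>gauss)"
proof -
  have "(\<integral>y. exp (\<xi> \<bullet> y - (norm \<xi>)\<^sup>2 / 2) * \<phi> y \<partial>gauss)
      = (\<integral>y. exp (\<xi> \<bullet> y - (norm \<xi>)\<^sup>2 / 2) * \<phi> y * f_inf y \<partial>lborel)"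
    by (rule integral_gauss) measurable
  also have "\<dots> = (\<integral>y. \<phi> y * f_inf (y - \<xi>) \<partial>lborel)"
  proof (intro Bochner_Integration.integral_cong refl)
    fix y
    have "exp (\<xi> \<bullet> y - (norm \<xi>)\<^sup>2 / 2) * f_inf y = exp (- ((norm \<xi>)\<^sup>2 / 2)) * (exp (\<xi> \<bullet> y) * f_inf y)"
      by (simp add: mult.assoc[symmetric] flip: exp_add)
    also have "\<dots> = f_inf (y - \<xi>)" by (simp add: exp_times_f_inf exp_minus)
    finally show "exp (\<xi> \<bullet> y - (norm \<xi>)\<^sup>2 / 2) * \<phi> y * f_inf y = \<phi> y * f_inf (y - \<xi>)" by (simp add: mult_ac)
  qed
  also have "\<dots> = (\<integral>y. \<phi> (\<xi> + y) * f_inf (\<xi> + y - \<xi>) \<partial>lborel)"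
    by (rule integral_lborel_shift[symmetric]) measurable
  also have "\<dots> = (\<integral>y. \<phi> (y + \<xi>) \<partial>gauss)"
    by (subst integral_gauss) (auto simp: add.commute)
  finally show ?thesis ..
qed

text \<open>A coherent vector averages over the Gaussian centred at xi. Dependence on xi is thus a
  translation of the test function, and derivatives in xi fall on that function.\<close>

lemma coh_inner_shift:
  fixes \<phi> :: "real^'n \<Rightarrow> real"
  assumes "sq_int \<phi>"
  shows "coh \<xi> \<bullet> abs_gl2 \<phi> = (\<integral>y. \<phi> (y + \<xi>) \<partial>gauss)"
  unfolding coh_def using assms
  by (subst inner_abs_gl2[OF sq_int_coh assms], subst integral_gauss_shift) (auto simp: sq_int_def)

lemma gauss_integrable_bounded:
  fixes f :: "real^'n \<Rightarrow> real"
  assumes "f \<in> borel_measurable borel" "\<And>x. \<bar>f x\<bar> \<le> B"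
  shows "integrable gauss f"
  by (rule sq_int_integrable[OF sq_int_bounded[OF assms]])

text \<open>Both sides are the derivative at t = 0 of the shift identity with shift t b: the
  translated function yields the gradient, the exponential weight yields the factor x . b.\<close>

lemma gauss_integration_by_parts:
  fixes \<psi> :: "real^'n \<Rightarrow> real"
  assumes \<psi>: "\<And>x. (\<psi> has_derivative (\<lambda>h. G x \<bullet> h)) (at x)" and G: "continuous_on UNIV G"
    and s: "bounded {x. \<psi> x \<noteq> 0}"
  shows "(\<integral>x. G x \<bullet> b \<partial>gauss) = (\<integral>x. (x \<bullet> b) * \<psi> x \<partial>gauss)"
proof -
  have c: "continuous_on UNIV \<psi>" by (rule continuous_on_derivative[OF \<psi>])
  have [measurable]: "\<psi> \<in> borel_measurable borel" "G \<in> borel_measurable borel"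
    by (rule borel_measurable_continuous_onI[OF c] borel_measurable_continuous_onI[OF G])+
  obtain B where B: "0 \<le> B" "\<And>x. \<bar>\<psi> x\<bar> \<le> B" using continuous_bounded_support[OF c s] by auto
  obtain B' where B': "0 \<le> B'" "\<And>x. norm (G x) \<le> B'"
    using continuous_bounded_support[OF G gradient_bounded_support[OF \<psi> s]] by auto
  obtain R where R: "\<And>x. \<psi> x \<noteq> 0 \<Longrightarrow> norm x \<le> R" using s unfolding bounded_iff by blast
  define R' where "R' = max R 0"
  have R': "0 \<le> R'" "\<And>x. \<psi> x \<noteq> 0 \<Longrightarrow> norm x \<le> R'" using R by (auto simp: R'_def le_max_iff_disj)
  have d1: "((\<lambda>t. \<integral>y. \<psi> (y + t *\<^sub>R b) \<partial>gauss) has_real_derivative (\<integral>y. G (y + 0 *\<^sub>R b) \<bullet> b \<partial>gauss)) (at 0)"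
  proof (rule has_real_derivative_integral[where a="-1" and b=1 and W="\<lambda>_. B' * norm b"])
    show "integrable gauss (\<lambda>y. \<psi> (y + t *\<^sub>R b))" for t
      by (rule gauss_integrable_bounded[where B=B]) (use B in auto)
    show "((\<lambda>s. \<psi> (y + s *\<^sub>R b)) has_real_derivative G (y + t *\<^sub>R b) \<bullet> b) (at t)" for t y
    proof -
      have "((\<lambda>s. \<psi> (y + s *\<^sub>R b)) has_derivative (\<lambda>h. G (y + t *\<^sub>R b) \<bullet> (h *\<^sub>R b))) (at t)"
        by (rule has_derivative_compose[OF _ \<psi>]) (auto intro!: derivative_eq_intros)
      then show ?thesis by (simp add: has_field_derivative_def mult_commute_abs)
    qed
    show "\<bar>G (y + t *\<^sub>R b) \<bullet> b\<bar> \<le> B' * norm b" for t y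
      using Cauchy_Schwarz_ineq2[of "G (y + t *\<^sub>R b)" b] mult_right_mono[OF B'(2)[of "y + t *\<^sub>R b"], of "norm b"]
      by simp
  qed auto
  have d2: "((\<lambda>t. \<integral>y. exp (t * (b \<bullet> y) - t\<^sup>2 * (norm b)\<^sup>2 / 2) * \<psi> y \<partial>gauss) has_real_derivative
     (\<integral>y. (b \<bullet> y - 0 * (norm b)\<^sup>2) * exp (0 * (b \<bullet> y) - 0\<^sup>2 * (norm b)\<^sup>2 / 2) * \<psi> y \<partial>gauss)) (at 0)"
  proof (rule has_real_derivative_integral[where a="-1" and b=1
        and W="\<lambda>_. (norm b * R' + (norm b)\<^sup>2) * exp (norm b * R') * B"])
    fix t :: real assume t: "-1 < t" "t < 1"
    then have t1: "\<bar>t\<bar> \<le> 1" by simp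
    have e: "\<bar>exp (t * (b \<bullet> y) - t\<^sup>2 * (norm b)\<^sup>2 / 2)\<bar> \<le> exp (norm b * R')" and d: "\<bar>b \<bullet> y\<bar> \<le> norm b * R'" if "\<psi> y \<noteq> 0" for y
    proof -
      have "\<bar>b \<bullet> y\<bar> \<le> norm b * norm y" by (rule Cauchy_Schwarz_ineq2)
      also have "\<dots> \<le> norm b * R'" using R'(2)[OF that] by (simp add: mult_left_mono)
      finally show d: "\<bar>b \<bullet> y\<bar> \<le> norm b * R'" .
      have "\<bar>t * (b \<bullet> y)\<bar> \<le> 1 * \<bar>b \<bullet> y\<bar>" unfolding abs_mult by (rule mult_right_mono[OF t1]) simp
      then have "t * (b \<bullet> y) - t\<^sup>2 * (norm b)\<^sup>2 / 2 \<le> norm b * R'" using d zero_le_power2[of "t * norm b"] unfolding power_mult_distrib by linarith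
      then show "\<bar>exp (t * (b \<bullet> y) - t\<^sup>2 * (norm b)\<^sup>2 / 2)\<bar> \<le> exp (norm b * R')" by simp
    qed
    show "integrable gauss (\<lambda>y. exp (t * (b \<bullet> y) - t\<^sup>2 * (norm b)\<^sup>2 / 2) * \<psi> y)"
    proof (rule gauss_integrable_bounded[where B="exp (norm b * R') * B"])
      show "\<bar>exp (t * (b \<bullet> y) - t\<^sup>2 * (norm b)\<^sup>2 / 2) * \<psi> y\<bar> \<le> exp (norm b * R') * B" for y
      proof (cases "\<psi> y = 0")
        case False
        show ?thesis unfolding abs_mult by (rule mult_mono[OF e[OF False] B(2)]) (use B in auto)
      qed (use B in simp)
    qed measurable
    show "((\<lambda>s. exp (s * (b \<bullet> y) - s\<^sup>2 * (norm b)\<^sup>2 / 2) * \<psi> y) has_real_derivative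
        (b \<bullet> y - t * (norm b)\<^sup>2) * exp (t * (b \<bullet> y) - t\<^sup>2 * (norm b)\<^sup>2 / 2) * \<psi> y) (at t)" for y
      by (auto intro!: derivative_eq_intros)
    show "\<bar>(b \<bullet> y - t * (norm b)\<^sup>2) * exp (t * (b \<bullet> y) - t\<^sup>2 * (norm b)\<^sup>2 / 2) * \<psi> y\<bar>
        \<le> (norm b * R' + (norm b)\<^sup>2) * exp (norm b * R') * B" for y
    proof (cases "\<psi> y = 0")
      case False
      have "\<bar>t * (norm b)\<^sup>2\<bar> \<le> 1 * (norm b)\<^sup>2" unfolding abs_mult using t1 by (intro mult_mono) auto
      then have 1: "\<bar>b \<bullet> y - t * (norm b)\<^sup>2\<bar> \<le> norm b * R' + (norm b)\<^sup>2"
        using d[OF False] by linarith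
      show ?thesis unfolding abs_mult by (intro mult_mono 1 e[OF False] B) (use B R' in auto)
    qed (use B R' in simp)
  qed auto
  have e: "(\<lambda>t. \<integral>y. \<psi> (y + t *\<^sub>R b) \<partial>gauss) = (\<lambda>t. \<integral>y. exp (t * (b \<bullet> y) - t\<^sup>2 * (norm b)\<^sup>2 / 2) * \<psi> y \<partial>gauss)"
    by (subst integral_gauss_shift) (auto simp: power_mult_distrib)
  show ?thesis using DERIV_unique[OF d1[unfolded e] d2] by (simp add: inner_commute)
qed

subsection \<open>The Fokker--Planck semigroup as a second quantization\<close>

lemma integrable_mult_bounded_support:
  fixes f k :: "real^'n \<Rightarrow> real"
  assumes "continuous_on UNIV f" "bounded {x. f x \<noteq> 0}" "continuous_on UNIV k"
  shows "integrable gauss (\<lambda>x. k x * f x)"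
proof (rule sq_int_integrable[OF sq_int_continuous_bounded_support])
  show "continuous_on UNIV (\<lambda>x. k x * f x)" using assms by (intro continuous_intros)
  show "bounded {x. k x * f x \<noteq> 0}" by (rule bounded_subset[OF assms(2)]) auto
qed

lemma test_fun_facts:
  assumes "test_fun \<phi> g Hs"
  shows "(\<phi> has_derivative (\<lambda>h. g x \<bullet> h)) (at x)" "(g has_derivative (\<lambda>h. Hs x *v h)) (at x)"
    "continuous_on UNIV \<phi>" "continuous_on UNIV g" "continuous_on UNIV Hs"
    "bounded {x. \<phi> x \<noteq> 0}" "bounded {x. g x \<noteq> 0}" "bounded {x. Hs x \<noteq> 0}"
proof -
  have d: "(\<phi> has_derivative (\<lambda>h. g x \<bullet> h)) (at x)" "(g has_derivative (\<lambda>h. Hs x *v h)) (at x)" for x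
    using assms by (simp_all add: test_fun_def)
  show "(\<phi> has_derivative (\<lambda>h. g x \<bullet> h)) (at x)" "(g has_derivative (\<lambda>h. Hs x *v h)) (at x)" by (fact d)+
  show "continuous_on UNIV \<phi>" "continuous_on UNIV g"
    using continuous_on_derivative[OF d(1)] continuous_on_derivative[OF d(2)] by auto
  show "continuous_on UNIV Hs" and b: "bounded {x. \<phi> x \<noteq> 0}" using assms by (simp_all add: test_fun_def)
  show g: "bounded {x. g x \<noteq> 0}" by (rule gradient_bounded_support[OF d(1) b])
  show "bounded {x. Hs x \<noteq> 0}" by (rule jacobian_bounded_support[OF d(2) g])
qed

locale fokker_planck =
  fixes C :: "real^'n^'n"
  assumes psd: "pos_semidef (sym_part C)"

lemma sym_plus_asym: "sym_part C + asym_part C = C"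
proof -
  have "sym_part C + asym_part C = (1/2 + 1/2) *\<^sub>R C"
    unfolding sym_part_def asym_part_def by (simp only: scaleR_add_right scaleR_diff_right scaleR_add_left) simp
  then show ?thesis by simp
qed

lemma transpose_sym_part: "transpose (sym_part C) = sym_part C"
  by (simp add: sym_part_def transpose_def vec_eq_iff add.commute)

lemma transpose_asym_part: "transpose (asym_part C) = - asym_part C"
  by (simp add: asym_part_def transpose_def vec_eq_iff algebra_simps)

lemma sym_minus_asym: "sym_part C - asym_part C = transpose C"
proof -
  have "sym_part C - asym_part C = transpose (sym_part C + asym_part C)"
    by (simp add: transpose_def vec_eq_iff sym_part_def asym_part_def algebra_simps)
  then show ?thesis by (simp only: sym_plus_asym)
qed

lemma uminus_matrix_vector_mult: "(- M) *v x = - (M *v x)" for M :: "real^'n^'m"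
  by (simp add: matrix_vector_mult_def vec_eq_iff sum_negf)

lemma dissipative_operator_sym_asym:
  assumes "pos_semidef (sym_part C)"
  shows "dissipative_operator ((*v) (sym_part C)) ((*v) (asym_part C))"
proof (rule dissipative_operator.intro)
  show "(sym_part C *v x) \<bullet> y = x \<bullet> (sym_part C *v y)" for x y
    using dot_lmul_matrix[of x "sym_part C" y] by (simp add: transpose_sym_part flip: transpose_matrix_vector)
  show "(asym_part C *v x) \<bullet> y = - (x \<bullet> (asym_part C *v y))" for x y
    using dot_lmul_matrix[of x "asym_part C" y]
    by (simp add: transpose_asym_part uminus_matrix_vector_mult flip: transpose_matrix_vector)
qed (use assms in \<open>auto simp: pos_semidef_def\<close>)

sublocale fokker_planck \<subseteq> dissipative_operator "(*v) (sym_part C)" "(*v) (asym_part C)"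
  by (rule dissipative_operator_sym_asym[OF psd])

text \<open>The transpose of C has the same symmetric part and the opposite skew part. Its semigroup
  is the adjoint one, which moves the parameter xi of a test vector
  \<open>coh \<xi>\<close>.\<close>

sublocale fokker_planck \<subseteq> tr: dissipative_operator "(*v) (sym_part C)" "\<lambda>x. - (asym_part C *v x)"
proof (rule dissipative_operator.intro)
  show "linear (\<lambda>x. - (asym_part C *v x))" using A by (rule linear_compose_neg)
qed (use S S_sym S_psd A_skew in auto)

section \<open>The semigroup on the Gaussian space and existence of weak solutions\<close>

context fokker_planck
begin

lemma gen_eq: "gen x = - (C *v x)"
  unfolding gen_def using sym_plus_asym[of C] by (metis matrix_vector_mult_add_rdistrib)

lemma tr_gen_eq: "tr.gen x = - (transpose C *v x)"
  unfolding tr.gen_def using sym_minus_asym[of C] by (metis add_uminus_conv_diff matrix_vector_mult_diff_rdistrib)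

lemma evol_adjoint: "evol t x \<bullet> y = x \<bullet> tr.evol t y"
  unfolding evol_def tr.evol_def
proof (rule opexp_adjoint[OF linear_gen tr.linear_gen])
  show "gen x \<bullet> y = x \<bullet> tr.gen y" for x y
    using S_sym[of x y] A_skew[of x y] by (simp add: gen_def tr.gen_def inner_add_left inner_add_right inner_diff_left inner_diff_right)
qed

lemma adjoint_evol: "adjoint (evol t) = tr.evol t"
  by (rule adjoint_unique) (simp add: evol_adjoint)

lemma evol_contraction: "0 \<le> t \<Longrightarrow> norm (evol t x) \<le> 1 * norm x"
  using norm_evol_le by simp

definition U :: "real \<Rightarrow> 'n gl2 \<Rightarrow> 'n gl2" where "U t = Gam (evol t)"

lemma U_inner: "0 \<le> t \<Longrightarrow> U t h \<bullet> coh \<xi> = h \<bullet> coh (tr.evol t \<xi>)"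
  unfolding U_def using Gam_inner[OF linear_evol evol_contraction zero_le_one order_refl] by (simp add: adjoint_evol)

lemma U_coh: "0 \<le> t \<Longrightarrow> U t (coh \<eta>) = coh (evol t \<eta>)"
  unfolding U_def by (rule Gam_coh[OF linear_evol evol_contraction zero_le_one order_refl])

lemma U_add: "0 \<le> t \<Longrightarrow> U t (g + h) = U t g + U t h"
  unfolding U_def by (rule Gam_add[OF linear_evol evol_contraction zero_le_one order_refl])

lemma U_diff: "0 \<le> t \<Longrightarrow> U t (g - h) = U t g - U t h"
  unfolding U_def by (rule Gam_diff[OF linear_evol evol_contraction zero_le_one order_refl])

lemma U_scale: "0 \<le> t \<Longrightarrow> U t (c *\<^sub>R h) = c *\<^sub>R U t h"
  unfolding U_def by (rule Gam_scale[OF linear_evol evol_contraction zero_le_one order_refl])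

lemma norm_U: "0 \<le> t \<Longrightarrow> norm (U t h) \<le> norm h"
  unfolding U_def by (rule norm_Gam[OF linear_evol evol_contraction zero_le_one order_refl])

lemma U_zero_vec: "0 \<le> t \<Longrightarrow> U t 0 = 0"
  using U_scale[of t 0 0] by simp

lemma U_0: "U 0 h = h"
  by (rule gl2_eqI) (simp add: U_inner tr.evol_0)

text \<open>Totality of the coherent vectors in the form of an induction rule: the vectors with
  property \<open>P\<close> form a closed subspace.\<close>

lemma U_closed_induct:
  assumes coh: "\<And>\<eta>. P (coh \<eta>)" and 0: "P 0" and add: "\<And>g h. P g \<Longrightarrow> P h \<Longrightarrow> P (g + h)"
    and scale: "\<And>c h. P h \<Longrightarrow> P (c *\<^sub>R h)"
    and lim: "\<And>H h. (\<And>n. P (H n)) \<Longrightarrow> H \<longlonglongrightarrow> h \<Longrightarrow> P h"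
  shows "P h"
proof -
  have "h \<in> {h. P h}"
  proof (rule coh_dense)
    show "subspace {h. P h}" using 0 add scale by (auto intro!: subspaceI)
    show "closed {h. P h}" unfolding closed_sequential_limits using lim by blast
  qed (use coh in simp)
  then show ?thesis by simp
qed

text \<open>For coherent vectors this is continuity of exp(xi . eta) and of the finite-dimensional
  orbit; contractivity makes the approximation of general data uniform in time.\<close>

lemma U_continuous: "continuous_on {0..} (\<lambda>t. U t h)"
proof (induction h rule: U_closed_induct)
  case (1 \<eta>)
  have c: "continuous_on UNIV (coh :: real^'n \<Rightarrow> 'n gl2)"
  proof (unfold continuous_on_def, rule ballI)
    fix \<xi> :: "real^'n"
    have "((\<lambda>\<zeta>. (norm (coh \<zeta> - coh \<xi>))\<^sup>2) \<longlongrightarrow> exp (\<xi> \<bullet> \<xi>) - 2 * exp (\<xi> \<bullet> \<xi>) + exp (\<xi> \<bullet> \<xi>)) (at \<xi>)"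
    proof -
      have "(norm (coh \<zeta> - coh \<xi>))\<^sup>2 = exp (\<zeta> \<bullet> \<zeta>) - 2 * exp (\<zeta> \<bullet> \<xi>) + exp (\<xi> \<bullet> \<xi>)" for \<zeta>
        unfolding power2_norm_eq_inner by (simp add: inner_diff_left inner_diff_right inner_coh inner_commute)
      then show ?thesis by (simp only:) (intro tendsto_intros)
    qed
    then have "((\<lambda>\<zeta>. (norm (coh \<zeta> - coh \<xi>))\<^sup>2) \<longlongrightarrow> 0) (at \<xi>)" by simp
    from tendsto_real_sqrt[OF this] have "((\<lambda>\<zeta>. norm (coh \<zeta> - coh \<xi>)) \<longlongrightarrow> 0) (at \<xi>)" by simp
    then show "(coh \<longlongrightarrow> coh \<xi>) (at \<xi>)" by (rule LIM_zero_cancel[OF tendsto_norm_zero_cancel])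
  qed
  have "continuous_on {0..} (\<lambda>t. coh (evol t \<eta>))"
    by (rule continuous_on_compose2[OF c continuous_on_evol]) simp
  then show ?case by (rule continuous_on_eq) (simp add: U_coh)
next
  case 2
  show ?case by (rule continuous_on_eq[OF continuous_on_const]) (simp add: U_zero_vec)
next
  case (3 g h)
  show ?case by (rule continuous_on_eq[OF continuous_on_add[OF 3]]) (simp add: U_add)
next
  case (4 c h)
  show ?case by (rule continuous_on_eq[OF continuous_on_scaleR[OF continuous_on_const[of _ c] 4]]) (simp add: U_scale)
next
  case (5 H h)
  show ?case
  proof (rule uniform_limit_theorem[OF always_eventually[OF allI[OF 5(1)]] _ sequentially_bot])
    show "uniform_limit {0..} (\<lambda>n t. U t (H n)) (\<lambda>t. U t h) sequentially"
    proof (rule uniform_limitI)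
      fix e :: real assume "e > 0"
      with 5(2) have "\<forall>\<^sub>F n in sequentially. dist (H n) h < e" by (rule tendstoD)
      then show "\<forall>\<^sub>F n in sequentially. \<forall>t\<in>{0..}. dist (U t (H n)) (U t h) < e"
      proof eventually_elim
        case (elim n)
        then show ?case using norm_U[of _ "H n - h"]
          by (auto simp: dist_norm U_diff intro: le_less_trans)
      qed
    qed
  qed
qed

lemma FP_adj_continuous:
  assumes "test_fun \<phi> g Hs"
  shows "continuous_on UNIV (FP_adj C g Hs)" "bounded {x. FP_adj C g Hs x \<noteq> 0}"
proof -
  note g = test_fun_facts(4)[OF assms] and H = test_fun_facts(5)[OF assms]
    and sg = test_fun_facts(7)[OF assms] and sH = test_fun_facts(8)[OF assms]
  show "continuous_on UNIV (FP_adj C g Hs)"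
    unfolding FP_adj_def
    by (intro continuous_intros g H matrix_vector_mult_linear_continuous_on)
  show "bounded {x. FP_adj C g Hs x \<noteq> 0}"
    by (rule bounded_subset[of "{x. g x \<noteq> 0} \<union> {x. Hs x \<noteq> 0}"]) (use sg sH in \<open>auto simp: FP_adj_def\<close>)
qed

lemma sq_int_test:
  assumes "test_fun \<phi> g Hs"
  shows "sq_int \<phi>" "sq_int (FP_adj C g Hs)"
proof -
  show "sq_int \<phi>" by (rule sq_int_continuous_bounded_support[OF test_fun_facts(3,6)[OF assms]])
  show "sq_int (FP_adj C g Hs)" by (rule sq_int_continuous_bounded_support[OF FP_adj_continuous[OF assms]])
qed

text \<open>Averaged over a Gaussian centred at xi, diffusion and the drift relative to the centre
  cancel. Integration by parts turns the Hessian into the moments of y_j times the i-th derivative;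
  a second one shows these moments to be symmetric, so that the skew part of C contributes nothing.
  Only the drift of the centre remains.\<close>

lemma coh_inner_FP_adj:
  assumes t: "test_fun \<phi> g Hs"
  shows "coh \<xi> \<bullet> abs_gl2 (FP_adj C g Hs) = (\<integral>y. g (y + \<xi>) \<bullet> (- (C *v \<xi>)) \<partial>gauss)"
proof -
  define \<phi>1 where "\<phi>1 y = \<phi> (y + \<xi>)" for y
  define g1 where "g1 y = g (y + \<xi>)" for y
  define H1 where "H1 y = Hs (y + \<xi>)" for y
  have sh: "((\<lambda>y. y + \<xi>) has_derivative (\<lambda>h. h)) (at y)" for y by (auto intro!: derivative_eq_intros)
  have d\<phi>: "(\<phi>1 has_derivative (\<lambda>h. g1 y \<bullet> h)) (at y)" for y
    unfolding \<phi>1_def g1_def using has_derivative_compose[OF sh, of \<phi> "\<lambda>h. g (y + \<xi>) \<bullet> h" y] t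
    by (simp add: test_fun_def)
  have dg: "(g1 has_derivative (\<lambda>h. H1 y *v h)) (at y)" for y
    unfolding g1_def H1_def using has_derivative_compose[OF sh, of g "\<lambda>h. Hs (y + \<xi>) *v h" y] t
    by (simp add: test_fun_def)
  have cH: "continuous_on UNIV H1" unfolding H1_def
    by (rule continuous_on_compose2[OF test_fun_facts(5)[OF t]]) (auto intro: continuous_intros)
  have c\<phi>: "continuous_on UNIV \<phi>1" and cg: "continuous_on UNIV g1"
    using continuous_on_derivative[OF d\<phi>] continuous_on_derivative[OF dg] by auto
  have b\<phi>: "bounded {y. \<phi>1 y \<noteq> 0}"
  proof -
    have "bounded ((\<lambda>x. x - \<xi>) ` {x. \<phi> x \<noteq> 0})" using t by (intro bounded_translation_minus) (simp add: test_fun_def)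
    moreover have "{y. \<phi>1 y \<noteq> 0} \<subseteq> (\<lambda>x. x - \<xi>) ` {x. \<phi> x \<noteq> 0}"
      unfolding \<phi>1_def by (auto intro!: image_eqI[of _ _ "_ + \<xi>"])
    ultimately show ?thesis by (rule bounded_subset)
  qed
  have bg: "bounded {y. g1 y \<noteq> 0}" by (rule gradient_bounded_support[OF d\<phi> b\<phi>])
  have bgi: "bounded {y. g1 y $ i \<noteq> 0}" for i by (rule bounded_subset[OF bg]) auto
  have bH: "bounded {y. H1 y \<noteq> 0}" by (rule jacobian_bounded_support[OF dg bg])
  have bHij: "bounded {y. H1 y $ i $ j \<noteq> 0}" for i j by (rule bounded_subset[OF bH]) auto
  have cgi: "continuous_on UNIV (\<lambda>y. g1 y $ i)" for i by (intro continuous_intros cg)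
  have cHi: "continuous_on UNIV (\<lambda>y. H1 y $ i)" for i by (intro continuous_intros cH)
  have cHij: "continuous_on UNIV (\<lambda>y. H1 y $ i $ j)" for i j by (intro continuous_intros cH)
  have ig: "integrable gauss (\<lambda>y. k y * g1 y $ i)" if "continuous_on UNIV k" for k i
    by (rule integrable_mult_bounded_support[OF cgi bgi that])
  have iH: "integrable gauss (\<lambda>y. k * H1 y $ i $ j)" for k i j
    by (rule integrable_mult_bounded_support[OF cHij bHij continuous_on_const])
  have i\<phi>: "integrable gauss (\<lambda>y. k y * \<phi>1 y)" if "continuous_on UNIV k" for k
    by (rule integrable_mult_bounded_support[OF c\<phi> b\<phi> that])
  have 1: "(\<integral>y. H1 y $ i $ j \<partial>gauss) = (\<integral>y. y $ j * g1 y $ i \<partial>gauss)" for i j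
  proof -
    have "((\<lambda>y. g1 y $ i) has_derivative (\<lambda>h. H1 y $ i \<bullet> h)) (at y)" for y
      using bounded_linear.has_derivative[OF bounded_linear_vec_nth dg[of y], of i]
      by (simp add: matrix_vector_mul_component)
    from gauss_integration_by_parts[OF this cHi bgi, of "axis j 1"]
    show ?thesis by (simp add: inner_axis)
  qed
  define m where "m i j = (\<integral>y. y $ j * g1 y $ i \<partial>gauss)" for i j
  have 2: "m i j = m j i" for i j
  proof -
    have "m i j = (\<integral>y. (y $ i * y $ j) * \<phi>1 y \<partial>gauss) - (if i = j then 1 else 0) * (\<integral>y. \<phi>1 y \<partial>gauss)" for i j
    proof -
      have "((\<lambda>y. y $ j * \<phi>1 y) has_derivative (\<lambda>h. (y $ j *\<^sub>R g1 y + \<phi>1 y *\<^sub>R axis j 1) \<bullet> h)) (at y)" for y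
      proof -
        have "((\<lambda>y. y $ j * \<phi>1 y) has_derivative (\<lambda>h. y $ j * (g1 y \<bullet> h) + h $ j * \<phi>1 y)) (at y)"
          by (rule has_derivative_mult[OF bounded_linear_imp_has_derivative[OF bounded_linear_vec_nth] d\<phi>])
        then show ?thesis by (simp add: inner_add_left inner_axis' mult.commute)
      qed
      moreover have "continuous_on UNIV (\<lambda>y. y $ j *\<^sub>R g1 y + \<phi>1 y *\<^sub>R axis j 1)"
        by (intro continuous_intros cg c\<phi>)
      moreover have "bounded {y. y $ j * \<phi>1 y \<noteq> 0}" by (rule bounded_subset[OF b\<phi>]) auto
      ultimately have I: "(\<integral>y. (y $ j *\<^sub>R g1 y + \<phi>1 y *\<^sub>R axis j 1) \<bullet> axis i 1 \<partial>gauss)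
          = (\<integral>y. (y \<bullet> axis i 1) * (y $ j * \<phi>1 y) \<partial>gauss)"
        by (rule gauss_integration_by_parts)
      have e: "(y $ j *\<^sub>R g1 y + \<phi>1 y *\<^sub>R axis j 1) \<bullet> axis i 1 = y $ j * g1 y $ i + (if i = j then 1 else 0) * \<phi>1 y" for y
        by (simp add: inner_add_left inner_axis) (simp add: axis_def)
      have "(\<integral>y. y $ j * g1 y $ i + (if i = j then 1 else 0) * \<phi>1 y \<partial>gauss) = (\<integral>y. (y $ i * y $ j) * \<phi>1 y \<partial>gauss)"
        using I unfolding e by (simp only: inner_axis inner_real_def mult_1_right mult.assoc)
      moreover have "(\<integral>y. y $ j * g1 y $ i + (if i = j then 1 else 0) * \<phi>1 y \<partial>gauss)
          = m i j + (if i = j then 1 else 0) * (\<integral>y. \<phi>1 y \<partial>gauss)"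
        unfolding m_def
        by (subst Bochner_Integration.integral_add[OF ig i\<phi>]) (auto intro!: continuous_intros)
      ultimately show ?thesis by simp
    qed
    from this[of i j] this[of j i] show ?thesis by (simp add: mult.commute eq_commute)
  qed
  let ?A = "asym_part C" and ?S = "sym_part C"
  \<comment> \<open>Exchanging the indices shows that a skew matrix paired with the symmetric
    moments equals its own negative.\<close>
  have "(\<Sum>i\<in>UNIV. \<Sum>j\<in>UNIV. ?A $ i $ j * m i j) = (\<Sum>j\<in>UNIV. \<Sum>i\<in>UNIV. ?A $ i $ j * m i j)" by (rule sum.swap)
  also have "\<dots> = (\<Sum>j\<in>UNIV. \<Sum>i\<in>UNIV. - (?A $ j $ i * m j i))"
  proof (intro sum.cong refl)
    fix i j
    have "?A $ i $ j = - ?A $ j $ i"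
      using arg_cong[OF transpose_asym_part[of C], of "\<lambda>M. M $ j $ i"] by (simp add: transpose_def)
    then show "?A $ i $ j * m i j = - (?A $ j $ i * m j i)" using 2[of i j] by simp
  qed
  finally have A0: "(\<Sum>i\<in>UNIV. \<Sum>j\<in>UNIV. ?A $ i $ j * m i j) = 0" by (simp add: sum_negf)
  have comp: "(M *v y) \<bullet> g1 y = (\<Sum>i\<in>UNIV. \<Sum>j\<in>UNIV. M $ i $ j * (y $ j * g1 y $ i))" for M y
    by (simp add: inner_vec_def matrix_vector_mult_def sum_distrib_right mult.assoc)
  have iM: "integrable gauss (\<lambda>y. (M *v y) \<bullet> g1 y)"
    and IM: "(\<integral>y. (M *v y) \<bullet> g1 y \<partial>gauss) = (\<Sum>i\<in>UNIV. \<Sum>j\<in>UNIV. M $ i $ j * m i j)" for M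
  proof -
    have igj: "integrable gauss (\<lambda>y. y $ j * g1 y $ i)" for i j by (intro ig continuous_intros)
    show "integrable gauss (\<lambda>y. (M *v y) \<bullet> g1 y)"
      unfolding comp by (intro Bochner_Integration.integrable_sum integrable_mult_right igj)
    show "(\<integral>y. (M *v y) \<bullet> g1 y \<partial>gauss) = (\<Sum>i\<in>UNIV. \<Sum>j\<in>UNIV. M $ i $ j * m i j)"
      unfolding comp m_def
      by (simp add: Bochner_Integration.integral_sum Bochner_Integration.integrable_sum integrable_mult_right igj)
  qed
  have ic: "integrable gauss (\<lambda>y. g1 y \<bullet> b)" for b
    unfolding inner_vec_def using ig[OF continuous_on_const] by (auto intro!: Bochner_Integration.integrable_sum simp: mult.commute)
  have iS: "integrable gauss (\<lambda>y. \<Sum>i\<in>UNIV. \<Sum>j\<in>UNIV. ?S $ i $ j * H1 y $ i $ j)"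
    by (intro Bochner_Integration.integrable_sum iH)
  have IS: "(\<integral>y. (\<Sum>i\<in>UNIV. \<Sum>j\<in>UNIV. ?S $ i $ j * H1 y $ i $ j) \<partial>gauss) = (\<Sum>i\<in>UNIV. \<Sum>j\<in>UNIV. ?S $ i $ j * m i j)"
  proof -
    have "integrable gauss (\<lambda>y. H1 y $ i $ j)" for i j using iH[of 1] by simp
    then show ?thesis
      by (simp add: Bochner_Integration.integral_sum Bochner_Integration.integrable_sum integrable_mult_right 1 m_def)
  qed
  have "coh \<xi> \<bullet> abs_gl2 (FP_adj C g Hs) = (\<integral>y. FP_adj C g Hs (y + \<xi>) \<partial>gauss)"
    by (rule coh_inner_shift[OF sq_int_test(2)[OF t]])
  also have "\<dots> = (\<integral>y. (\<Sum>i\<in>UNIV. \<Sum>j\<in>UNIV. ?S $ i $ j * H1 y $ i $ j) - (C *v y) \<bullet> g1 y + g1 y \<bullet> (- (C *v \<xi>)) \<partial>gauss)"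
    unfolding FP_adj_def g1_def H1_def
    by (simp add: matrix_vector_right_distrib inner_add_left inner_commute[of "g _"] algebra_simps)
  also have "\<dots> = (\<Sum>i\<in>UNIV. \<Sum>j\<in>UNIV. ?S $ i $ j * m i j) - (\<Sum>i\<in>UNIV. \<Sum>j\<in>UNIV. C $ i $ j * m i j)
      + (\<integral>y. g1 y \<bullet> (- (C *v \<xi>)) \<partial>gauss)"
    by (subst Bochner_Integration.integral_add[OF Bochner_Integration.integrable_diff[OF iS iM] ic],
        subst Bochner_Integration.integral_diff[OF iS iM]) (simp only: IS IM)
  also have "(\<Sum>i\<in>UNIV. \<Sum>j\<in>UNIV. C $ i $ j * m i j) = (\<Sum>i\<in>UNIV. \<Sum>j\<in>UNIV. ?S $ i $ j * m i j)"
  proof -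
    have "C $ i $ j = ?S $ i $ j + ?A $ i $ j" for i j using sym_plus_asym[of C] by (metis vector_add_component)
    then show ?thesis using A0 by (simp add: distrib_right sum.distrib)
  qed
  finally show ?thesis by (simp add: g1_def)
qed

text \<open>The translated equilibrium f_inf(x - xi(t)) with xi' = -C xi solves the equation
  exactly; this is its weak form, with the translation moved to the test function.\<close>

lemma coh_weak_derivative:
  assumes t: "test_fun \<phi> g Hs"
  shows "((\<lambda>s. coh (evol s \<eta>) \<bullet> abs_gl2 \<phi>) has_real_derivative coh (evol t \<eta>) \<bullet> abs_gl2 (FP_adj C g Hs)) (at t)"
proof -
  have d\<phi>: "(\<phi> has_derivative (\<lambda>h. g y \<bullet> h)) (at y)" for y by (rule test_fun_facts(1)[OF t])
  note c\<phi> = test_fun_facts(3)[OF t] and cg = test_fun_facts(4)[OF t]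
  have [measurable]: "\<phi> \<in> borel_measurable borel" "g \<in> borel_measurable borel"
    by (rule borel_measurable_continuous_onI[OF c\<phi>] borel_measurable_continuous_onI[OF cg])+
  have b\<phi>: "bounded {y. \<phi> y \<noteq> 0}" using t by (simp add: test_fun_def)
  obtain B where B: "0 \<le> B" "\<And>x. \<bar>\<phi> x\<bar> \<le> B" using continuous_bounded_support[OF c\<phi> b\<phi>] by auto
  obtain B' where B': "0 \<le> B'" "\<And>x. norm (g x) \<le> B'"
    using continuous_bounded_support[OF cg gradient_bounded_support[OF d\<phi> b\<phi>]] by auto
  have "compact ((\<lambda>s. gen (evol s \<eta>)) ` {t-1..t+1})"
    by (intro compact_continuous_image bounded_linear.continuous_on[OF _ continuous_on_evol])
       (use linear_gen in \<open>auto simp: linear_conv_bounded_linear\<close>)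
  from compact_imp_bounded[OF this] obtain M where "\<forall>y\<in>(\<lambda>s. gen (evol s \<eta>)) ` {t-1..t+1}. norm y \<le> M"
    unfolding bounded_iff ..
  then have M: "norm (gen (evol s \<eta>)) \<le> M" if "s \<in> {t-1..t+1}" for s using that by simp
  have "((\<lambda>s. \<integral>y. \<phi> (y + evol s \<eta>) \<partial>gauss) has_real_derivative (\<integral>y. g (y + evol t \<eta>) \<bullet> gen (evol t \<eta>) \<partial>gauss)) (at t)"
  proof (rule has_real_derivative_integral[where a="t-1" and b="t+1" and W="\<lambda>_. B' * M"])
    show "integrable gauss (\<lambda>y. \<phi> (y + evol s \<eta>))" for s
      by (rule gauss_integrable_bounded[where B=B]) (use B in auto)
    show "((\<lambda>s. \<phi> (y + evol s \<eta>)) has_real_derivative g (y + evol s \<eta>) \<bullet> gen (evol s \<eta>)) (at s)" for s y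
    proof -
      have "((\<lambda>s. y + evol s \<eta>) has_derivative (\<lambda>h. h *\<^sub>R gen (evol s \<eta>))) (at s)"
        using evol_has_vector_derivative[of \<eta> s] unfolding has_vector_derivative_def
        by (auto intro!: derivative_eq_intros)
      from has_derivative_compose[OF this d\<phi>]
      show ?thesis by (simp add: has_field_derivative_def mult_commute_abs)
    qed
    show "\<bar>g (y + evol s \<eta>) \<bullet> gen (evol s \<eta>)\<bar> \<le> B' * M" if "t - 1 < s" "s < t + 1" for s y
    proof -
      have "\<bar>g (y + evol s \<eta>) \<bullet> gen (evol s \<eta>)\<bar> \<le> norm (g (y + evol s \<eta>)) * norm (gen (evol s \<eta>))"
        by (rule Cauchy_Schwarz_ineq2)
      also have "\<dots> \<le> B' * M" using that by (intro mult_mono B' M) auto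
      finally show ?thesis .
    qed
  qed auto
  then show ?thesis unfolding coh_inner_shift[OF sq_int_test(1)[OF t]] coh_inner_FP_adj[OF t] gen_eq .
qed

end

lemma DERIV_transform_on:
  assumes "(f has_real_derivative d) (at x within S)" "x \<in> S" "\<And>y. y \<in> S \<Longrightarrow> g y = f y"
  shows "(g has_real_derivative d) (at x within S)"
  using assms has_derivative_transform[of x S g f] unfolding has_field_derivative_def by blast

lemma has_real_derivative_uniform_limit:
  fixes f f' :: "nat \<Rightarrow> real \<Rightarrow> real"
  assumes S: "convex S" "x \<in> S"
    and d: "\<And>n x. x \<in> S \<Longrightarrow> (f n has_real_derivative f' n x) (at x within S)"
    and u: "\<And>e. 0 < e \<Longrightarrow> \<forall>\<^sub>F n in sequentially. \<forall>x\<in>S. \<bar>f' n x - g' x\<bar> \<le> e"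
    and l: "\<And>x. x \<in> S \<Longrightarrow> (\<lambda>n. f n x) \<longlonglongrightarrow> g x"
  shows "(g has_real_derivative g' x) (at x within S)"
proof -
  have "\<exists>h. \<forall>x\<in>S. (\<lambda>n. f n x) \<longlonglongrightarrow> h x \<and> (h has_derivative (\<lambda>k. g' x * k)) (at x within S)"
  proof (rule has_derivative_sequence[where f = f and f' = "\<lambda>n x k. f' n x * k" and g' = "\<lambda>x k. g' x * k"
        and ?x0.0 = x and l = "g x"])
    show "convex S" "x \<in> S" "(\<lambda>n. f n x) \<longlonglongrightarrow> g x" using S l[OF S(2)] by auto
    show "(f n has_derivative (\<lambda>k. f' n x * k)) (at x within S)" if "x \<in> S" for n x
      using d[OF that, of n] by (simp add: has_field_derivative_def)
    fix e :: real assume "0 < e"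
    from u[OF this] show "\<forall>\<^sub>F n in sequentially. \<forall>x\<in>S. \<forall>h. norm (f' n x * h - g' x * h) \<le> e * norm h"
    proof eventually_elim
      case (elim n)
      then show ?case by (auto simp flip: left_diff_distrib simp: abs_mult intro: mult_right_mono)
    qed
  qed
  then obtain h where h: "\<And>x. x \<in> S \<Longrightarrow> (\<lambda>n. f n x) \<longlonglongrightarrow> h x"
    "\<And>x. x \<in> S \<Longrightarrow> (h has_real_derivative g' x) (at x within S)"
    by (auto simp: has_field_derivative_def)
  have "h x = g x" if "x \<in> S" for x using LIMSEQ_unique[OF h(1)[OF that] l[OF that]] .
  then show ?thesis by (intro DERIV_transform_on[OF h(2)[OF S(2)] S(2)]) simp
qed

context fokker_planck
begin

text \<open>Coherent vectors give the explicit solutions. For limits of data, contractivity makes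
  the derivatives converge uniformly in time, so differentiation passes to the limit.\<close>

lemma U_weak_derivative:
  assumes t: "test_fun \<phi> g Hs" and t0: "0 \<le> t"
  shows "((\<lambda>s. U s h \<bullet> abs_gl2 \<phi>) has_real_derivative U t h \<bullet> abs_gl2 (FP_adj C g Hs)) (at t within {0..})"
proof -
  let ?f = "abs_gl2 \<phi>" and ?p = "abs_gl2 (FP_adj C g Hs)"
  have "\<forall>t\<ge>0. ((\<lambda>s. U s h \<bullet> ?f) has_real_derivative U t h \<bullet> ?p) (at t within {0..})"
  proof (induction h rule: U_closed_induct)
    case (1 \<eta>)
    show ?case
    proof (intro allI impI)
      fix t :: real assume "0 \<le> t"
      show "((\<lambda>s. U s (coh \<eta>) \<bullet> ?f) has_real_derivative U t (coh \<eta>) \<bullet> ?p) (at t within {0..})"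
        by (rule DERIV_cong[OF DERIV_transform_on[OF has_field_derivative_at_within[OF coh_weak_derivative[OF assms(1), of \<eta>]]]])
           (use \<open>0 \<le> t\<close> in \<open>auto simp: U_coh\<close>)
    qed
  next
    case 2
    show ?case
    proof (intro allI impI)
      fix t :: real assume "0 \<le> t"
      show "((\<lambda>s. U s 0 \<bullet> ?f) has_real_derivative U t 0 \<bullet> ?p) (at t within {0..})"
        by (rule DERIV_cong[OF DERIV_transform_on[OF DERIV_const[of 0]]])
           (use \<open>0 \<le> t\<close> in \<open>auto simp: U_zero_vec\<close>)
    qed
  next
    case (3 g' h)
    show ?case
    proof (intro allI impI)
      fix t :: real assume "0 \<le> t"
      show "((\<lambda>s. U s (g' + h) \<bullet> ?f) has_real_derivative U t (g' + h) \<bullet> ?p) (at t within {0..})"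
        by (rule DERIV_cong[OF DERIV_transform_on[OF DERIV_add[OF 3(1)[rule_format, OF \<open>0 \<le> t\<close>] 3(2)[rule_format, OF \<open>0 \<le> t\<close>]]]])
           (use \<open>0 \<le> t\<close> in \<open>auto simp: U_add inner_add_left\<close>)
    qed
  next
    case (4 c h)
    show ?case
    proof (intro allI impI)
      fix t :: real assume "0 \<le> t"
      show "((\<lambda>s. U s (c *\<^sub>R h) \<bullet> ?f) has_real_derivative U t (c *\<^sub>R h) \<bullet> ?p) (at t within {0..})"
        by (rule DERIV_cong[OF DERIV_transform_on[OF DERIV_cmult[OF 4[rule_format, OF \<open>0 \<le> t\<close>], of c]]])
           (use \<open>0 \<le> t\<close> in \<open>auto simp: U_scale\<close>)
    qed
  next
    case (5 H h)
    show ?case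
    proof (intro allI impI)
      fix t :: real assume "0 \<le> t"
      show "((\<lambda>s. U s h \<bullet> ?f) has_real_derivative U t h \<bullet> ?p) (at t within {0..})"
      proof (rule has_real_derivative_uniform_limit[where f = "\<lambda>n s. U s (H n) \<bullet> ?f" and f' = "\<lambda>n s. U s (H n) \<bullet> ?p"
            and g' = "\<lambda>s. U s h \<bullet> ?p"])
        have bd: "\<bar>U s (H n) \<bullet> k - U s h \<bullet> k\<bar> \<le> norm (H n - h) * norm k" if "0 \<le> s" for s n k
        proof -
          have "\<bar>U s (H n) \<bullet> k - U s h \<bullet> k\<bar> \<le> norm (U s (H n - h)) * norm k"
            using Cauchy_Schwarz_ineq2[of "U s (H n - h)" k] by (simp add: U_diff[OF that] inner_diff_left)
          also have "\<dots> \<le> norm (H n - h) * norm k" by (intro mult_right_mono norm_U that) simp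
          finally show ?thesis .
        qed
        have lim0: "(\<lambda>n. norm (H n - h) * norm k) \<longlonglongrightarrow> 0" for k :: "'n gl2"
          using tendsto_mult[OF tendsto_norm[OF LIM_zero[OF 5(2)]] tendsto_const[of "norm k"]] by simp
        fix e :: real assume "0 < e"
        with order_tendstoD(2)[OF lim0[of ?p]] have "\<forall>\<^sub>F n in sequentially. norm (H n - h) * norm ?p < e" by blast
        then show "\<forall>\<^sub>F n in sequentially. \<forall>s\<in>{0..}. \<bar>U s (H n) \<bullet> ?p - U s h \<bullet> ?p\<bar> \<le> e"
        proof eventually_elim
          case (elim n)
          show ?case
          proof
            fix s :: real assume "s \<in> {0..}"
            then have "0 \<le> s" by simp
            from bd[OF this, of n ?p] elim show "\<bar>U s (H n) \<bullet> ?p - U s h \<bullet> ?p\<bar> \<le> e" by linarith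
          qed
        qed
      next
        fix s :: real assume s: "s \<in> {0..}"
        have "(\<lambda>n. U s (H n)) \<longlonglongrightarrow> U s h"
        proof (rule LIM_zero_cancel, rule tendsto_norm_zero_cancel, rule tendsto_sandwich[OF _ _ tendsto_const])
          show "(\<lambda>n. norm (H n - h)) \<longlonglongrightarrow> 0" using tendsto_norm[OF LIM_zero[OF 5(2)]] by simp
          show "\<forall>\<^sub>F n in sequentially. norm (U s (H n) - U s h) \<le> norm (H n - h)"
            using norm_U[of s "H _ - h"] s by (intro always_eventually) (simp add: U_diff)
        qed auto
        then show "(\<lambda>n. U s (H n) \<bullet> ?f) \<longlonglongrightarrow> U s h \<bullet> ?f" by (intro tendsto_intros)
      qed (use 5(1) \<open>0 \<le> t\<close> in auto)
    qed
  qed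
  with t0 show ?thesis by blast
qed

lemma FP_solution_exists:
  assumes f0: "in_H f0" shows "FP_solution C f0 (\<lambda>t. ofL (U t (toL f0)))"
  unfolding FP_solution_def
proof (intro conjI allI impI)
  show "in_H (ofL (U t (toL f0)))" for t by (rule in_H_ofL)
  show "H_norm (\<lambda>x. ofL (U 0 (toL f0)) x - f0 x) = 0"
    by (simp add: H_norm_diff in_H_ofL f0 toL_ofL U_0)
next
  fix t :: real assume "0 \<le> t"
  then have "((\<lambda>s. U s (toL f0)) \<longlongrightarrow> U t (toL f0)) (at t within {0..})"
    using U_continuous[of "toL f0"] by (auto simp: continuous_on_def)
  from tendsto_norm[OF LIM_zero[OF this]]
  show "((\<lambda>s. H_norm (\<lambda>x. ofL (U s (toL f0)) x - ofL (U t (toL f0)) x)) \<longlongrightarrow> 0) (at t within {0..})"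
    by (simp add: H_norm_diff in_H_ofL toL_ofL)
next
  fix \<phi> :: "real^'n \<Rightarrow> real" and g Hs and t :: real assume t: "test_fun \<phi> g Hs" "0 \<le> t"
  from U_weak_derivative[OF this, of "toL f0"]
  show "((\<lambda>s. \<integral>x. ofL (U s (toL f0)) x * \<phi> x \<partial>lborel) has_real_derivative
           (\<integral>x. ofL (U t (toL f0)) x * FP_adj C g Hs x \<partial>lborel)) (at t within {0..})"
    by (simp add: integral_eq_inner_toL in_H_ofL toL_ofL sq_int_test[OF t(1)])
qed

end

subsection \<open>Uniqueness of weak solutions\<close>

lemma norm_abs_gl2_mono:
  assumes "sq_int f" "sq_int g" "\<And>x. \<bar>f x\<bar> \<le> \<bar>g x\<bar>"
  shows "norm (abs_gl2 f) \<le> norm (abs_gl2 g)"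
proof -
  have "(\<integral>x. (f x)\<^sup>2 \<partial>gauss) \<le> (\<integral>x. (g x)\<^sup>2 \<partial>gauss)"
    using assms by (intro integral_mono) (auto simp: sq_int_def abs_le_square_iff)
  then show ?thesis using assms by (simp add: norm_abs_gl2)
qed

lemma gl2_dominated_convergence:
  fixes f :: "nat \<Rightarrow> real^'n \<Rightarrow> real"
  assumes w: "sq_int w" and m: "\<And>n. f n \<in> borel_measurable borel"
    and b: "\<And>n x. \<bar>f n x\<bar> \<le> \<bar>w x\<bar>" and l: "\<And>x. (\<lambda>n. f n x) \<longlonglongrightarrow> g x"
  shows "sq_int g" "(\<lambda>n. abs_gl2 (f n)) \<longlonglongrightarrow> abs_gl2 g"
proof -
  have f: "sq_int (f n)" for n by (rule sq_int_bound[OF w m b])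
  have bg: "\<bar>g x\<bar> \<le> \<bar>w x\<bar>" for x
    by (rule LIMSEQ_le_const2[OF tendsto_rabs[OF l]]) (use b in auto)
  have mg: "g \<in> borel_measurable borel" by (rule borel_measurable_LIMSEQ_real[OF l m])
  show g: "sq_int g" by (rule sq_int_bound[OF w mg bg])
  have "(\<lambda>n. \<integral>x. (f n x - g x)\<^sup>2 \<partial>gauss) \<longlonglongrightarrow> (\<integral>x. 0 \<partial>(gauss :: (real^'n) measure))"
  proof (rule integral_dominated_convergence[where w = "\<lambda>x. 4 * (w x)\<^sup>2"])
    show "integrable gauss (\<lambda>x. 4 * (w x)\<^sup>2)" using w by (simp add: sq_int_def)
    show "(\<lambda>x. (f n x - g x)\<^sup>2) \<in> borel_measurable gauss" for n using m[of n] mg by measurable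
    show "AE x in gauss. norm ((f n x - g x)\<^sup>2) \<le> 4 * (w x)\<^sup>2" for n
    proof (rule AE_I2)
      fix x
      have "\<bar>f n x - g x\<bar> \<le> 2 * \<bar>w x\<bar>" using b[of n x] bg[of x] by linarith
      from power_mono[OF this abs_ge_zero, of 2] show "norm ((f n x - g x)\<^sup>2) \<le> 4 * (w x)\<^sup>2"
        by (simp add: power_mult_distrib)
    qed
    have "(\<lambda>n. (f n x - g x)\<^sup>2) \<longlonglongrightarrow> (g x - g x)\<^sup>2" for x by (intro tendsto_intros l)
    then show "AE x in gauss. (\<lambda>n. (f n x - g x)\<^sup>2) \<longlonglongrightarrow> 0" by simp
  qed simp
  from tendsto_real_sqrt[OF this]
  have "(\<lambda>n. norm (abs_gl2 (f n) - abs_gl2 g)) \<longlonglongrightarrow> 0"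
    by (simp add: diff_abs_gl2 f g norm_abs_gl2 sq_int_diff)
  then show "(\<lambda>n. abs_gl2 (f n)) \<longlonglongrightarrow> abs_gl2 g" by (rule LIM_zero_cancel[OF tendsto_norm_zero_cancel])
qed

lemma sq_int_exp_bound:
  fixes p :: "real^'n \<Rightarrow> real"
  assumes "p \<in> borel_measurable borel" "\<And>x. \<bar>p x\<bar> \<le> K * exp (a * norm x)"
  shows "sq_int p"
proof (rule sq_int_bound[OF sq_int_scale[OF sq_int_exp_norm[of a], of K] assms(1)])
  fix x :: "real^'n"
  have "\<bar>p x\<bar> \<le> \<bar>K\<bar> * exp (a * norm x)"
    using assms(2)[of x] mult_right_mono[OF abs_ge_self[of K] exp_ge_zero[of "a * norm x"]] by linarith
  also have "\<dots> \<le> \<bar>K\<bar> * exp (a * norm x + (norm x)\<^sup>2 / 8)" by (intro mult_left_mono) auto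
  finally show "\<bar>p x\<bar> \<le> \<bar>K * exp (a * norm x + (norm x)\<^sup>2 / 8)\<bar>" by (simp add: abs_mult)
qed

text \<open>The directional derivative of \<open>coh\<close> at xi along b.\<close>

definition dcoh :: "real^'n \<Rightarrow> real^'n \<Rightarrow> 'n gl2" where
  "dcoh \<xi> b = abs_gl2 (\<lambda>x. (b \<bullet> x - b \<bullet> \<xi>) * exp (\<xi> \<bullet> x - (norm \<xi>)\<^sup>2 / 2))"

lemma dcoh_bound:
  assumes "norm \<xi> \<le> B" "norm b \<le> B"
  shows "\<bar>(b \<bullet> x - b \<bullet> \<xi>) * exp (\<xi> \<bullet> x - (norm \<xi>)\<^sup>2 / 2)\<bar> \<le> (B + B\<^sup>2) * exp ((B + 1) * norm x)"
proof -
  have B: "0 \<le> B" using assms(1) norm_ge_zero order_trans by blast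
  have "\<bar>b \<bullet> x\<bar> \<le> B * norm x" "\<bar>b \<bullet> \<xi>\<bar> \<le> B * B" "\<xi> \<bullet> x \<le> B * norm x"
    using Cauchy_Schwarz_ineq2[of b x] Cauchy_Schwarz_ineq2[of b \<xi>] norm_cauchy_schwarz[of \<xi> x]
      mult_right_mono[OF assms(2), of "norm x"] mult_mono[OF assms(2,1)] mult_right_mono[OF assms(1), of "norm x"] B
    by auto
  note c = this
  have e: "1 \<le> exp (norm x)" "norm x \<le> exp (norm x)" using exp_ge_add_one_self[of "norm x"] norm_ge_zero[of x] by linarith+
  have "\<bar>b \<bullet> x - b \<bullet> \<xi>\<bar> \<le> B * norm x + B\<^sup>2 * 1" using c by (simp add: power2_eq_square)
  also have "\<dots> \<le> B * exp (norm x) + B\<^sup>2 * exp (norm x)" using e B by (intro add_mono mult_left_mono) auto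
  finally have 1: "\<bar>b \<bullet> x - b \<bullet> \<xi>\<bar> \<le> (B + B\<^sup>2) * exp (norm x)" by (simp add: algebra_simps)
  have "exp (\<xi> \<bullet> x - (norm \<xi>)\<^sup>2 / 2) \<le> exp (B * norm x)"
    unfolding exp_le_cancel_iff using c(3) zero_le_power2[of "norm \<xi>"] by linarith
  then have "\<bar>b \<bullet> x - b \<bullet> \<xi>\<bar> * exp (\<xi> \<bullet> x - (norm \<xi>)\<^sup>2 / 2) \<le> ((B + B\<^sup>2) * exp (norm x)) * exp (B * norm x)"
    using 1 B by (intro mult_mono) auto
  also have "\<dots> = (B + B\<^sup>2) * exp ((B + 1) * norm x)" by (simp add: algebra_simps exp_add)
  finally show ?thesis by (simp add: abs_mult)
qed

lemma sq_int_dcoh: "sq_int (\<lambda>x. (b \<bullet> x - b \<bullet> \<xi>) * exp (\<xi> \<bullet> x - (norm \<xi>)\<^sup>2 / 2))"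
  by (rule sq_int_exp_bound[OF _ dcoh_bound[of \<xi> "max (norm \<xi>) (norm b)" b]]) auto

lemma dcoh_uminus: "dcoh \<xi> (- b) = - dcoh \<xi> b"
  using scaleR_abs_gl2[OF sq_int_dcoh[of b \<xi>], of "-1"] by (simp add: dcoh_def algebra_simps)

lemma coh_curve_derivative:
  assumes s: "a < s" "s < b"
    and \<gamma>: "\<And>s. a < s \<Longrightarrow> s < b \<Longrightarrow> (\<gamma> has_vector_derivative \<gamma>' s) (at s)"
    and B: "\<And>s. a < s \<Longrightarrow> s < b \<Longrightarrow> norm (\<gamma> s) \<le> B" "\<And>s. a < s \<Longrightarrow> s < b \<Longrightarrow> norm (\<gamma>' s) \<le> B"
  shows "((\<lambda>s. w \<bullet> coh (\<gamma> s)) has_real_derivative w \<bullet> dcoh (\<gamma> s) (\<gamma>' s)) (at s)"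
proof -
  obtain f where f: "sq_int f" "w = abs_gl2 f" by (rule gl2_cases)
  have e1: "w \<bullet> coh \<xi> = (\<integral>x. f x * exp (\<xi> \<bullet> x - (norm \<xi>)\<^sup>2 / 2) \<partial>gauss)" for \<xi>
    unfolding f(2) coh_def by (rule inner_abs_gl2[OF f(1) sq_int_coh])
  have e2: "w \<bullet> dcoh \<xi> c = (\<integral>x. f x * ((c \<bullet> x - c \<bullet> \<xi>) * exp (\<xi> \<bullet> x - (norm \<xi>)\<^sup>2 / 2)) \<partial>gauss)" for \<xi> c
    unfolding f(2) dcoh_def by (rule inner_abs_gl2[OF f(1) sq_int_dcoh])
  have sw: "sq_int (\<lambda>x::real^'a. (B + B\<^sup>2) * exp ((B + 1) * norm x))"
  proof (rule sq_int_exp_bound[where K="\<bar>B + B\<^sup>2\<bar>" and a="B+1"])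
  qed (auto simp: abs_mult)
  show ?thesis unfolding e1 e2
  proof (rule has_real_derivative_integral[OF s, where W="\<lambda>x. \<bar>f x * ((B + B\<^sup>2) * exp ((B + 1) * norm x))\<bar>"])
    show "integrable gauss (\<lambda>x. f x * exp (\<gamma> t \<bullet> x - (norm (\<gamma> t))\<^sup>2 / 2))" for t
      by (rule sq_int_mult[OF f(1) sq_int_coh])
    show "integrable gauss (\<lambda>x. \<bar>f x * ((B + B\<^sup>2) * exp ((B + 1) * norm x))\<bar>)"
      by (rule integrable_abs[OF sq_int_mult[OF f(1) sw]])
    fix t x assume t: "a < t" "t < b"
    have d: "((\<lambda>s. \<gamma> s \<bullet> x - (norm (\<gamma> s))\<^sup>2 / 2) has_real_derivative \<gamma>' t \<bullet> x - \<gamma>' t \<bullet> \<gamma> t) (at t)"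
    proof -
      have g: "(\<gamma> has_derivative (\<lambda>h. h *\<^sub>R \<gamma>' t)) (at t)" using \<gamma>[OF t] by (simp add: has_vector_derivative_def)
      have D: "((\<lambda>s. \<gamma> s \<bullet> x - (1 / 2) * (\<gamma> s \<bullet> \<gamma> s)) has_derivative
          (\<lambda>h. (h *\<^sub>R \<gamma>' t) \<bullet> x - (1 / 2) * (\<gamma> t \<bullet> (h *\<^sub>R \<gamma>' t) + (h *\<^sub>R \<gamma>' t) \<bullet> \<gamma> t))) (at t)"
        by (intro has_derivative_diff has_derivative_inner_left has_derivative_mult_right has_derivative_inner g)
      have e: "(\<lambda>s. \<gamma> s \<bullet> x - (norm (\<gamma> s))\<^sup>2 / 2) = (\<lambda>s. \<gamma> s \<bullet> x - (1 / 2) * (\<gamma> s \<bullet> \<gamma> s))"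
        by (simp add: power2_norm_eq_inner)
      show ?thesis unfolding has_field_derivative_def e
        by (rule has_derivative_eq_rhs[OF D]) (auto simp: fun_eq_iff inner_commute algebra_simps)
    qed
    show "((\<lambda>s. f x * exp (\<gamma> s \<bullet> x - (norm (\<gamma> s))\<^sup>2 / 2)) has_real_derivative
        f x * ((\<gamma>' t \<bullet> x - \<gamma>' t \<bullet> \<gamma> t) * exp (\<gamma> t \<bullet> x - (norm (\<gamma> t))\<^sup>2 / 2))) (at t)"
      using DERIV_cmult[OF DERIV_fun_exp[OF d], of "f x"] by (simp add: mult_ac)
    show "\<bar>f x * ((\<gamma>' t \<bullet> x - \<gamma>' t \<bullet> \<gamma> t) * exp (\<gamma> t \<bullet> x - (norm (\<gamma> t))\<^sup>2 / 2))\<bar>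
        \<le> \<bar>f x * ((B + B\<^sup>2) * exp ((B + 1) * norm x))\<bar>"
      unfolding abs_mult[of "f x"]
      by (rule mult_left_mono[OF order_trans[OF dcoh_bound[OF B(1)[OF t] B(2)[OF t]] abs_ge_self]]) simp
  qed
qed

text \<open>Pairing with the difference of the two coherent vectors itself and applying the mean
  value theorem turns weak differentiability with a bounded derivative into a Lipschitz bound in
  norm.\<close>

lemma coh_curve_lipschitz:
  assumes \<gamma>: "\<And>s. a < s \<Longrightarrow> s < b \<Longrightarrow> (\<gamma> has_vector_derivative \<gamma>' s) (at s)"
    and B: "\<And>s. a < s \<Longrightarrow> s < b \<Longrightarrow> norm (\<gamma> s) \<le> B" "\<And>s. a < s \<Longrightarrow> s < b \<Longrightarrow> norm (\<gamma>' s) \<le> B"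
  obtains K where "\<And>s t. a < s \<Longrightarrow> s < b \<Longrightarrow> a < t \<Longrightarrow> t < b \<Longrightarrow> norm (coh (\<gamma> s) - coh (\<gamma> t)) \<le> K * \<bar>s - t\<bar>"
proof -
  have sw: "sq_int (\<lambda>x::real^'a. (B + B\<^sup>2) * exp ((B + 1) * norm x))"
  proof (rule sq_int_exp_bound[where K="\<bar>B + B\<^sup>2\<bar>" and a="B+1"])
  qed (auto simp: abs_mult)
  define K where "K = norm (abs_gl2 (\<lambda>x::real^'a. (B + B\<^sup>2) * exp ((B + 1) * norm x)))"
  have d: "norm (dcoh (\<gamma> s) (\<gamma>' s)) \<le> K" if "a < s" "s < b" for s
    unfolding dcoh_def K_def
    by (rule norm_abs_gl2_mono[OF sq_int_dcoh sw]) (rule order_trans[OF dcoh_bound[OF B(1)[OF that] B(2)[OF that]] abs_ge_self])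
  have "norm (coh (\<gamma> s) - coh (\<gamma> t)) \<le> K * \<bar>s - t\<bar>" if st: "a < s" "s < b" "a < t" "t < b" for s t
  proof -
    let ?w = "coh (\<gamma> s) - coh (\<gamma> t)"
    have "norm (?w \<bullet> coh (\<gamma> s) - ?w \<bullet> coh (\<gamma> t)) \<le> (norm ?w * K) * norm (s - t)"
    proof (rule field_differentiable_bound[of "{a<..<b}" "\<lambda>s. ?w \<bullet> coh (\<gamma> s)" "\<lambda>s. ?w \<bullet> dcoh (\<gamma> s) (\<gamma>' s)"])
      show "((\<lambda>s. ?w \<bullet> coh (\<gamma> s)) has_real_derivative ?w \<bullet> dcoh (\<gamma> z) (\<gamma>' z)) (at z within {a<..<b})"
        if "z \<in> {a<..<b}" for z
        by (rule has_field_derivative_at_within[OF coh_curve_derivative[OF _ _ \<gamma> B]]) (use that in auto)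
      show "norm (?w \<bullet> dcoh (\<gamma> z) (\<gamma>' z)) \<le> norm ?w * K" if "z \<in> {a<..<b}" for z
        using Cauchy_Schwarz_ineq2[of ?w "dcoh (\<gamma> z) (\<gamma>' z)"] mult_left_mono[OF d[of z], of "norm ?w"] that by simp
    qed (use st in auto)
    then have "norm ?w * norm ?w \<le> norm ?w * (K * \<bar>s - t\<bar>)"
      by (simp add: inner_diff_right[symmetric] dot_square_norm power2_eq_square mult.assoc)
    then show ?thesis
    proof (cases "norm ?w = 0")
      case True
      have "0 \<le> K" by (simp add: K_def)
      then show ?thesis unfolding True by simp
    qed (use mult_le_cancel_left_pos[of "norm ?w"] in simp)
  qed
  with that show ?thesis by blast
qed

text \<open>Needed for the derivatives of the cutoff. The critical point is u = 0, where the
  difference quotient is at most |h|^k.\<close>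

lemma DERIV_pos_part_power:
  assumes "0 < k"
  shows "((\<lambda>u. max 0 u ^ Suc k) has_real_derivative real (Suc k) * max 0 u ^ k) (at u)"
proof -
  have z: "(0::real) ^ k = 0" using assms by simp
  consider "u < 0" | "u > 0" | "u = 0" by linarith
  then show ?thesis
  proof cases
    case 1
    have "((\<lambda>u. 0) has_real_derivative 0) (at u)" by simp
    from has_field_derivative_transform_within_open[OF this, of "{..<0}" "\<lambda>u. max 0 u ^ Suc k"] 1
    show ?thesis by (auto simp: max_def z)
  next
    case 2
    have "((\<lambda>u. u ^ Suc k) has_real_derivative real (Suc k) * u ^ k) (at u)"
      using DERIV_pow[of "Suc k" u] by simp
    from has_field_derivative_transform_within_open[OF this, of "{0<..}" "\<lambda>u. max 0 u ^ Suc k"] 2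
    show ?thesis by (auto simp: max_def)
  next
    case 3
    have "((\<lambda>h. max 0 h ^ Suc k / h) \<longlongrightarrow> 0) (at (0::real))"
    proof (rule tendsto_rabs_zero_cancel, rule tendsto_sandwich[OF _ _ tendsto_const])
      have "((\<lambda>h::real. \<bar>h\<bar> ^ k) \<longlongrightarrow> \<bar>0\<bar> ^ k) (at 0)" by (intro tendsto_intros)
      then show "((\<lambda>h::real. \<bar>h\<bar> ^ k) \<longlongrightarrow> 0) (at 0)" by (simp only: abs_zero z)
      show "\<forall>\<^sub>F h in at (0::real). \<bar>max 0 h ^ Suc k / h\<bar> \<le> \<bar>h\<bar> ^ k"
        by (intro always_eventually) (auto simp: max_def abs_mult power_abs)
    qed auto
    then show ?thesis using 3 unfolding has_field_derivative_iff by (simp add: z)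
  qed
qed

section \<open>The weak equation for coherent vectors and the method of characteristics\<close>

context fokker_planck
begin

text \<open>The weak equation with test vector \<open>f\<close>, where \<open>p\<close> stands for
  the adjoint of -L applied to \<open>f\<close>. Detached from test functions, the relation can be
  closed under limits of the pair.\<close>

definition weak_pair :: "(real \<Rightarrow> 'n gl2) \<Rightarrow> 'n gl2 \<Rightarrow> 'n gl2 \<Rightarrow> bool" where
  "weak_pair v f p \<longleftrightarrow> (\<forall>t\<ge>0. ((\<lambda>s. v s \<bullet> f) has_real_derivative v t \<bullet> p) (at t within {0..}))"

lemma weak_pair_limit:
  assumes v: "continuous_on {0..} v" and wp: "\<And>n. weak_pair v (F n) (P n)"
    and F: "F \<longlonglongrightarrow> f" and P: "P \<longlonglongrightarrow> p"
  shows "weak_pair v f p"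
  unfolding weak_pair_def
proof (intro allI impI)
  fix t :: real assume t: "0 \<le> t"
  \<comment> \<open>Derivatives converge uniformly only where \<open>v\<close> is bounded, hence the
    restriction to times up to t + 1; near t this does not change the filter.\<close>
  have "compact (v ` {0..t+1})" by (intro compact_continuous_image continuous_on_subset[OF v]) auto
  from compact_imp_bounded[OF this] obtain B where "\<forall>y\<in>v ` {0..t+1}. norm y \<le> B" unfolding bounded_iff ..
  then have B: "norm (v s) \<le> B" if "s \<in> {0..t+1}" for s using that by blast
  have "((\<lambda>s. v s \<bullet> f) has_real_derivative v t \<bullet> p) (at t within {0..t+1})"
  proof (rule has_real_derivative_uniform_limit[where f = "\<lambda>n s. v s \<bullet> F n" and f' = "\<lambda>n s. v s \<bullet> P n"
        and g' = "\<lambda>s. v s \<bullet> p"])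
    show "((\<lambda>s. v s \<bullet> F n) has_real_derivative v s \<bullet> P n) (at s within {0..t+1})" if "s \<in> {0..t+1}" for n s
      using wp[of n] that unfolding weak_pair_def by (auto intro: has_field_derivative_subset)
    have "(\<lambda>n. B * norm (P n - p)) \<longlonglongrightarrow> B * 0"
      by (intro tendsto_mult tendsto_const tendsto_norm_zero LIM_zero P)
    then have l0: "(\<lambda>n. B * norm (P n - p)) \<longlonglongrightarrow> 0" by simp
    fix e :: real assume "0 < e"
    from order_tendstoD(2)[OF l0 this]
    show "\<forall>\<^sub>F n in sequentially. \<forall>s\<in>{0..t+1}. \<bar>v s \<bullet> P n - v s \<bullet> p\<bar> \<le> e"
    proof eventually_elim
      case (elim n)
      show ?case
      proof
        fix s assume s: "s \<in> {0..t+1}"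
        have "\<bar>v s \<bullet> P n - v s \<bullet> p\<bar> \<le> norm (v s) * norm (P n - p)"
          unfolding inner_diff_right[symmetric] by (rule Cauchy_Schwarz_ineq2)
        also have "\<dots> \<le> B * norm (P n - p)" by (rule mult_right_mono[OF B[OF s]]) simp
        finally show "\<bar>v s \<bullet> P n - v s \<bullet> p\<bar> \<le> e" using elim by linarith
      qed
    qed
  qed (use t F in \<open>auto intro: tendsto_intros\<close>)
  moreover have "at t within {0..t+1} = at t within {0..}" by (rule at_within_nhd[of t "{..<t+1}"]) auto
  ultimately show "((\<lambda>s. v s \<bullet> f) has_real_derivative v t \<bullet> p) (at t within {0..})" by simp
qed

lemma bilinear_sum: "(\<Sum>i\<in>UNIV. \<Sum>j\<in>UNIV. M $ i $ j * (x $ i * y $ j)) = x \<bullet> (M *v y)" for M :: "real^'n^'n"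
  by (simp add: inner_vec_def matrix_vector_mult_def sum_distrib_left mult_ac)

text \<open>The cutoff \<open>(max 0 (1 - r |x|^2))^3\<close> is twice continuously differentiable and tends to 1 as \<open>r\<close> tends to 0.\<close>
lemma cutoff_test_fun:
  fixes r :: real and \<xi> :: "real^'n"
  assumes r: "0 < r"
  defines "s \<equiv> \<lambda>x. max 0 (1 - r * (x \<bullet> x))"
  defines "E \<equiv> \<lambda>x. exp (\<xi> \<bullet> x - (norm \<xi>)\<^sup>2 / 2)"
  defines "\<phi> \<equiv> \<lambda>x. s x ^ 3 * E x"
  defines "g \<equiv> \<lambda>x. E x *\<^sub>R ((- 6 * r * s x ^ 2) *\<^sub>R x + s x ^ 3 *\<^sub>R \<xi>)"
  defines "Hs \<equiv> \<lambda>x. \<chi> i j. E x * ((- 6 * r * s x ^ 2) * (x $ i * \<xi> $ j) + s x ^ 3 * (\<xi> $ i * \<xi> $ j)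
      + 24 * r\<^sup>2 * s x * (x $ i * x $ j) + (- 6 * r * s x ^ 2) * (if i = j then 1 else 0)
      + (- 6 * r * s x ^ 2) * (\<xi> $ i * x $ j))"
  shows "test_fun \<phi> g Hs"
    "FP_adj C g Hs x = E x * ((- 6 * r * s x ^ 2) * (x \<bullet> (sym_part C *v \<xi>) + (\<Sum>i\<in>UNIV. sym_part C $ i $ i)
        + \<xi> \<bullet> (sym_part C *v x) - (C *v x) \<bullet> x)
      + s x ^ 3 * (\<xi> \<bullet> (sym_part C *v \<xi>) - (C *v x) \<bullet> \<xi>) + 24 * r\<^sup>2 * s x * (x \<bullet> (sym_part C *v x)))"
proof -
  have ds: "((\<lambda>x. 1 - r * (x \<bullet> x)) has_derivative (\<lambda>h. - 2 * r * (x \<bullet> h))) (at x)" for x :: "real^'n"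
    by (auto intro!: derivative_eq_intros simp: inner_commute)
  have s3: "((\<lambda>x. s x ^ 3) has_derivative (\<lambda>h. (- 6 * r * s x ^ 2) * (x \<bullet> h))) (at x)" for x
    using has_derivative_compose[OF ds, of "\<lambda>u. max 0 u ^ 3" "(*) (3 * s x ^ 2)" x]
      DERIV_pos_part_power[of 2 "1 - r * (x \<bullet> x)"]
    by (simp add: s_def has_field_derivative_def eval_nat_numeral mult_ac)
  have s2: "((\<lambda>x. - 6 * r * s x ^ 2) has_derivative (\<lambda>h. (24 * r\<^sup>2 * s x) * (x \<bullet> h))) (at x)" for x
  proof -
    have "((\<lambda>x. s x ^ 2) has_derivative (\<lambda>h. (2 * s x) * (- 2 * r * (x \<bullet> h)))) (at x)"
      using has_derivative_compose[OF ds, of "\<lambda>u. max 0 u ^ 2" "(*) (2 * s x)" x]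
        DERIV_pos_part_power[of 1 "1 - r * (x \<bullet> x)"]
      by (simp add: s_def has_field_derivative_def eval_nat_numeral)
    from has_derivative_mult_right[OF this, of "- 6 * r"]
    show ?thesis by (rule has_derivative_eq_rhs) (auto simp: power2_eq_square)
  qed
  have dE: "(E has_derivative (\<lambda>h. (\<xi> \<bullet> h) * E x)) (at x)" for x
    unfolding E_def by (auto intro!: derivative_eq_intros)
  have d\<phi>: "(\<phi> has_derivative (\<lambda>h. g x \<bullet> h)) (at x)" for x
    unfolding \<phi>_def using has_derivative_mult[OF s3 dE]
    by (rule has_derivative_eq_rhs) (auto simp: g_def inner_add_left algebra_simps)
  have dg: "(g has_derivative (\<lambda>h. Hs x *v h)) (at x)" for x
  proof -
    have "(g has_derivative (\<lambda>h. E x *\<^sub>R (((- 6 * r * s x ^ 2) *\<^sub>R h + ((24 * r\<^sup>2 * s x) * (x \<bullet> h)) *\<^sub>R x)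
        + ((- 6 * r * s x ^ 2) * (x \<bullet> h)) *\<^sub>R \<xi>) + ((\<xi> \<bullet> h) * E x) *\<^sub>R ((- 6 * r * s x ^ 2) *\<^sub>R x + s x ^ 3 *\<^sub>R \<xi>))) (at x)"
      unfolding g_def
      by (intro has_derivative_scaleR dE has_derivative_add s2 has_derivative_ident has_derivative_scaleR_left s3)
    then show ?thesis
    proof (rule has_derivative_eq_rhs, intro ext, unfold vec_eq_iff, intro allI)
      fix h i
      have "(Hs x *v h) $ i = (\<Sum>j\<in>UNIV. E x * ((- 6 * r * s x ^ 2) * x $ i * (\<xi> $ j * h $ j) + s x ^ 3 * \<xi> $ i * (\<xi> $ j * h $ j)
          + 24 * r\<^sup>2 * s x * x $ i * (x $ j * h $ j) + (- 6 * r * s x ^ 2) * (if i = j then h $ j else 0)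
          + (- 6 * r * s x ^ 2) * \<xi> $ i * (x $ j * h $ j)))"
        unfolding matrix_vector_mult_def Hs_def by (auto intro!: sum.cong simp: algebra_simps)
      also have "\<dots> = E x * ((- 6 * r * s x ^ 2) * x $ i * (\<xi> \<bullet> h) + s x ^ 3 * \<xi> $ i * (\<xi> \<bullet> h)
          + 24 * r\<^sup>2 * s x * x $ i * (x \<bullet> h) + (- 6 * r * s x ^ 2) * h $ i
          + (- 6 * r * s x ^ 2) * \<xi> $ i * (x \<bullet> h))"
        unfolding inner_vec_def by (simp only: sum_distrib_left[symmetric] sum.distrib) simp
      finally show "(E x *\<^sub>R (((- 6 * r * s x ^ 2) *\<^sub>R h + ((24 * r\<^sup>2 * s x) * (x \<bullet> h)) *\<^sub>R x)
        + ((- 6 * r * s x ^ 2) * (x \<bullet> h)) *\<^sub>R \<xi>) + ((\<xi> \<bullet> h) * E x) *\<^sub>R ((- 6 * r * s x ^ 2) *\<^sub>R x + s x ^ 3 *\<^sub>R \<xi>)) $ i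
        = (Hs x *v h) $ i" by (simp add: algebra_simps)
    qed
  qed
  have cH: "continuous_on UNIV Hs"
    unfolding Hs_def E_def s_def
    by (intro continuous_on_vec_lambda continuous_intros)
  have "bounded {x. \<phi> x \<noteq> 0}"
    unfolding bounded_iff
  proof (intro exI[of _ "1 + 1 / r"] ballI)
    fix x assume "x \<in> {x. \<phi> x \<noteq> 0}"
    then have "1 - r * (x \<bullet> x) > 0" by (auto simp: \<phi>_def s_def max_def split: if_splits)
    then have "(norm x)\<^sup>2 \<le> 1 / r" using r by (simp add: dot_square_norm field_simps)
    moreover have "norm x \<le> 1 + (norm x)\<^sup>2" using zero_le_power2[of "norm x - 1"] norm_ge_zero[of x]
      by (simp add: power2_eq_square algebra_simps del: norm_ge_zero)
    ultimately show "norm x \<le> 1 + 1 / r" by linarith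
  qed
  then show "test_fun \<phi> g Hs" using d\<phi> dg cH by (simp add: test_fun_def)
  have "(\<Sum>i\<in>UNIV. \<Sum>j\<in>UNIV. sym_part C $ i $ j * Hs x $ i $ j)
      = (\<Sum>i\<in>UNIV. \<Sum>j\<in>UNIV. E x * ((- 6 * r * s x ^ 2) * (sym_part C $ i $ j * (x $ i * \<xi> $ j))
        + s x ^ 3 * (sym_part C $ i $ j * (\<xi> $ i * \<xi> $ j))
        + 24 * r\<^sup>2 * s x * (sym_part C $ i $ j * (x $ i * x $ j)) + (- 6 * r * s x ^ 2) * (if i = j then sym_part C $ i $ j else 0)
        + (- 6 * r * s x ^ 2) * (sym_part C $ i $ j * (\<xi> $ i * x $ j))))"
    unfolding Hs_def by (auto intro!: sum.cong simp: algebra_simps)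
  also have "\<dots> = E x * ((- 6 * r * s x ^ 2) * (x \<bullet> (sym_part C *v \<xi>)) + s x ^ 3 * (\<xi> \<bullet> (sym_part C *v \<xi>))
        + 24 * r\<^sup>2 * s x * (x \<bullet> (sym_part C *v x)) + (- 6 * r * s x ^ 2) * (\<Sum>i\<in>UNIV. sym_part C $ i $ i)
        + (- 6 * r * s x ^ 2) * (\<xi> \<bullet> (sym_part C *v x)))"
    by (simp only: sum_distrib_left[symmetric] sum.distrib bilinear_sum) simp
  finally show "FP_adj C g Hs x = E x * ((- 6 * r * s x ^ 2) * (x \<bullet> (sym_part C *v \<xi>) + (\<Sum>i\<in>UNIV. sym_part C $ i $ i)
        + \<xi> \<bullet> (sym_part C *v x) - (C *v x) \<bullet> x)
      + s x ^ 3 * (\<xi> \<bullet> (sym_part C *v \<xi>) - (C *v x) \<bullet> \<xi>) + 24 * r\<^sup>2 * s x * (x \<bullet> (sym_part C *v x)))"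
    unfolding FP_adj_def by (simp add: g_def inner_add_right algebra_simps)
qed

text \<open>Terms with derivatives of the cutoff carry a factor r and vanish in the limit, after
  which the adjoint acts on the exponential as multiplication by \<open>A2\<close>. That product is
  \<open>dcoh\<close> in direction -(transpose C) xi: the second-order operator in x has become a
  transport operator in xi.\<close>

lemma weak_pair_coh:
  assumes v: "continuous_on {0..} v"
    and wp: "\<And>\<phi> g Hs. test_fun \<phi> g Hs \<Longrightarrow> weak_pair v (abs_gl2 \<phi>) (abs_gl2 (FP_adj C g Hs))"
  shows "weak_pair v (coh \<xi>) (dcoh \<xi> (tr.gen \<xi>))"
proof -
  define r where "r n = 1 / real (Suc n)" for n
  define s where "s n x = max 0 (1 - r n * (x \<bullet> x))" for n and x :: "real^'n"
  define E where "E x = exp (\<xi> \<bullet> x - (norm \<xi>)\<^sup>2 / 2)" for x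
  define A1 where "A1 x = x \<bullet> (sym_part C *v \<xi>) + (\<Sum>i\<in>UNIV. sym_part C $ i $ i) + \<xi> \<bullet> (sym_part C *v x) - (C *v x) \<bullet> x" for x
  define A2 where "A2 x = \<xi> \<bullet> (sym_part C *v \<xi>) - (C *v x) \<bullet> \<xi>" for x
  define A3 where "A3 x = x \<bullet> (sym_part C *v x)" for x
  define \<phi> where "\<phi> n x = s n x ^ 3 * E x" for n x
  define \<psi> where "\<psi> n x = E x * ((- 6 * r n * s n x ^ 2) * A1 x + s n x ^ 3 * A2 x + 24 * (r n)\<^sup>2 * s n x * A3 x)" for n x
  have r: "0 < r n" "r n \<le> 1" for n by (simp_all add: r_def)
  have s: "0 \<le> s n x" "s n x \<le> 1" for n x using r(1)[of n] by (auto simp: s_def)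
  have rl: "r \<longlonglongrightarrow> 0" unfolding r_def by (rule LIMSEQ_Suc[OF lim_1_over_n])
  have sl: "(\<lambda>n. s n x) \<longlonglongrightarrow> 1" for x
  proof -
    have "(\<lambda>n. s n x) \<longlonglongrightarrow> max 0 (1 - 0 * (x \<bullet> x))" unfolding s_def by (intro tendsto_intros rl)
    then show ?thesis by simp
  qed
  have cont: "continuous_on UNIV E" "continuous_on UNIV A1" "continuous_on UNIV A2" "continuous_on UNIV A3" "continuous_on UNIV (s n)" for n
    unfolding E_def A1_def A2_def A3_def s_def
    by (intro continuous_intros matrix_vector_mult_linear_continuous_on)+
  have [measurable]: "E \<in> borel_measurable borel" "A1 \<in> borel_measurable borel" "A2 \<in> borel_measurable borel"
    "A3 \<in> borel_measurable borel" "s n \<in> borel_measurable borel" for n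
    by (rule borel_measurable_continuous_onI[OF cont(1)] borel_measurable_continuous_onI[OF cont(2)]
       borel_measurable_continuous_onI[OF cont(3)] borel_measurable_continuous_onI[OF cont(4)] borel_measurable_continuous_onI[OF cont(5)])+
  have sE: "sq_int E" unfolding E_def by (rule sq_int_coh)
  have wpn: "weak_pair v (abs_gl2 (\<phi> n)) (abs_gl2 (\<psi> n))" for n
  proof -
    note c = cutoff_test_fun[OF r(1)[of n], of \<xi>]
    from wp[OF c(1)] show ?thesis
      unfolding \<phi>_def \<psi>_def A1_def A2_def A3_def s_def E_def ext[OF c(2)] .
  qed
  have "(\<lambda>n. abs_gl2 (\<phi> n)) \<longlonglongrightarrow> abs_gl2 E"
  proof (rule gl2_dominated_convergence(2)[OF sE])
    show "\<phi> n \<in> borel_measurable borel" for n unfolding \<phi>_def by measurable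
    show "\<bar>\<phi> n x\<bar> \<le> \<bar>E x\<bar>" for n x
      using s[of n x] power_le_one[of "s n x" 3] by (simp add: \<phi>_def abs_mult mult_left_le_one_le)
    have "(\<lambda>n. \<phi> n x) \<longlonglongrightarrow> 1 ^ 3 * E x" for x unfolding \<phi>_def by (intro tendsto_intros sl)
    then show "(\<lambda>n. \<phi> n x) \<longlonglongrightarrow> E x" for x by simp
  qed
  then have l1: "(\<lambda>n. abs_gl2 (\<phi> n)) \<longlonglongrightarrow> coh \<xi>" by (simp add: coh_def E_def[abs_def])
  obtain k1 where k1: "0 \<le> k1" "\<And>x. norm (sym_part C *v x) \<le> k1 * norm x" using operator_bound[OF S] by blast
  obtain k2 where k2: "0 \<le> k2" "\<And>x. norm (C *v x) \<le> k2 * norm x"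
    using operator_bound[of "(*v) C"] by (auto simp: matrix_vector_mul_linear)
  \<comment> \<open>One majorant for all n, since the scalar factors r s^2, s^3 and r^2 s are at
    most 1.\<close>
  define w where "w x = E x * (6 * \<bar>A1 x\<bar> + \<bar>A2 x\<bar> + 24 * \<bar>A3 x\<bar>)" for x
  have sw: "sq_int w"
  proof (rule sq_int_exp_bound)
    show "w \<in> borel_measurable borel" unfolding w_def by measurable
    define K where "K = 6 * (k1 * norm \<xi> + \<bar>\<Sum>i\<in>UNIV. sym_part C $ i $ i\<bar> + norm \<xi> * k1 + k2)
        + (\<bar>\<xi> \<bullet> (sym_part C *v \<xi>)\<bar> + k2 * norm \<xi>) + 24 * k1"
    fix x :: "real^'n"
    let ?e = "exp (2 * norm x)"
    have e1: "1 \<le> ?e" by simp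
    have e2: "norm x \<le> ?e" using exp_ge_add_one_self[of "2 * norm x"] norm_ge_zero[of x] by linarith
    have e3: "norm x * norm x \<le> ?e" using abs_le_exp[of "norm x" 2] by (simp add: power2_eq_square)
    have i: "\<bar>y \<bullet> z\<bar> \<le> norm y * norm z" for y z :: "real^'n" by (rule Cauchy_Schwarz_ineq2)
    have b1: "\<bar>x \<bullet> (sym_part C *v \<xi>)\<bar> \<le> (k1 * norm \<xi>) * ?e"
      using order_trans[OF i mult_mono[OF e2 k1(2)]] by (simp add: mult.commute k1)
    have b2: "\<bar>\<xi> \<bullet> (sym_part C *v x)\<bar> \<le> (norm \<xi> * k1) * ?e"
      using order_trans[OF i mult_left_mono[OF order_trans[OF k1(2)[of x] mult_left_mono[OF e2 k1(1)]] norm_ge_zero[of \<xi>]]] by (simp add: mult_ac)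
    have b3: "\<bar>(C *v x) \<bullet> x\<bar> \<le> k2 * ?e"
    proof -
      have "\<bar>(C *v x) \<bullet> x\<bar> \<le> (k2 * norm x) * norm x" using order_trans[OF i mult_right_mono[OF k2(2)]] by simp
      also have "\<dots> \<le> k2 * ?e" using mult_left_mono[OF e3 k2(1)] by (simp add: mult.assoc)
      finally show ?thesis .
    qed
    have b4: "\<bar>(C *v x) \<bullet> \<xi>\<bar> \<le> (k2 * norm \<xi>) * ?e"
      using order_trans[OF i mult_right_mono[OF order_trans[OF k2(2)[of x] mult_left_mono[OF e2 k2(1)]] norm_ge_zero[of \<xi>]]] by (simp add: mult_ac)
    have b5: "\<bar>A3 x\<bar> \<le> k1 * ?e"
    proof -
      have "\<bar>A3 x\<bar> \<le> norm x * (k1 * norm x)" unfolding A3_def using order_trans[OF i mult_left_mono[OF k1(2)]] by simp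
      also have "\<dots> \<le> k1 * ?e" using mult_left_mono[OF e3 k1(1)] by (simp add: mult_ac)
      finally show ?thesis .
    qed
    have c: "\<bar>c\<bar> \<le> \<bar>c\<bar> * ?e" for c :: real using mult_left_mono[OF e1, of "\<bar>c\<bar>"] by simp
    have a1: "\<bar>A1 x\<bar> \<le> (k1 * norm \<xi> + \<bar>\<Sum>i\<in>UNIV. sym_part C $ i $ i\<bar> + norm \<xi> * k1 + k2) * ?e"
      using b1 b2 b3 c[of "\<Sum>i\<in>UNIV. sym_part C $ i $ i"] unfolding A1_def distrib_right by linarith
    have a2: "\<bar>A2 x\<bar> \<le> (\<bar>\<xi> \<bullet> (sym_part C *v \<xi>)\<bar> + k2 * norm \<xi>) * ?e"
      using b4 c[of "\<xi> \<bullet> (sym_part C *v \<xi>)"] unfolding A2_def distrib_right by linarith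
    have g: "6 * a + b + 24 * c \<le> (6 * p + q + 24 * r) * e" if "a \<le> p * e" "b \<le> q * e" "c \<le> r * e"
      for a b c p q r e :: real
    proof -
      have "6 * a + b + 24 * c \<le> 6 * (p * e) + q * e + 24 * (r * e)" using that by linarith
      then show ?thesis by (simp add: algebra_simps)
    qed
    have 1: "6 * \<bar>A1 x\<bar> + \<bar>A2 x\<bar> + 24 * \<bar>A3 x\<bar> \<le> K * ?e"
      unfolding K_def by (rule g[OF a1 a2 b5])
    have "E x \<le> exp (norm \<xi> * norm x)" unfolding E_def exp_le_cancel_iff
      using norm_cauchy_schwarz[of \<xi> x] zero_le_power2[of "norm \<xi>"] by linarith
    then have "w x \<le> exp (norm \<xi> * norm x) * (K * ?e)"
      unfolding w_def by (intro mult_mono 1) auto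
    moreover have "exp ((norm \<xi> + 2) * norm x) = exp (norm \<xi> * norm x) * ?e" by (simp add: distrib_right exp_add)
    ultimately have "w x \<le> K * exp ((norm \<xi> + 2) * norm x)" by (simp only: mult_ac)
    moreover have "0 \<le> w x" by (simp add: w_def E_def)
    ultimately show "\<bar>w x\<bar> \<le> K * exp ((norm \<xi> + 2) * norm x)" by linarith
  qed
  have "(\<lambda>n. abs_gl2 (\<psi> n)) \<longlonglongrightarrow> abs_gl2 (\<lambda>x. E x * A2 x)"
  proof (rule gl2_dominated_convergence(2)[OF sw])
    show "\<psi> n \<in> borel_measurable borel" for n unfolding \<psi>_def by measurable
    show "\<bar>\<psi> n x\<bar> \<le> \<bar>w x\<bar>" for n x
    proof -
      have "r n * s n x ^ 2 \<le> 1" "s n x ^ 3 \<le> 1" "(r n)\<^sup>2 * s n x \<le> 1"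
        using r[of n] s[of n x] by (auto intro!: mult_le_one power_le_one)
      moreover have "0 \<le> r n * s n x ^ 2" "0 \<le> s n x ^ 3" "0 \<le> (r n)\<^sup>2 * s n x" using r[of n] s[of n x] by auto
      ultimately have "\<bar>(r n * s n x ^ 2) * A1 x\<bar> \<le> \<bar>A1 x\<bar>" "\<bar>s n x ^ 3 * A2 x\<bar> \<le> \<bar>A2 x\<bar>" "\<bar>((r n)\<^sup>2 * s n x) * A3 x\<bar> \<le> \<bar>A3 x\<bar>"
        unfolding abs_mult by (auto intro!: mult_left_le_one_le)
      then have "\<bar>- 6 * ((r n * s n x ^ 2) * A1 x) + s n x ^ 3 * A2 x + 24 * (((r n)\<^sup>2 * s n x) * A3 x)\<bar>
          \<le> 6 * \<bar>A1 x\<bar> + \<bar>A2 x\<bar> + 24 * \<bar>A3 x\<bar>" by linarith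
      then have "\<bar>E x\<bar> * \<bar>- 6 * ((r n * s n x ^ 2) * A1 x) + s n x ^ 3 * A2 x + 24 * (((r n)\<^sup>2 * s n x) * A3 x)\<bar>
          \<le> \<bar>E x\<bar> * \<bar>6 * \<bar>A1 x\<bar> + \<bar>A2 x\<bar> + 24 * \<bar>A3 x\<bar>\<bar>" by (intro mult_left_mono) auto
      then show ?thesis unfolding \<psi>_def w_def abs_mult by (simp only: mult.assoc)
    qed
    have "(\<lambda>n. \<psi> n x) \<longlonglongrightarrow> E x * ((- 6 * 0 * 1 ^ 2) * A1 x + 1 ^ 3 * A2 x + 24 * 0\<^sup>2 * 1 * A3 x)" for x
      unfolding \<psi>_def by (intro tendsto_intros sl rl)
    then show "(\<lambda>n. \<psi> n x) \<longlonglongrightarrow> E x * A2 x" for x by simp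
  qed
  moreover have "E x * A2 x = (tr.gen \<xi> \<bullet> x - tr.gen \<xi> \<bullet> \<xi>) * exp (\<xi> \<bullet> x - (norm \<xi>)\<^sup>2 / 2)" for x
  proof -
    have "tr.gen \<xi> \<bullet> \<xi> = - (\<xi> \<bullet> (sym_part C *v \<xi>))" using tr.inner_gen[of \<xi>] by (simp add: tr.q_def inner_commute)
    moreover have "tr.gen \<xi> \<bullet> x = - ((C *v x) \<bullet> \<xi>)"
      unfolding tr_gen_eq using dot_lmul_matrix[of \<xi> C x] by (simp add: inner_commute)
    ultimately show ?thesis by (simp add: A2_def E_def)
  qed
  ultimately have l2: "(\<lambda>n. abs_gl2 (\<psi> n)) \<longlonglongrightarrow> dcoh \<xi> (tr.gen \<xi>)" by (simp add: dcoh_def)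
  show ?thesis by (rule weak_pair_limit[OF v wpn l1 l2])
qed

text \<open>Along the characteristic \<open>tr.evol (T - s) \<zeta>\<close> the transform \<open>v s \<bullet> coh\<close> of a weak solution is constant.\<close>
lemma weak_solution_eq_U:
  assumes v: "continuous_on {0..} v"
    and wp: "\<And>\<phi> g Hs. test_fun \<phi> g Hs \<Longrightarrow> weak_pair v (abs_gl2 \<phi>) (abs_gl2 (FP_adj C g Hs))"
    and T: "0 \<le> T"
  shows "v T = U T (v 0)"
proof (rule gl2_eqI)
  fix \<zeta>
  \<comment> \<open>The curve runs backwards: at time T it is at \<open>\<zeta>\<close>, where the
    pairing with \<open>v T\<close> is wanted, and at time 0 it is at the image of
    \<open>\<zeta>\<close> under the adjoint flow, as in \<open>U_inner\<close>.\<close>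
  define \<gamma> where "\<gamma> s = tr.evol (T - s) \<zeta>" for s
  define \<gamma>' where "\<gamma>' s = - tr.gen (\<gamma> s)" for s
  have d\<gamma>: "(\<gamma> has_vector_derivative \<gamma>' s) (at s)" for s
  proof -
    have "((\<lambda>s. T - s) has_vector_derivative - 1) (at s)" by (auto intro!: derivative_eq_intros)
    from vector_diff_chain_at[OF this, of "\<lambda>t. tr.evol t \<zeta>"] tr.evol_has_vector_derivative[of \<zeta> "T - s"]
    show ?thesis by (simp add: comp_def \<gamma>_def[abs_def] \<gamma>'_def)
  qed
  have c\<gamma>: "continuous_on UNIV \<gamma>"
    by (rule continuous_on_vector_derivative) (auto intro: has_vector_derivative_at_within[OF d\<gamma>])
  have c\<gamma>': "continuous_on UNIV \<gamma>'"
    unfolding \<gamma>'_def using tr.linear_gen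
    by (intro continuous_intros bounded_linear.continuous_on[OF _ c\<gamma>]) (simp add: linear_conv_bounded_linear)
  have "((\<lambda>s. v s \<bullet> coh (\<gamma> s)) has_real_derivative 0) (at s within {0..T})" if s: "s \<in> {0..T}" for s
  proof -
    have "compact ((\<lambda>s. max (norm (\<gamma> s)) (norm (\<gamma>' s))) ` {s-1..s+1})"
      by (intro compact_continuous_image continuous_intros continuous_on_subset[OF c\<gamma>] continuous_on_subset[OF c\<gamma>']) auto
    from compact_imp_bounded[OF this] obtain B where
      "\<forall>y\<in>(\<lambda>s. max (norm (\<gamma> s)) (norm (\<gamma>' s))) ` {s-1..s+1}. norm y \<le> B" unfolding bounded_iff ..
    then have M: "\<bar>max (norm (\<gamma> t)) (norm (\<gamma>' t))\<bar> \<le> B" if "t \<in> {s-1..s+1}" for t using that by simp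
    have B: "norm (\<gamma> t) \<le> B" "norm (\<gamma>' t) \<le> B" if "s - 1 < t" "t < s + 1" for t
      using abs_le_D1[OF M[of t]] that by auto
    obtain K where K: "\<And>t t'. s - 1 < t \<Longrightarrow> t < s + 1 \<Longrightarrow> s - 1 < t' \<Longrightarrow> t' < s + 1
        \<Longrightarrow> norm (coh (\<gamma> t) - coh (\<gamma> t')) \<le> K * \<bar>t - t'\<bar>"
      using coh_curve_lipschitz[OF d\<gamma> B] by blast
    let ?F = "at s within {0..T}"
    have 1: "((\<lambda>y. (v y \<bullet> coh (\<gamma> s) - v s \<bullet> coh (\<gamma> s)) / (y - s)) \<longlongrightarrow> v s \<bullet> dcoh (\<gamma> s) (tr.gen (\<gamma> s))) ?F"
    proof -
      have "((\<lambda>y. v y \<bullet> coh (\<gamma> s)) has_real_derivative v s \<bullet> dcoh (\<gamma> s) (tr.gen (\<gamma> s))) (at s within {0..})"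
        using weak_pair_coh[OF v wp, of "\<gamma> s"] s by (simp add: weak_pair_def)
      from has_field_derivative_subset[OF this, of "{0..T}"] show ?thesis by (simp add: has_field_derivative_iff)
    qed
    have 2: "((\<lambda>y. (v s \<bullet> coh (\<gamma> y) - v s \<bullet> coh (\<gamma> s)) / (y - s)) \<longlongrightarrow> v s \<bullet> dcoh (\<gamma> s) (\<gamma>' s)) ?F"
    proof -
      have "((\<lambda>y. v s \<bullet> coh (\<gamma> y)) has_real_derivative v s \<bullet> dcoh (\<gamma> s) (\<gamma>' s)) (at s)"
        by (rule coh_curve_derivative[of "s - 1" s "s + 1", OF _ _ d\<gamma> B]) auto
      from has_field_derivative_at_within[OF this, of "{0..T}"] show ?thesis by (simp add: has_field_derivative_iff)
    qed
    \<comment> \<open>\<open>v\<close> is differentiable only against fixed vectors, so the product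
      rule is assembled by hand; the mixed increment vanishes because \<open>v\<close> is continuous
      and the coherent curve is Lipschitz.\<close>
    have 3: "((\<lambda>y. ((v y - v s) \<bullet> (coh (\<gamma> y) - coh (\<gamma> s))) / (y - s)) \<longlongrightarrow> 0) ?F"
    proof (rule tendsto_rabs_zero_cancel, rule tendsto_sandwich[OF _ _ tendsto_const])
      have "(v \<longlongrightarrow> v s) ?F" using continuous_on_subset[OF v, of "{0..T}"] s by (auto simp: continuous_on_def)
      then have "((\<lambda>y. norm (v y - v s) * K) \<longlongrightarrow> 0 * K) ?F"
        by (intro tendsto_mult tendsto_const tendsto_norm_zero LIM_zero)
      then show "((\<lambda>y. norm (v y - v s) * K) \<longlongrightarrow> 0) ?F" by simp
      have "\<forall>\<^sub>F y in ?F. dist y s < 1" using eventually_at_ball[of 1 s "{0..T}"] by (auto simp: eventually_at dist_commute)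
      moreover have "\<forall>\<^sub>F y in ?F. y \<noteq> s" by (auto simp: eventually_at_filter)
      ultimately show "\<forall>\<^sub>F y in ?F. \<bar>((v y - v s) \<bullet> (coh (\<gamma> y) - coh (\<gamma> s))) / (y - s)\<bar> \<le> norm (v y - v s) * K"
      proof eventually_elim
        case (elim y)
        have "\<bar>(v y - v s) \<bullet> (coh (\<gamma> y) - coh (\<gamma> s))\<bar> \<le> norm (v y - v s) * norm (coh (\<gamma> y) - coh (\<gamma> s))"
          by (rule Cauchy_Schwarz_ineq2)
        also have "\<dots> \<le> norm (v y - v s) * (K * \<bar>y - s\<bar>)"
          using elim by (intro mult_left_mono K) (auto simp: dist_real_def)
        finally show ?case using elim by (simp add: divide_le_eq mult.assoc)
      qed
    qed auto
    have "((\<lambda>y. (v y \<bullet> coh (\<gamma> y) - v s \<bullet> coh (\<gamma> s)) / (y - s)) \<longlongrightarrow> 0) ?F"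
    proof -
      have "(v y \<bullet> coh (\<gamma> y) - v s \<bullet> coh (\<gamma> s)) / (y - s) = (v y \<bullet> coh (\<gamma> s) - v s \<bullet> coh (\<gamma> s)) / (y - s)
          + (v s \<bullet> coh (\<gamma> y) - v s \<bullet> coh (\<gamma> s)) / (y - s) + ((v y - v s) \<bullet> (coh (\<gamma> y) - coh (\<gamma> s))) / (y - s)" for y
        by (simp add: inner_diff_left inner_diff_right flip: add_divide_distrib)
      \<comment> \<open>The velocity of the characteristic is chosen to cancel the time derivative
        of \<open>v\<close>.\<close>
      moreover have "v s \<bullet> dcoh (\<gamma> s) (tr.gen (\<gamma> s)) + v s \<bullet> dcoh (\<gamma> s) (\<gamma>' s) + 0 = 0"
        by (simp add: \<gamma>'_def dcoh_uminus)
      ultimately show ?thesis using tendsto_add[OF tendsto_add[OF 1 2] 3] by (simp only:)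
    qed
    then show ?thesis by (simp add: has_field_derivative_iff)
  qed
  then obtain c where "\<And>s. s \<in> {0..T} \<Longrightarrow> v s \<bullet> coh (\<gamma> s) = c"
    using has_field_derivative_zero_constant[of "{0..T}" "\<lambda>s. v s \<bullet> coh (\<gamma> s)"] by auto
  from this[of T] this[of 0] have "v T \<bullet> coh (\<gamma> T) = v 0 \<bullet> coh (\<gamma> 0)" using T by simp
  then show "v T \<bullet> coh \<zeta> = U T (v 0) \<bullet> coh \<zeta>" by (simp add: U_inner[OF T] \<gamma>_def tr.evol_0)
qed

text \<open>Pins down \<open>FP_evol\<close>, which merely selects some solution: all solutions
  represent the same vector of the Gaussian space at every time.\<close>

lemma FP_solution_unique:
  assumes f0: "in_H f0" and u: "FP_solution C f0 u" and t: "0 \<le> t"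
  shows "in_H (u t)" "toL (u t) = U t (toL f0)"
proof -
  have H: "in_H (u t)" if "0 \<le> t" for t using u that by (simp add: FP_solution_def)
  show "in_H (u t)" by (rule H[OF t])
  have i: "toL (u 0) = toL f0"
    using u H_norm_diff[OF H[of 0] f0] by (simp add: FP_solution_def)
  have v: "continuous_on {0..} (\<lambda>s. toL (u s))"
    unfolding continuous_on_def
  proof
    fix t :: real assume t: "t \<in> {0..}"
    then have "((\<lambda>s. H_norm (\<lambda>x. u s x - u t x)) \<longlongrightarrow> 0) (at t within {0..})" using u by (simp add: FP_solution_def)
    moreover have "\<forall>\<^sub>F s in at t within {0..}. H_norm (\<lambda>x. u s x - u t x) = norm (toL (u s) - toL (u t))"
      unfolding eventually_at_filter by (rule always_eventually) (use t in \<open>auto intro: H_norm_diff H\<close>)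
    ultimately have "((\<lambda>s. norm (toL (u s) - toL (u t))) \<longlongrightarrow> 0) (at t within {0..})"
      by (rule Lim_transform_eventually)
    then show "((\<lambda>s. toL (u s)) \<longlongrightarrow> toL (u t)) (at t within {0..})"
      by (rule LIM_zero_cancel[OF tendsto_norm_zero_cancel])
  qed
  have "weak_pair (\<lambda>s. toL (u s)) (abs_gl2 \<phi>) (abs_gl2 (FP_adj C g Hs))" if tf: "test_fun \<phi> g Hs"
    for \<phi> :: "real^'n \<Rightarrow> real" and g Hs
    unfolding weak_pair_def
  proof (intro allI impI)
    fix t :: real assume t: "0 \<le> t"
    have "((\<lambda>s. \<integral>x. u s x * \<phi> x \<partial>lborel) has_real_derivative (\<integral>x. u t x * FP_adj C g Hs x \<partial>lborel)) (at t within {0..})"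
      using u tf t by (simp add: FP_solution_def)
    from DERIV_transform_on[OF this, of "\<lambda>s. toL (u s) \<bullet> abs_gl2 \<phi>"]
    show "((\<lambda>s. toL (u s) \<bullet> abs_gl2 \<phi>) has_real_derivative toL (u t) \<bullet> abs_gl2 (FP_adj C g Hs)) (at t within {0..})"
      using t by (simp add: integral_eq_inner_toL H sq_int_test[OF tf])
  qed
  from weak_solution_eq_U[OF v this t] show "toL (u t) = U t (toL f0)" by (simp add: i)
qed

end

subsection \<open>The propagator norm\<close>

text \<open>First-order comparison as \<tau> tends to 0, using exp u - 1 \<ge> u on the left and exp
  u - 1 \<le> u + u^2 for u in [0, 1] on the right.\<close>

lemma le_of_exp_bound:
  fixes a b K :: real
  assumes a: "0 \<le> a" and b: "0 < b" and K: "0 \<le> K"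
    and h: "\<And>\<tau>. 0 < \<tau> \<Longrightarrow> exp (\<tau> * a) - 1 \<le> K * (exp (\<tau> * b) - 1)"
  shows "a \<le> K * b"
proof (rule field_le_epsilon)
  fix e :: real assume e: "0 < e"
  \<comment> \<open>The first bound keeps \<tau> b in [0, 1]; the second makes the quadratic error
    at most \<open>e\<close>.\<close>
  define \<tau> where "\<tau> = min (1 / b) (e / (K * b\<^sup>2 + 1))"
  have p: "0 < K * b\<^sup>2 + 1" using K b by (simp add: add_nonneg_pos)
  have \<tau>: "0 < \<tau>" using b e p by (simp add: \<tau>_def)
  have "\<tau> \<le> 1 / b" by (simp add: \<tau>_def)
  then have tb: "0 \<le> \<tau> * b" "\<tau> * b \<le> 1" using b \<tau> by (simp_all add: field_simps)
  have "\<tau> * a \<le> exp (\<tau> * a) - 1" using exp_ge_add_one_self[of "\<tau> * a"] by linarith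
  also have "\<dots> \<le> K * (exp (\<tau> * b) - 1)" by (rule h[OF \<tau>])
  also have "\<dots> \<le> K * (\<tau> * b + (\<tau> * b)\<^sup>2)" using exp_bound[OF tb] K by (intro mult_left_mono) auto
  also have "\<dots> = \<tau> * (K * b + \<tau> * (K * b\<^sup>2))" by (simp add: power2_eq_square algebra_simps)
  finally have "a \<le> K * b + \<tau> * (K * b\<^sup>2)" using \<tau> by simp
  moreover have "\<tau> * (K * b\<^sup>2) \<le> e"
  proof -
    have "\<tau> \<le> e / (K * b\<^sup>2 + 1)" by (simp add: \<tau>_def)
    then have "\<tau> * (K * b\<^sup>2 + 1) \<le> e" using p by (simp add: pos_le_divide_eq)
    then show ?thesis using \<tau> by (simp add: distrib_left)
  qed
  ultimately show "a \<le> K * b + e" by linarith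
qed

context fokker_planck
begin

lemma H_norm_FP_evol:
  assumes f0: "in_H f0" and t: "0 \<le> t"
  shows "H_norm (\<lambda>x. FP_evol C t f0 x - Pi0 f0 x) = norm (U t (toL f0) - (toL f0 \<bullet> coh 0) *\<^sub>R coh 0)"
proof -
  have "FP_solution C f0 (SOME u. FP_solution C f0 u)"
    by (rule someI[of "FP_solution C f0", OF FP_solution_exists[OF f0]])
  from FP_solution_unique[OF f0 this t] show ?thesis
    by (simp add: FP_evol_def H_norm_diff in_H_Pi0 toL_Pi0[OF f0])
qed

text \<open>The supremum also runs over data with an equilibrium component;
  \<open>norm_Gam_perp\<close> covers them because it bounds the distance to the projection by the
  full norm of the data. The reverse bound compares squared norms and so passes through exponentials
  of squared lengths.\<close>

lemma FP_norm_eq_onorm: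
  assumes t: "0 \<le> t" shows "FP_norm_V0perp C t = onorm (evol t)"
proof -
  let ?R = "onorm (evol t)"
  let ?F = "{f. in_H f \<and> H_norm f \<noteq> 0} :: (real^'n \<Rightarrow> real) set"
  let ?r = "\<lambda>f0. H_norm (\<lambda>x. FP_evol C t f0 x - Pi0 f0 x) / H_norm f0"
  have bl: "bounded_linear (evol t)" using linear_evol by (simp add: linear_conv_bounded_linear)
  have R: "norm (evol t x) \<le> ?R * norm x" for x by (rule onorm[OF bl])
  have R0: "0 \<le> ?R" by (rule onorm_pos_le[OF bl])
  have R1: "?R \<le> 1" by (rule onorm_bound) (use norm_evol_le[OF t] in auto)
  have le: "?r f0 \<le> ?R" if "f0 \<in> ?F" for f0
  proof -
    have f0: "in_H f0" "norm (toL f0) > 0" using that by (auto simp: H_norm_eq)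
    have "norm (U t (toL f0) - (toL f0 \<bullet> coh 0) *\<^sub>R coh 0) \<le> ?R * norm (toL f0)"
      unfolding U_def by (rule norm_Gam_perp[OF linear_evol R R0 R1])
    then show ?thesis using f0 by (simp add: H_norm_FP_evol[OF f0(1) t] H_norm_eq divide_le_eq)
  qed
  have bdd: "bdd_above (?r ` ?F)" using le by (intro bdd_aboveI2) blast
  have mem: "ofL h \<in> ?F" if "h \<noteq> 0" for h using that by (simp add: in_H_ofL H_norm_eq toL_ofL)
  have "coh (0 :: real^'n) \<noteq> 0" using norm_coh_0[where 'a = 'n] by auto
  then have ne: "?F \<noteq> {}" using mem by blast
  show ?thesis
  proof (rule antisym)
    show "FP_norm_V0perp C t \<le> ?R"
      unfolding FP_norm_V0perp_def by (rule cSUP_least[OF ne le])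
    have N0: "0 \<le> FP_norm_V0perp C t"
    proof -
      obtain f where f: "f \<in> ?F" using ne by blast
      have "0 \<le> ?r f" using f by (simp add: H_norm_FP_evol[OF _ t] H_norm_eq)
      also have "\<dots> \<le> FP_norm_V0perp C t" unfolding FP_norm_V0perp_def by (rule cSUP_upper[OF f bdd])
      finally show ?thesis .
    qed
    show "?R \<le> FP_norm_V0perp C t"
    proof (rule onorm_bound[OF N0])
      fix x
      show "norm (evol t x) \<le> FP_norm_V0perp C t * norm x"
      proof (cases "x = 0")
        case False
        have "(norm (evol t x))\<^sup>2 \<le> (FP_norm_V0perp C t)\<^sup>2 * (norm x)\<^sup>2"
        proof (rule le_of_exp_bound)
          fix \<tau> :: real assume \<tau>: "0 < \<tau>"
          \<comment> \<open>This scaling makes |y|^2 linear in \<tau>, as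
            \<open>le_of_exp_bound\<close> requires.\<close>
          define y where "y = sqrt \<tau> *\<^sub>R x"
          define h where "h = coh y - coh 0"
          have sq: "(norm (coh z - coh 0))\<^sup>2 = exp ((norm z)\<^sup>2) - 1" for z :: "real^'n"
            unfolding power2_norm_eq_inner[of "coh z - coh 0"]
            by (simp add: inner_diff_left inner_diff_right inner_coh power2_norm_eq_inner)
          have ny: "(norm y)\<^sup>2 = \<tau> * (norm x)\<^sup>2" using \<tau> by (simp add: y_def power_mult_distrib)
          have nA: "(norm (evol t y))\<^sup>2 = \<tau> * (norm (evol t x))\<^sup>2"
            using \<tau> by (simp add: y_def linear_cmul[OF linear_evol] power_mult_distrib)
          have "(norm h)\<^sup>2 > 0" unfolding h_def sq ny using \<tau> False by simp
          then have h0: "h \<noteq> 0" by auto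
          have hc: "h \<bullet> coh 0 = 0" by (simp add: h_def inner_diff_left inner_coh)
          have Uh: "U t h = coh (evol t y) - coh 0"
            by (simp add: h_def U_diff[OF t] U_coh[OF t] linear_0[OF linear_evol])
          have "?r (ofL h) \<le> FP_norm_V0perp C t"
            unfolding FP_norm_V0perp_def by (rule cSUP_upper[OF mem[OF h0] bdd])
          then have "norm (coh (evol t y) - coh 0) / norm h \<le> FP_norm_V0perp C t"
            by (simp add: H_norm_FP_evol[OF in_H_ofL t] H_norm_eq in_H_ofL toL_ofL hc Uh)
          then have "norm (coh (evol t y) - coh 0) \<le> FP_norm_V0perp C t * norm h"
            using h0 by (simp add: divide_le_eq)
          from power_mono[OF this norm_ge_zero, of 2]
          show "exp (\<tau> * (norm (evol t x))\<^sup>2) - 1 \<le> (FP_norm_V0perp C t)\<^sup>2 * (exp (\<tau> * (norm x)\<^sup>2) - 1)"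
            unfolding power_mult_distrib h_def sq ny nA .
        qed (use False in auto)
        then have "(norm (evol t x))\<^sup>2 \<le> (FP_norm_V0perp C t * norm x)\<^sup>2" by (simp add: power_mult_distrib)
        then show ?thesis by (rule power2_le_imp_le) (use N0 in simp)
      qed (simp add: linear_0[OF linear_evol])
    qed
  qed
qed

subsection \<open>The hypocoercivity index\<close>

lemma mat_pow_mult: "mat_pow M j *v x = ((*v) M ^^ j) x" for M :: "real^'n^'n"
  by (induction j) (simp_all flip: matrix_vector_mul_assoc)

lemma funpow_neg_asym: "((*v) (- asym_part C) ^^ j) x = (- 1) ^ j *\<^sub>R ((*v) (asym_part C) ^^ j) x"
  by (induction j) (simp_all add: uminus_matrix_vector_mult matrix_vector_mult_scaleR linear_cmul[OF A])

lemma inner_mat_pow_asym: "x \<bullet> (mat_pow (asym_part C) j *v z) = ((*v) (- asym_part C) ^^ j) x \<bullet> z"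
proof (induction j arbitrary: x)
  case (Suc j)
  have "x \<bullet> (mat_pow (asym_part C) (Suc j) *v z) = (- asym_part C *v x) \<bullet> (mat_pow (asym_part C) j *v z)"
    using A_skew[of x "mat_pow (asym_part C) j *v z"]
    by (simp add: uminus_matrix_vector_mult flip: matrix_vector_mul_assoc)
  then show ?case by (simp add: Suc funpow_swap1)
qed simp

text \<open>The quadratic form of the sum is the sum of all q(A^j x): moving skew powers to the
  other side produces signs (-1)^j that occur twice and cancel. Such a sum of nonnegative terms
  vanishes only if each term does, and q y = 0 forces S y = 0.\<close>

lemma pos_def_iff_N:
  "pos_def (\<Sum>j\<le>m. mat_pow (asym_part C) j ** sym_part C ** mat_pow (transpose (asym_part C)) j)
    \<longleftrightarrow> N (Suc m) = {0}"
proof -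
  have sumv: "(\<Sum>j\<le>m. M j) *v x = (\<Sum>j\<le>m. M j *v x)" for M :: "nat \<Rightarrow> real^'n^'n" and x
    by (induction m) (simp_all add: matrix_vector_mult_add_rdistrib)
  have summand: "x \<bullet> ((mat_pow (asym_part C) j ** sym_part C ** mat_pow (transpose (asym_part C)) j) *v x)
      = q (((*v) (asym_part C) ^^ j) x)" for x j
  proof -
    have sg: "(- 1) ^ j * ((- 1) ^ j * y) = y" for y :: real
      by (simp flip: power_mult_distrib mult.assoc)
    have "x \<bullet> ((mat_pow (asym_part C) j ** sym_part C ** mat_pow (transpose (asym_part C)) j) *v x)
        = ((*v) (- asym_part C) ^^ j) x \<bullet> (sym_part C *v ((*v) (- asym_part C) ^^ j) x)"
      unfolding matrix_vector_mul_assoc[symmetric] inner_mat_pow_asym transpose_asym_part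
      unfolding mat_pow_mult ..
    then show ?thesis by (simp add: funpow_neg_asym q_def matrix_vector_mult_scaleR sg)
  qed
  have "x \<bullet> ((\<Sum>j\<le>m. mat_pow (asym_part C) j ** sym_part C ** mat_pow (transpose (asym_part C)) j) *v x)
      = (\<Sum>j\<le>m. q (((*v) (asym_part C) ^^ j) x))" for x
    unfolding sumv inner_sum_right summand ..
  moreover have "0 < (\<Sum>j\<le>m. q (((*v) (asym_part C) ^^ j) x)) \<longleftrightarrow> x \<notin> N (Suc m)" for x
  proof -
    have nn: "0 \<le> q y" for y by (simp add: q_def S_psd)
    have "(\<Sum>j\<le>m. q (((*v) (asym_part C) ^^ j) x)) = 0 \<longleftrightarrow> (\<forall>j\<le>m. q (((*v) (asym_part C) ^^ j) x) = 0)"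
      by (subst sum_nonneg_eq_0_iff) (auto simp: nn)
    also have "\<dots> \<longleftrightarrow> x \<in> N (Suc m)"
      using q_eq_0 by (auto simp: N_def less_Suc_eq_le q_def)
    finally show ?thesis using sum_nonneg[of "{..m}" "\<lambda>j. q (((*v) (asym_part C) ^^ j) x)"] nn by (auto simp: less_le)
  qed
  ultimately have "pos_def (\<Sum>j\<le>m. mat_pow (asym_part C) j ** sym_part C ** mat_pow (transpose (asym_part C)) j)
    \<longleftrightarrow> (\<forall>x. x \<noteq> 0 \<longrightarrow> x \<notin> N (Suc m))" by (simp add: pos_def_def)
  then show ?thesis using subspace_0[OF subspace_N[of "Suc m"]] by auto
qed

text \<open>Otherwise the unit spheres of the decreasing spaces \<open>N j\<close> are nested
  nonempty compact sets and share a vector. The intersection of all \<open>N j\<close> lies in the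
  kernel of the symmetric part, where the transpose of C acts as -A, and is therefore an invariant
  subspace excluded by Condition A.\<close>

lemma N_eventually_trivial:
  assumes "condition_A C" shows "\<exists>m. N (Suc m) = {0}"
proof (rule ccontr)
  assume no: "\<nexists>m. N (Suc m) = {0}"
  define V where "V = (\<Inter>j. N j)"
  define F where "F j = N j \<inter> sphere 0 1" for j
  have "\<Inter>(range F) \<noteq> {}"
  proof (rule compact_nest)
    fix j
    show "compact (F j)" unfolding F_def
      by (intro closed_Int_compact closed_subspace subspace_N compact_sphere)
    have "N j \<noteq> {0}"
    proof -
      have "N (Suc j) \<noteq> {0}" "N (Suc j) \<subseteq> N j" using no N_mono[of j "Suc j"] by auto
      then show ?thesis using subspace_0[OF subspace_N[of "Suc j"]] by blast
    qed
    then obtain x where "x \<in> N j" "x \<noteq> 0" using subspace_0[OF subspace_N[of j]] by blast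
    then have "(1 / norm x) *\<^sub>R x \<in> F j" by (simp add: F_def subspace_scale[OF subspace_N])
    then show "F j \<noteq> {}" by blast
  next
    show "F n \<subseteq> F m" if "m \<le> n" for m n using N_mono[OF that] by (auto simp: F_def)
  qed
  then obtain x where "x \<in> V" "norm x = 1" by (auto simp: F_def V_def)
  then have x: "x \<in> V" "x \<noteq> 0" by auto
  have V: "x \<in> V \<longleftrightarrow> (\<forall>i. sym_part C *v (((*v) (asym_part C) ^^ i) x) = 0)" for x
    by (auto simp: V_def N_def)
  have "V = {0}"
  proof -
    have "subspace V" unfolding V_def by (intro subspace_Inter) (auto simp: subspace_N)
    moreover have "V \<subseteq> {x. sym_part C *v x = 0}"
    proof
      fix x assume "x \<in> V"
      then have "sym_part C *v (((*v) (asym_part C) ^^ 0) x) = 0" using V by blast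
      then show "x \<in> {x. sym_part C *v x = 0}" by simp
    qed
    moreover have "transpose C *v v \<in> V" if v: "v \<in> V" for v
    proof -
      have 0: "sym_part C *v (((*v) (asym_part C) ^^ i) v) = 0" for i using v V by blast
      have "transpose C *v v = - (asym_part C *v v)"
        using 0[of 0] unfolding sym_minus_asym[of C, symmetric] by (simp add: matrix_vector_mult_diff_rdistrib)
      also have "\<dots> \<in> V"
      proof (rule subspace_neg[OF \<open>subspace V\<close>])
        have "sym_part C *v (((*v) (asym_part C) ^^ i) (asym_part C *v v)) = 0" for i
          using 0[of "Suc i"] by (simp add: funpow_swap1)
        then show "asym_part C *v v \<in> V" using V by blast
      qed
      finally show ?thesis .
    qed
    ultimately show ?thesis using assms unfolding condition_A_def by blast
  qed
  with x show False by blast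
qed

lemma hc_index_dissipative:
  assumes "condition_A C"
  shows "dissipative_index ((*v) (sym_part C)) ((*v) (asym_part C)) (hc_index C)"
proof unfold_locales
  let ?P = "\<lambda>m. pos_def (\<Sum>j\<le>m. mat_pow (asym_part C) j ** sym_part C ** mat_pow (transpose (asym_part C)) j)"
  have "\<exists>m. ?P m" using N_eventually_trivial[OF assms] pos_def_iff_N by blast
  then have "?P (hc_index C)" unfolding hc_index_def by (rule LeastI_ex)
  then show "N (Suc (hc_index C)) = {0}" by (simp only: pos_def_iff_N)
  show "N (hc_index C) \<noteq> {0}"
  proof (cases "hc_index C")
    case 0
    \<comment> \<open>For index 0 there is no smaller index to appeal to; \<open>N 0\<close> is
      nontrivial because the dimension is positive.\<close>
    obtain e :: "real^'n" where "norm e = 1" using vector_choose_size[of 1] by auto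
    then have "e \<noteq> 0" "e \<in> N 0" by (auto simp: N_0)
    then show ?thesis using 0 by auto
  next
    case (Suc k)
    then have "\<not> ?P k" unfolding hc_index_def by (intro not_less_Least) simp
    then show ?thesis by (simp only: pos_def_iff_N Suc not_False_eq_True)
  qed
qed

end

section \<open>Uniqueness of the leading exponent and the equivalence\<close>

lemma power_bigo_at_right_0:
  assumes "b \<le> a" shows "(\<lambda>t::real. t ^ a) \<in> O[at_right 0](\<lambda>t. t ^ b)"
proof (rule bigoI[where c=1])
  show "\<forall>\<^sub>F t in at_right (0::real). norm (t ^ a) \<le> 1 * norm (t ^ b)"
    unfolding eventually_at_right_field
    by (rule exI[of _ 1]) (auto simp: power_abs intro!: power_decreasing assms)
qed

text \<open>If m < n, both errors and d t^(2n+1) are O(t^(2m+2)), so subtracting the expansions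
  would make c t^(2m+1) of that order as well. Exchanging the two expansions gives equality.\<close>

lemma leading_exponent_unique:
  fixes f :: "real \<Rightarrow> real"
  assumes c: "0 < c" "(\<lambda>t. f t - (1 - c * t ^ (2*m+1))) \<in> O[at_right 0](\<lambda>t. t ^ (2*m+2))"
    and d: "0 < d" "(\<lambda>t. f t - (1 - d * t ^ (2*n+1))) \<in> O[at_right 0](\<lambda>t. t ^ (2*n+2))"
  shows "n \<le> m"
proof (rule ccontr)
  assume "\<not> n \<le> m"
  then have mn: "m < n" by simp
  let ?O = "O[at_right 0](\<lambda>t::real. t ^ (2*m+2))"
  have 1: "(\<lambda>t. f t - (1 - d * t ^ (2*n+1))) \<in> ?O"
    by (rule landau_o.big_trans[OF d(2) power_bigo_at_right_0]) (use mn in simp)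
  have "(\<lambda>t. d * t ^ (2*n+1)) \<in> ?O"
    using power_bigo_at_right_0[of "2*m+2" "2*n+1"] mn d(1) by simp
  from sum_in_bigo(1)[OF sum_in_bigo(2)[OF c(2) 1] this]
  have "(\<lambda>t. c * t ^ (2*m+1)) \<in> ?O" by (simp add: algebra_simps)
  then obtain K where "\<forall>\<^sub>F t in at_right (0::real). norm (c * t ^ (2*m+1)) \<le> K * norm (t ^ (2*m+2))"
    by (elim landau_o.bigE)
  then obtain b where b: "b > 0" "\<And>t. 0 < t \<Longrightarrow> t < b \<Longrightarrow> norm (c * t ^ (2*m+1)) \<le> K * norm (t ^ (2*m+2))"
    unfolding eventually_at_right_field by auto
  \<comment> \<open>Inside the range of the O-estimate, and so small that |K| t stays below
    \<open>c\<close>.\<close>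
  define t where "t = min (b / 2) (c / (2 * (\<bar>K\<bar> + 1)))"
  have t: "0 < t" "t < b" using b c by (auto simp: t_def)
  have "c * t ^ (2*m+1) \<le> (K * t) * t ^ (2*m+1)" using b(2)[OF t] t c by (simp add: abs_mult mult_ac)
  then have "c \<le> K * t" by (rule mult_right_le_imp_le) (use t in simp)
  also have "K * t \<le> \<bar>K\<bar> * t" using t by (intro mult_right_mono) auto
  also have "\<dots> < c"
  proof -
    have "t \<le> c / (2 * (\<bar>K\<bar> + 1))" by (simp add: t_def)
    then have "2 * ((\<bar>K\<bar> + 1) * t) \<le> c" by (simp add: field_simps)
    moreover have "\<bar>K\<bar> * t < (\<bar>K\<bar> + 1) * t" using t by simp
    moreover have "0 \<le> (\<bar>K\<bar> + 1) * t" using t by simp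
    ultimately show ?thesis by linarith
  qed
  finally show False by simp
qed

theorem theorem3p15:
  fixes C :: "real^'n^'n" and m :: nat
  assumes "condition_A C"
  shows "hc_index C = m \<longleftrightarrow>
    (\<exists>c>0. (\<lambda>t. FP_norm_V0perp C t - (1 - c * t ^ (2*m+1))) \<in> O[at_right 0](\<lambda>t. t ^ (2*m+2)))"
proof -
  interpret fokker_planck C by standard (use assms in \<open>simp add: condition_A_def\<close>)
  interpret dissipative_index "(*v) (sym_part C)" "(*v) (asym_part C)" "hc_index C"
    by (rule hc_index_dissipative[OF assms])
  obtain d where d: "0 < d"
    "(\<lambda>t. onorm (evol t) - (1 - d * t ^ (2 * hc_index C + 1))) \<in> O[at_right 0](\<lambda>t. t ^ (2 * hc_index C + 2))"
    using onorm_evol_asymptotics by blast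
  have "\<forall>\<^sub>F t in at_right (0::real). onorm (evol t) - (1 - d * t ^ (2 * hc_index C + 1))
      = FP_norm_V0perp C t - (1 - d * t ^ (2 * hc_index C + 1))"
    unfolding eventually_at_right_field by (rule exI[of _ 1]) (auto simp: FP_norm_eq_onorm)
  \<comment> \<open>The identity between the two norms is available for nonnegative times only,
    hence the passage through a one-sided neighbourhood of 0.\<close>
  from landau_o.big.in_cong[OF this] d(2)
  have d': "(\<lambda>t. FP_norm_V0perp C t - (1 - d * t ^ (2 * hc_index C + 1))) \<in> O[at_right 0](\<lambda>t. t ^ (2 * hc_index C + 2))"
    by blast
  show ?thesis
  proof
    assume "hc_index C = m"
    then show "\<exists>c>0. (\<lambda>t. FP_norm_V0perp C t - (1 - c * t ^ (2*m+1))) \<in> O[at_right 0](\<lambda>t. t ^ (2*m+2))"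
      using d(1) d' by blast
  next
    assume "\<exists>c>0. (\<lambda>t. FP_norm_V0perp C t - (1 - c * t ^ (2*m+1))) \<in> O[at_right 0](\<lambda>t. t ^ (2*m+2))"
    then obtain c where c: "0 < c" "(\<lambda>t. FP_norm_V0perp C t - (1 - c * t ^ (2*m+1))) \<in> O[at_right 0](\<lambda>t. t ^ (2*m+2))"
      by blast
    from leading_exponent_unique[OF c d(1) d'] leading_exponent_unique[OF d(1) d' c]
    show "hc_index C = m" by simp
  qed
qed

end
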